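(* Let $1<p<\infty$, let $f\in L^p(T)$, and let $f_a$ be the antisymmetric part of $f$. Then $f_a\in L^p(T_1)$ (that is, the restriction of $f_a$ to $T_1$ lies in $L^p(T_1)$), and $S_N^{T_1}f_a\to f_a$ in $L^p(T_1)$ as $N\to\infty$.
   Context: $T\subset\mathbb{R}^2$ is the equilateral triangle with vertices $(-1/\sqrt3,0)$, $(1/\sqrt3,0)$, $(0,1)$, and $T_1$ is its right-hand half, the hemiequilateral triangle with vertices $(0,0)$, $(1/\sqrt3,0)$, $(0,1)$. Functions are real-valued and $L^p$ is with respect to Lebesgue measure. The antisymmetric part of $f$ is $$f_a(x,y):=\frac{f(x,y)-f(-x,y)}{2},\qquad (x,y)\in T.$$ For integers $0<m<n$ with $m\equiv n \pmod 2$ define $$\begin{aligned}u_{m,n}(x,y)&:=2\sin\left(\frac{\pi m x}{\sqrt{3}}\right)\sin(\pi n y)\\&\quad-2(-1)^{(m+n)/2}\sin\left(\frac{\pi x}{2\sqrt{3}}(m+3n)\right)\sin\left(\frac{\pi y}{2}(m-n)\right)\\&\quad+2(-1)^{(m-n)/2}\sin\left(\frac{\pi x}{2\sqrt{3}}(m-3n)\right)\sin\left(\frac{\pi y}{2}(m+n)\right).\end{aligned}$$ (These are eigenfunctions of the Dirichlet Laplacian on $T_1$, with $\|u_{m,n}\|_{L^2(T_1)}^2=\sqrt3/2$.) The coefficients are $$f_a^{\triangle}(m,n):=\frac{2}{\sqrt3}\int_{T_1}f_a(\xi,\eta)\,u_{m,n}(\xi,\eta)\,d\xi\,d\eta,$$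 the index sets are $\mathcal{U}_N:=\{(m,n)\in\mathbb{Z}^2: 0<m<n\leq N,\ m\equiv n \pmod 2\}$, and the partial sums are $$S_N^{T_1}f_a:=\sum_{(m,n)\in\mathcal{U}_N}f_a^{\triangle}(m,n)\,u_{m,n}.$$ *)

theory Defs
  imports "HOL-Analysis.Analysis"
begin

text \<open>Functions are used as representatives of their almost-everywhere classes.\<close>

definition Lp_space :: "'a measure \<Rightarrow> real \<Rightarrow> ('a \<Rightarrow> real) set" where
  "Lp_space M p = {f \<in> borel_measurable M. integrable M (\<lambda>z. \<bar>f z\<bar> powr p)}"

definition Lp_norm :: "'a measure \<Rightarrow> real \<Rightarrow> ('a \<Rightarrow> real) \<Rightarrow> real" where
  "Lp_norm M p f = (\<integral>z. \<bar>f z\<bar> powr p \<partial>M) powr (1 / p)"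

text \<open>Membership in \<open>L\<^sup>p\<close> is demanded explicitly, because the Bochner integral in the norm
  is \<open>0\<close> for non-integrable arguments.\<close>

definition Lp_converges ::
    "'a measure \<Rightarrow> real \<Rightarrow> (nat \<Rightarrow> 'a \<Rightarrow> real) \<Rightarrow> ('a \<Rightarrow> real) \<Rightarrow> bool" where
  "Lp_converges M p F f \<longleftrightarrow>
     (\<forall>N. F N \<in> Lp_space M p) \<and> f \<in> Lp_space M p \<and>
     (\<lambda>N. Lp_norm M p (\<lambda>z. F N z - f z)) \<longlonglongrightarrow> 0"

definition eq_triangle :: "(real \<times> real) set" where
  "eq_triangle = convex hull {(- 1 / sqrt 3, 0), (1 / sqrt 3, 0), (0, 1)}"

definition hemi_triangle :: "(real \<times> real) set" where
  "hemi_triangle = convex hull {(0, 0), (1 / sqrt 3, 0), (0, 1)}"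

text \<open>The values of the antisymmetric part on \<open>eq_triangle\<close> only depend on those of \<open>f\<close> on
  \<open>eq_triangle\<close>, which is invariant under the reflection.\<close>

definition antisym_part :: "(real \<times> real \<Rightarrow> real) \<Rightarrow> real \<times> real \<Rightarrow> real" where
  "antisym_part f = (\<lambda>(x, y). (f (x, y) - f (- x, y)) / 2)"

text \<open>For \<open>m \<equiv> n\<close> modulo 2 both integer divisions are exact; \<open>(m - n) div 2\<close> is negative for
  \<open>m < n\<close>, hence the integer power.\<close>

definition hemi_eigenfun :: "int \<Rightarrow> int \<Rightarrow> real \<times> real \<Rightarrow> real" where
  "hemi_eigenfun m n = (\<lambda>(x, y).
     2 * sin (pi * of_int m * x / sqrt 3) * sin (pi * of_int n * y)
     - 2 * (- 1) powi ((m + n) div 2)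
         * sin (pi * x / (2 * sqrt 3) * of_int (m + 3 * n)) * sin (pi * y / 2 * of_int (m - n))
     + 2 * (- 1) powi ((m - n) div 2)
         * sin (pi * x / (2 * sqrt 3) * of_int (m - 3 * n)) * sin (pi * y / 2 * of_int (m + n)))"

definition hemi_coeff :: "(real \<times> real \<Rightarrow> real) \<Rightarrow> int \<Rightarrow> int \<Rightarrow> real" where
  "hemi_coeff g m n =
     2 / sqrt 3 * (\<integral>z. g z * hemi_eigenfun m n z \<partial>lebesgue_on hemi_triangle)"

definition hemi_indices :: "nat \<Rightarrow> (int \<times> int) set" where
  "hemi_indices N = {(m, n). 0 < m \<and> m < n \<and> n \<le> int N \<and> m mod 2 = n mod 2}"

lemma finite_hemi_indices: "finite (hemi_indices N)"
  by (rule finite_subset[of _ "{0..int N} \<times> {0..int N}"]) (auto simp: hemi_indices_def)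

definition hemi_partial_sum :: "(real \<times> real \<Rightarrow> real) \<Rightarrow> nat \<Rightarrow> real \<times> real \<Rightarrow> real" where
  "hemi_partial_sum g N z =
     (\<Sum>(m, n)\<in>hemi_indices N. hemi_coeff g m n * hemi_eigenfun m n z)"

end

theory Submission
  imports Defs "HOL-Complex_Analysis.Complex_Analysis"
begin

text \<open>
  In the coordinates \<open>\<alpha> = (1 - y + x / \<surd>3) / 2\<close>, \<open>\<beta> = (1 - y - x / \<surd>3) / 2\<close> the triangle \<open>T\<^sub>1\<close> becomes a
  chamber of a group of affine maps that is generated by reflections and contains the translations by
  \<open>\<int>\<^sup>2\<close>; modulo \<open>\<int>\<^sup>2\<close> the group has twelve elements. With \<open>m = a - b\<close> and \<open>n = a + b\<close>, the
  eigenfunction \<open>u\<^sub>m\<^sub>,\<^sub>n\<close> is, up to the factor \<open>\<plusminus>1/2\<close>, the alternating sum over this group of the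
  character of the torus with frequency \<open>(a, b)\<close>, and the orbit of the index set \<open>\<U>\<^sub>N\<close> is, up to walls
  where these alternating sums vanish, the hexagon
  \<open>\<bar>a\<bar>, \<bar>b\<bar>, \<bar>a + b\<bar> \<le> N\<close>. Hence the partial sum of \<open>f\<^sub>a\<close> is the alternating sum over the group of
  the hexagonal partial sum of the Fourier series of \<open>f\<^sub>a\<close> extended by zero to the unit square. Since
  the images of the open chamber under the nontrivial group elements miss the chamber, it suffices
  that hexagonal partial sums converge in \<open>L\<^sup>p\<close> of the torus.

  The hexagon is an intersection of six half planes, and the half-plane projections reduce, line by
  line, to the Riesz projection on the circle. The latter is bounded for \<open>1 < p \<le> 2\<close>: a positive
  trigonometric polynomial is the real part of a polynomial \<open>F\<close> with positive real part in the disc,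
  the pointwise inequality \<open>\<bar>F\<bar>\<^sup>p \<le> A (Re F)\<^sup>p - B Re (F\<^sup>p)\<close> holds, and the mean of \<open>F\<^sup>p\<close> over the
  circle is \<open>F(0)\<^sup>p > 0\<close>. Duality gives \<open>p > 2\<close>.
\<close>

section \<open>The Riesz projection on the circle\<close>

text \<open>The decisive point is uniformity in \<open>N\<close>, and it comes from the polygonal
  shape of the truncation: each of the six sides costs one constant that does not depend on
  \<open>N\<close>. Two obstacles shape the work on the circle. The positive part of a trigonometric
  polynomial is not a trigonometric polynomial, so positive and negative parts are replaced by
  uniform approximations. The error is small in the supremum norm, but its projection is controlled
  only in L^2, by Parseval; for p <= 2 this still makes it small in L^p. The dual function |P|^(p-2)
  P is no polynomial either and is approximated in the same way. On the triangle, the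
  antisymmetrisation is applied to the partial sums of the zero extension and not to the function
  itself. Throughout, integrals of p-th powers stand in for norms; the triangle inequality then
  carries a factor 2^p, which is harmless because only boundedness and smallness matter.\<close>

definition echar :: "int \<Rightarrow> real \<Rightarrow> complex" where
  "echar k t = cis (2 * pi * of_int k * t)"

lemma norm_echar [simp]: "norm (echar k t) = 1"
  by (simp add: echar_def)

lemma echar_0 [simp]: "echar 0 t = 1"
  by (simp add: echar_def)

lemma echar_add: "echar (j + k) t = echar j t * echar k t"
  by (simp add: echar_def cis_mult algebra_simps)

lemma cnj_echar: "cnj (echar k t) = echar (- k) t"
  by (simp add: echar_def cis_cnj)

lemma continuous_on_echar [continuous_intros]:
  "continuous_on S g \<Longrightarrow> continuous_on S (\<lambda>x. echar k (g x))"
  unfolding echar_def by (intro continuous_intros)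

lemma cis_of_int_eq: "cis (2 * pi * of_int k) = 1"
  by (rule cis_multiple_2pi) simp

lemma echar_of_int [simp]: "echar k (of_int j) = 1"
  using cis_of_int_eq[of "k * j"] by (simp add: echar_def mult.assoc)

lemma echar_plus: "echar k (s + t) = echar k s * echar k t"
  by (simp add: echar_def cis_mult algebra_simps)

lemma echar_plus_one: "echar k (t + 1) = echar k t"
  using echar_of_int[of k 1] by (simp add: echar_plus)

lemma echar_power: "echar (int n) t = cis (2 * pi * t) ^ n"
  by (simp add: echar_def Complex.DeMoivre mult_ac)

lemma has_integral_echar: "(echar k has_integral (if k = 0 then 1 else 0)) {0..1}"
proof (cases "k = 0")
  case True
  then have "echar k = (\<lambda>_. 1)" by auto
  then show ?thesis
    using has_integral_const_real[of "1::complex" 0 1] True by simp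
next
  case False
  define w where "w = 2 * pi * of_int k"
  have w: "w \<noteq> 0" using False by (simp add: w_def)
  have "((\<lambda>t. cis (w * t) / (\<i> * w)) has_vector_derivative echar k t) (at t within {0..1})" for t
    unfolding echar_def w_def[symmetric] cis_conv_exp has_real_derivative_iff_has_vector_derivative
    using w
    by (auto intro!: derivative_eq_intros has_vector_derivative_real_field simp: field_simps)
  then have "(echar k has_integral cis (w * 1) / (\<i> * w) - cis (w * 0) / (\<i> * w)) {0..1}"
    by (intro fundamental_theorem_of_calculus) auto
  moreover have "cis w = 1" unfolding w_def by (rule cis_of_int_eq)
  ultimately show ?thesis using False by simp
qed

abbreviation trig_sum :: "nat \<Rightarrow> (int \<Rightarrow> complex) \<Rightarrow> real \<Rightarrow> complex" where
  "trig_sum D c \<equiv> \<lambda>t. \<Sum>k\<in>{- int D..int D}. c k * echar k t"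

abbreviation analytic_sum :: "nat \<Rightarrow> (int \<Rightarrow> complex) \<Rightarrow> real \<Rightarrow> complex" where
  "analytic_sum D c \<equiv> \<lambda>t. \<Sum>k\<in>{0..int D}. c k * echar k t"

text \<open>Cauchy's integral formula at the centre; with the parameter in [0, 1] the integral is
  the mean over the circle. The open set \<open>U\<close> is left free because the p-th power of a
  polynomial is used only where its real part is positive.\<close>

lemma circle_mean_value:
  assumes "f holomorphic_on U" "open U" "cball 0 1 \<subseteq> U"
  shows "((\<lambda>t. f (cis (2 * pi * t))) has_integral f 0) {0..1}"
proof -
  have "((\<lambda>u. f u / (u - 0)) has_contour_integral (2 * of_real pi * \<i> * f 0)) (circlepath 0 1)"
    using assms by (intro Cauchy_integral_circlepath_simple) (auto intro: holomorphic_on_subset)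
  then have "((\<lambda>t. f (circlepath 0 1 t) / circlepath 0 1 t * vector_derivative (circlepath 0 1) (at t within {0..1}))
      has_integral (2 * of_real pi * \<i> * f 0)) {0..1}"
    by (simp add: has_contour_integral_def)
  then have "((\<lambda>t. (2 * of_real pi * \<i>) * f (cis (2 * pi * t))) has_integral (2 * of_real pi * \<i> * f 0)) {0..1}"
  proof (rule has_integral_eq[rotated])
    fix t :: real assume t: "t \<in> {0..1}"
    have c: "circlepath 0 1 t = cis (2 * pi * t)" by (simp add: circlepath cis_conv_exp mult_ac)
    show "f (circlepath 0 1 t) / circlepath 0 1 t * vector_derivative (circlepath 0 1) (at t within {0..1})
      = (2 * of_real pi * \<i>) * f (cis (2 * pi * t))"
      using t by (subst vector_derivative_circlepath01) (auto simp: c cis_conv_exp mult_ac)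
  qed
  from has_integral_mult_right[OF this, of "inverse (2 * of_real pi * \<i>)"] show ?thesis
    by (simp add: field_simps)
qed

section \<open>Projection of positive trigonometric polynomials\<close>

text \<open>In polar form, with x the modulus of the argument, the claim is 1 <= A cos(x)^p - B
  cos(p x) for 0 <= x < pi/2. Away from pi/2 the first cosine is bounded below; near pi/2 it
  degenerates, but there cos(p x) is negative.\<close>

lemma powr_real_part_inequality:
  fixes p :: real
  assumes "1 < p" "p \<le> 2"
  obtains A B where "A \<ge> 0" "B \<ge> 0"
    "\<And>w. Re w > 0 \<Longrightarrow> norm w powr p \<le> A * Re w powr p - B * Re (w powr of_real p)"
proof -
  \<comment> \<open>The splitting angle is the midpoint of pi/(2p), where cos(p x) changes sign, and
    pi/2. \<open>B\<close> is normalised by B cos(p \<phi>) = -1, and then \<open>A\<close> by A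
    cos(\<phi>)^p = 1 + B, which absorbs the bound B cos(p x) <= B.\<close>
  define \<phi> where "\<phi> = pi * (p + 1) / (4 * p)"
  define B where "B = 1 / - cos (p * \<phi>)"
  define A where "A = (1 + B) / cos \<phi> powr p"
  have pp: "p * \<phi> = pi * (p + 1) / 4" using assms by (simp add: \<phi>_def)
  have "pi / 2 < p * \<phi>" "p * \<phi> < pi" 
    unfolding pp using assms by (auto simp: field_simps)
  then have cn: "cos (p * \<phi>) < 0"
    using cos_gt_zero_pi[of "pi - p * \<phi>"] by simp
  have \<phi>: "0 < \<phi>" "\<phi> < pi / 2"
    using assms by (auto simp: \<phi>_def field_simps intro!: divide_pos_pos add_pos_pos mult_pos_pos)
  then have cp: "cos \<phi> > 0" by (intro cos_gt_zero)  auto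
  have B: "B > 0" using cn by (simp add: B_def)
  have A: "A \<ge> 0" using B by (simp add: A_def)
  have key: "1 \<le> A * cos x powr p - B * cos (p * x)" if "0 \<le> x" "x < pi / 2" for x
  proof (cases "x \<le> \<phi>")
    case True
    have "cos \<phi> \<le> cos x" using True that \<phi> by (intro cos_monotone_0_pi_le) auto
    then have "cos \<phi> powr p \<le> cos x powr p" using cp assms by (intro powr_mono2) auto
    then have "A * cos \<phi> powr p \<le> A * cos x powr p" using A by (intro mult_left_mono)
    moreover have "A * cos \<phi> powr p = 1 + B" using cp by (simp add: A_def)
    moreover have "B * cos (p * x) \<le> B * 1" using B by (intro mult_left_mono) auto
    ultimately show ?thesis by linarith
  next
    case False
    have "p * x \<le> p * (pi / 2)" using that assms by (intro mult_left_mono) auto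
    \<comment> \<open>Here p <= 2 enters: the angle p x stays in [0, pi], where the cosine
      decreases.\<close>
    also have "\<dots> \<le> 2 * (pi/2)" using assms by (intro mult_right_mono) auto
    finally have "p * x \<le> pi" by simp
    moreover have "p * \<phi> \<le> p * x" using False assms by (intro mult_left_mono) auto
    ultimately have "cos (p * x) \<le> cos (p * \<phi>)"
      using \<phi> assms by (intro cos_monotone_0_pi_le) auto
    then have "B * cos (p * x) \<le> B * cos (p * \<phi>)" using B by (intro mult_left_mono) auto
    moreover have "B * cos (p * \<phi>) = -1" using cn by (simp add: B_def)
    moreover have "A * cos x powr p \<ge> 0" using A by simp
    ultimately show ?thesis by linarith
  qed
  have "norm w powr p \<le> A * Re w powr p - B * Re (w powr of_real p)" if w: "Re w > 0" for w
  proof -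
    have w0: "w \<noteq> 0" using w by auto
    define x where "x = \<bar>Im (Ln w)\<bar>"
    have x: "0 \<le> x" "x < pi / 2"
      using Re_Ln_pos_lt[OF w0] w by (auto simp: x_def)
    have c: "cos x = cos (Im (Ln w))" "cos (p * x) = cos (p * Im (Ln w))"
      by (auto simp: x_def abs_if)
    have "Re w = norm w * cos x"
      using exp_Ln[OF w0] w0 by (metis Re_exp c(1) norm_exp_eq_Re)
    then have rw: "Re w powr p = norm w powr p * cos x powr p"
      using x by (simp add: powr_mult cos_ge_zero)
    have "Re (w powr of_real p) = norm w powr p * cos (p * x)"
      using w0 unfolding c by (simp add: powr_def Re_exp)
    then have "A * Re w powr p - B * Re (w powr of_real p)
        = norm w powr p * (A * cos x powr p - B * cos (p * x))"
      by (simp add: rw algebra_simps)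
    also have "\<dots> \<ge> norm w powr p * 1"
      using key[OF x] by (intro mult_left_mono) auto
    finally show ?thesis by simp
  qed
  with A B show ?thesis using that[of A B] by auto
qed

lemma sum_symmetric_int:
  fixes g :: "int \<Rightarrow> 'a::comm_monoid_add"
  shows "(\<Sum>k\<in>{- int D..int D}. g k) = g 0 + (\<Sum>k=1..D. g (int k) + g (- int k))"
proof (induction D)
  case (Suc D)
  have "{- int (Suc D)..int (Suc D)} = insert (int (Suc D)) (insert (- int (Suc D)) {- int D..int D})"
    by auto
  then show ?case using Suc by (simp add: add_ac)
qed auto

lemma sum_nonneg_int:
  fixes g :: "int \<Rightarrow> 'a::comm_monoid_add"
  shows "(\<Sum>k\<in>{0..int D}. g k) = g 0 + (\<Sum>k=1..D. g (int k))"
proof (induction D)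
  case (Suc D)
  have "{0..int (Suc D)} = insert (int (Suc D)) {0..int D}"
    by auto
  then show ?case using Suc by (simp add: add_ac)
qed auto

lemma powr_add_le:
  fixes a b p :: real
  assumes "0 \<le> a" "0 \<le> b" "0 < p"
  shows "(a + b) powr p \<le> 2 powr p * (a powr p + b powr p)"
proof -
  have "(a + b) powr p \<le> (2 * max a b) powr p" using assms by (intro powr_mono2) auto
  also have "\<dots> = 2 powr p * max a b powr p" using assms by (simp add: powr_mult)
  also have "\<dots> \<le> 2 powr p * (a powr p + b powr p)"
    by (intro mult_left_mono) (auto simp: max_def)
  finally show ?thesis .
qed

text \<open>The hypothesis on \<open>c\<close> says that the trigonometric sum is real-valued. Its
  analytic half is (F + c 0) / 2, and the mean value of F^p bounds (c 0)^p by the integral of |F|^p;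
  so the constant is twice the \<open>A\<close> of the pointwise inequality, whatever the degree
  \<open>D\<close>.\<close>

lemma Riesz_positive:
  fixes p :: real
  assumes p: "1 < p" "p \<le> 2"
  obtains C where "C \<ge> 0"
    "\<And>c D. \<lbrakk>\<And>k. c (- k) = cnj (c k);
        \<And>t. Re (trig_sum D c t) > 0\<rbrakk>
      \<Longrightarrow> integral {0..1} (\<lambda>t. norm (analytic_sum D c t) powr p)
        \<le> C * integral {0..1} (\<lambda>t. norm (trig_sum D c t) powr p)"
proof -
  obtain A B where A: "A \<ge> 0" and B: "B \<ge> 0"
    and AB: "\<And>w. Re w > 0 \<Longrightarrow> norm w powr p \<le> A * Re w powr p - B * Re (w powr of_real p)"
    using powr_real_part_inequality[OF p] by metis
  have "integral {0..1} (\<lambda>t. norm (analytic_sum D c t) powr p)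
        \<le> (2 * A) * integral {0..1} (\<lambda>t. norm (trig_sum D c t) powr p)"
    if c: "\<And>k. c (- k) = cnj (c k)" and
       pos: "\<And>t. Re (trig_sum D c t) > 0" for c D
  proof -
    define q where "q t = (trig_sum D c t)" for t
    define r where "r t = (analytic_sum D c t)" for t
    define F where "F z = c 0 + 2 * (\<Sum>k=1..D. c (int k) * z ^ k)" for z :: complex
    define G where "G t = F (cis (2 * pi * t))" for t
    have Im0: "Im (c 0) = 0" using c[of 0] by (simp add: complex_eq_iff)
    have Freal: "Re (G t) = Re (q t)" for t
    proof -
      define w where "w k = c (int k) * echar (int k) t" for k
      have "q t = c 0 + (\<Sum>k=1..D. w k + cnj (w k))"
        unfolding q_def w_def sum_symmetric_int by (simp add: c cnj_echar)
      moreover have "G t = c 0 + 2 * (\<Sum>k=1..D. w k)"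
        by (simp add: G_def F_def echar_power w_def)
      ultimately show ?thesis by (simp add: sum.distrib)
    qed
    have rF: "r t = (G t + c 0) / 2" for t
      unfolding r_def sum_nonneg_int by (simp add: G_def F_def echar_power)
    have holF: "F holomorphic_on S" for S
      unfolding F_def by (intro holomorphic_intros)
    have contF: "continuous_on S F" for S
      using holF by (rule holomorphic_on_imp_continuous_on)
    \<comment> \<open>The minimum of Re F over the circle is attained, hence positive; the maximum
      principle for -F carries this lower bound to the closed disc.\<close>
    obtain z0 where z0: "z0 \<in> sphere 0 1" "\<And>z. z \<in> sphere 0 1 \<Longrightarrow> Re (F z0) \<le> Re (F z)"
    proof -
      have "continuous_on (sphere 0 1) (\<lambda>z. Re (F z))" by (intro continuous_intros contF)
      moreover have "sphere (0::complex) 1 \<noteq> {}" by simp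
      ultimately show ?thesis
        using continuous_attains_inf[of "sphere 0 1" "\<lambda>z. Re (F z)"] that
        by (metis compact_sphere)
    qed
    have sph: "\<exists>t. z = cis (2 * pi * t)" if "z \<in> sphere 0 1" for z
    proof -
      have "z = cis (2 * pi * (Arg z / (2 * pi)))"
        using that cis_Arg[of z] by (cases "z = 0") (auto simp: sgn_div_norm)
      then show ?thesis ..
    qed
    have m0: "Re (F z0) > 0"
      using sph[OF z0(1)] pos Freal unfolding G_def q_def by force
    have FU: "Re (F z) > 0" if "z \<in> cball 0 1" for z
    proof -
      have "Re (- F z) \<le> - Re (F z0)"
        by (rule maximum_real_frontier[of "\<lambda>z. - F z" "cball 0 1"])
           (use that z0 in \<open>auto intro!: holomorphic_intros continuous_intros holF contF\<close>)
      then show ?thesis using m0 by simp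
    qed
    \<comment> \<open>An open neighbourhood of the closed disc on which the principal p-th power of
      F is holomorphic.\<close>
    define U where "U = {z. Re (F z) > 0}"
    have U: "open U"
      unfolding U_def by (intro open_Collect_less continuous_intros contF)
    have mv: "((\<lambda>t. G t powr of_real p) has_integral F 0 powr of_real p) {0..1}"
      unfolding G_def
    proof (rule circle_mean_value[of "\<lambda>z. F z powr of_real p" U])
      show "(\<lambda>z. F z powr of_real p) holomorphic_on U"
        by (intro holomorphic_intros holF) (auto simp: U_def complex_nonpos_Reals_iff)
      show "cball 0 1 \<subseteq> U" using FU by (auto simp: U_def)
    qed (use U in auto)
    have "Re (F 0) > 0" using FU[of 0] by simp
    have F0: "F 0 = of_real (Re (c 0))" using Im0 by (simp add: F_def complex_eq_iff)
    have c0: "Re (c 0) > 0" using \<open>Re (F 0) > 0\<close> F0 by simp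
    then have F0p: "Re (F 0 powr of_real p) = Re (c 0) powr p"
      unfolding F0 by (subst powr_of_real) auto
    have mvR: "((\<lambda>t. Re (G t powr of_real p)) has_integral Re (c 0) powr p) {0..1}"
      using has_integral_Re[OF mv] F0p by simp
    have contG: "continuous_on {0..1} G"
      unfolding G_def by (intro continuous_on_compose2[OF contF[of UNIV]] continuous_intros) auto
    have contq: "continuous_on {0..1} q" "continuous_on {0..1} r"
      unfolding q_def r_def by (intro continuous_intros)+
    have p0: "p > 0" using p by simp
    have iG: "(\<lambda>t. norm (G t) powr p) integrable_on {0..1}"
      using p0 by (intro integrable_continuous_interval continuous_on_powr' continuous_intros contG) auto
    have iq: "(\<lambda>t. norm (q t) powr p) integrable_on {0..1}"
      using p0 by (intro integrable_continuous_interval continuous_on_powr' continuous_intros contq) auto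
    have ir: "(\<lambda>t. norm (r t) powr p) integrable_on {0..1}"
      using p0 by (intro integrable_continuous_interval continuous_on_powr' continuous_intros contq) auto
    have "integral {0..1} (\<lambda>t. norm (G t) powr p)
        \<le> integral {0..1} (\<lambda>t. A * norm (q t) powr p - B * Re (G t powr of_real p))"
    proof (rule integral_le[OF iG])
      show "(\<lambda>t. A * norm (q t) powr p - B * Re (G t powr of_real p)) integrable_on {0..1}"
        using iq mvR by (intro integrable_diff integrable_on_mult_right) auto
      fix t :: real
      have "norm (G t) powr p \<le> A * Re (q t) powr p - B * Re (G t powr of_real p)"
        using AB[of "G t"] pos[of t] by (simp add: Freal q_def)
      also have "A * Re (q t) powr p \<le> A * norm (q t) powr p"
        using A pos[of t] p complex_Re_le_cmod[of "q t"] unfolding q_def[symmetric]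
        by (intro mult_left_mono powr_mono2) auto
      finally show "norm (G t) powr p \<le> A * norm (q t) powr p - B * Re (G t powr of_real p)" by simp
    qed
    also have "\<dots> = A * integral {0..1} (\<lambda>t. norm (q t) powr p) - B * Re (c 0) powr p"
      using iq mvR by (subst integral_diff) (auto intro: integrable_on_mult_right simp: integral_unique)
    also have "\<dots> \<le> A * integral {0..1} (\<lambda>t. norm (q t) powr p)" using B by simp
    finally have *: "integral {0..1} (\<lambda>t. norm (G t) powr p) \<le> A * integral {0..1} (\<lambda>t. norm (q t) powr p)" .
    have **: "Re (c 0) powr p \<le> integral {0..1} (\<lambda>t. norm (G t) powr p)"
    proof (rule has_integral_le[OF mvR])
      show "((\<lambda>t. norm (G t) powr p) has_integral integral {0..1} (\<lambda>t. norm (G t) powr p)) {0..1}"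
        using iG by blast
      fix t :: real
      have "Re (G t powr of_real p) \<le> norm (G t powr of_real p)" by (rule complex_Re_le_cmod)
      then show "Re (G t powr of_real p) \<le> norm (G t) powr p" by (simp add: norm_powr_real_powr')
    qed
    have "integral {0..1} (\<lambda>t. norm (r t) powr p)
        \<le> integral {0..1} (\<lambda>t. norm (G t) powr p + Re (c 0) powr p)"
    proof (rule integral_le[OF ir])
      show "(\<lambda>t. norm (G t) powr p + Re (c 0) powr p) integrable_on {0..1}"
        by (intro integrable_add iG) auto
      fix t :: real
      have "norm (r t) \<le> (norm (G t) + norm (c 0)) / 2"
        unfolding rF by (simp add: norm_divide norm_triangle_ineq divide_right_mono)
      also have "norm (c 0) = Re (c 0)" using c0 Im0 by (simp add: cmod_eq_Re)
      finally have "norm (r t) \<le> max (norm (G t)) (Re (c 0))" by (simp add: max_def)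
      then have "norm (r t) powr p \<le> max (norm (G t)) (Re (c 0)) powr p"
        using p by (intro powr_mono2) auto
      also have "\<dots> \<le> norm (G t) powr p + Re (c 0) powr p" by (auto simp: max_def)
      finally show "norm (r t) powr p \<le> norm (G t) powr p + Re (c 0) powr p" .
    qed
    also have "\<dots> = integral {0..1} (\<lambda>t. norm (G t) powr p) + Re (c 0) powr p"
      by (subst integral_add) (use iG in auto)
    also have "\<dots> \<le> (2 * A) * integral {0..1} (\<lambda>t. norm (q t) powr p)"
      using * ** by simp
    finally show ?thesis unfolding q_def r_def .
  qed
  with A show ?thesis using that[of "2 * A"] by auto
qed

section \<open>Trigonometric polynomials and uniform approximation\<close>

definition torus_char :: "int \<times> int \<Rightarrow> real \<times> real \<Rightarrow> complex" where
  "torus_char k z = echar (fst k) (fst z) * echar (snd k) (snd z)"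

text \<open>Generation by single characters and sums makes closure under products, and the passage
  from polynomial functions, plain inductions; \<open>trig_polys_sum_rep\<close> recovers the finite
  sum.\<close>

inductive_set trig_polys :: "(real \<times> real \<Rightarrow> complex) set" where
  char: "(\<lambda>z. c * torus_char k z) \<in> trig_polys"
| add: "f \<in> trig_polys \<Longrightarrow> g \<in> trig_polys \<Longrightarrow> (\<lambda>z. f z + g z) \<in> trig_polys"

lemma trig_polys_const: "(\<lambda>z. c) \<in> trig_polys"
  using trig_polys.char[of c "(0, 0)"] by (simp add: torus_char_def)

lemma trig_polys_mult:
  assumes "f \<in> trig_polys" "g \<in> trig_polys"
  shows "(\<lambda>z. f z * g z) \<in> trig_polys"
  using assms(1)
proof induction
  case (char c k)
  show ?case using assms(2)
  proof induction
    case (char d l)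
    have "(\<lambda>z. (c * d) * torus_char (k + l) z) \<in> trig_polys" by (rule trig_polys.char)
    then show ?case by (simp add: torus_char_def echar_add mult_ac)
  qed (auto simp: algebra_simps intro: trig_polys.add)
qed (auto simp: algebra_simps intro: trig_polys.add)

lemma trig_polys_cmult: "f \<in> trig_polys \<Longrightarrow> (\<lambda>z. c * f z) \<in> trig_polys"
  using trig_polys_mult trig_polys_const by blast

abbreviation torus_sum :: "(int \<times> int) set \<Rightarrow> (int \<times> int \<Rightarrow> complex) \<Rightarrow> real \<times> real \<Rightarrow> complex" where
  "torus_sum S c \<equiv> \<lambda>z. \<Sum>k\<in>S. c k * torus_char k z"

lemma trig_polys_sum_rep:
  assumes "f \<in> trig_polys"
  obtains S c where "finite S" "f = (torus_sum S c)"
proof -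
  have "\<exists>S c. finite S \<and> f = (torus_sum S c)"
    using assms
  proof induction
    case (char c k)
    then show ?case by (intro exI[of _ "{k}"] exI[of _ "\<lambda>_. c"]) simp
  next
    case (add f g)
    then obtain S c T d where ST: "finite S" "finite T"
      and fg: "f = (torus_sum S c)" "g = (\<lambda>z. \<Sum>k\<in>T. d k * torus_char k z)"
      by auto
    have "f z + g z = (\<Sum>k\<in>S \<union> T. ((if k \<in> S then c k else 0) + (if k \<in> T then d k else 0)) * torus_char k z)" for z
    proof -
      have "f z = (\<Sum>k\<in>S \<union> T. (if k \<in> S then c k else 0) * torus_char k z)"
        unfolding fg using ST by (intro sum.mono_neutral_cong_left) auto
      moreover have "g z = (\<Sum>k\<in>S \<union> T. (if k \<in> T then d k else 0) * torus_char k z)"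
        unfolding fg using ST by (intro sum.mono_neutral_cong_left) auto
      ultimately show ?thesis by (simp add: sum.distrib algebra_simps)
    qed
    then show ?case using ST
      by (intro exI[of _ "S \<union> T"] exI[of _ "\<lambda>k. (if k \<in> S then c k else 0) + (if k \<in> T then d k else 0)"]) auto
  qed
  then show ?thesis using that by auto
qed

text \<open>The torus as a product of two unit circles, a compact set in a Euclidean space, so that
  the Stone-Weierstrass theorem for polynomial functions applies.\<close>

abbreviation torus_point :: "real \<times> real \<Rightarrow> complex \<times> complex" where
  "torus_point z \<equiv> (cis (2 * pi * fst z), cis (2 * pi * snd z))"

text \<open>On the two circles a real-linear functional is a combination of the sines and cosines of
  both angles, hence of characters with frequencies 1 and -1; sums and products stay in the
  algebra.\<close>

lemma real_polynomial_trig_poly: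
  fixes h :: "complex \<times> complex \<Rightarrow> real"
  assumes "real_polynomial_function h"
  shows "(\<lambda>z. complex_of_real (h (torus_point z))) \<in> trig_polys"
  using assms
proof induction
  case (linear f)
  interpret f: bounded_linear f by fact
  have eq: "f (z, w) = Re z * f (1, 0) + Im z * f (\<i>, 0) + Re w * f (0, 1) + Im w * f (0, \<i>)" for z w
  proof -
    have "(z, w) = Re z *\<^sub>R (1, 0) + Im z *\<^sub>R (\<i>, 0) + Re w *\<^sub>R (0, 1) + Im w *\<^sub>R (0, \<i>)"
      by (simp add: complex_eq_iff)
    then have "f (z, w) = f (Re z *\<^sub>R (1, 0) + Im z *\<^sub>R (\<i>, 0) + Re w *\<^sub>R (0, 1) + Im w *\<^sub>R (0, \<i>))"
      by simp
    also have "\<dots> = Re z * f (1, 0) + Im z * f (\<i>, 0) + Re w * f (0, 1) + Im w * f (0, \<i>)"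
      by (simp only: f.add f.scaleR real_scaleR_def)
    finally show ?thesis .
  qed
  have c: "complex_of_real (cos (2 * pi * t)) = (1/2) * echar 1 t + (1/2) * echar (-1) t"
       "complex_of_real (sin (2 * pi * t)) = (- \<i>/2) * echar 1 t + (\<i>/2) * echar (-1) t" for t
    by (auto simp: echar_def complex_eq_iff)
  have e1: "(\<lambda>z. (a * echar 1 (fst z)) :: complex) \<in> trig_polys"
    "(\<lambda>z. (a * echar (-1) (fst z)) :: complex) \<in> trig_polys" for a
    using trig_polys.char[of a "(1,0)"] trig_polys.char[of a "(-1,0)"] by (auto simp: torus_char_def)
  have 1: "(\<lambda>z. complex_of_real (cos (2 * pi * fst z))) \<in> trig_polys"
    "(\<lambda>z. complex_of_real (sin (2 * pi * fst z))) \<in> trig_polys"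
    unfolding c by (rule trig_polys.add[OF e1(1) e1(2)])+
  have e2: "(\<lambda>z. (a * echar 1 (snd z)) :: complex) \<in> trig_polys"
    "(\<lambda>z. (a * echar (-1) (snd z)) :: complex) \<in> trig_polys" for a
    using trig_polys.char[of a "(0,1)"] trig_polys.char[of a "(0,-1)"] by (auto simp: torus_char_def)
  have 2: "(\<lambda>z. complex_of_real (cos (2 * pi * snd z))) \<in> trig_polys"
    "(\<lambda>z. complex_of_real (sin (2 * pi * snd z))) \<in> trig_polys"
    unfolding c by (rule trig_polys.add[OF e2(1) e2(2)])+
  have "(\<lambda>z. of_real (f (1, 0)) * of_real (cos (2 * pi * fst z)) + of_real (f (\<i>, 0)) * of_real (sin (2 * pi * fst z))
      + of_real (f (0, 1)) * of_real (cos (2 * pi * snd z)) + of_real (f (0, \<i>)) * complex_of_real (sin (2 * pi * snd z))) \<in> trig_polys"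
    by (intro trig_polys.add trig_polys_cmult 1 2)
  moreover have "complex_of_real (f (torus_point z))
    = of_real (f (1, 0)) * of_real (cos (2 * pi * fst z)) + of_real (f (\<i>, 0)) * of_real (sin (2 * pi * fst z))
      + of_real (f (0, 1)) * of_real (cos (2 * pi * snd z)) + of_real (f (0, \<i>)) * of_real (sin (2 * pi * snd z))"
    for z :: "real \<times> real"
    by (simp add: eq[of "cis (2 * pi * fst z)" "cis (2 * pi * snd z)"])
  ultimately show ?case by presburger
next
  case (const c)
  show ?case by (rule trig_polys_const)
next
  case (add f g)
  then show ?case by (simp add: trig_polys.add)
next
  case (mult f g)
  then show ?case by (simp add: trig_polys_mult)
qed

lemma torus_Stone_Weierstrass_real:
  fixes \<Phi> :: "complex \<times> complex \<Rightarrow> real"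
  assumes "continuous_on (sphere 0 1 \<times> sphere 0 1) \<Phi>" "e > 0"
  obtains g where "(\<lambda>z. complex_of_real (g z)) \<in> trig_polys"
    "\<And>z. \<bar>g z - \<Phi> (torus_point z)\<bar> < e"
proof -
  have "compact (sphere (0::complex) 1 \<times> sphere (0::complex) 1)" by (intro compact_Times compact_sphere)
  from Stone_Weierstrass_real_polynomial_function[OF this assms]
  obtain h where h: "real_polynomial_function h"
    and he: "\<And>x. x \<in> sphere 0 1 \<times> sphere 0 1 \<Longrightarrow> \<bar>\<Phi> x - h x\<bar> < e" by blast
  show ?thesis
    by (rule that[of "\<lambda>z. h (torus_point z)"])
       (use real_polynomial_trig_poly[OF h] he in \<open>auto simp: abs_minus_commute\<close>)
qed

lemma torus_Stone_Weierstrass: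
  fixes \<Phi> :: "complex \<times> complex \<Rightarrow> complex"
  assumes "continuous_on (sphere 0 1 \<times> sphere 0 1) \<Phi>" "e > 0"
  obtains g where "g \<in> trig_polys"
    "\<And>z. norm (g z - \<Phi> (torus_point z)) < e"
proof -
  obtain g where g: "(\<lambda>z. complex_of_real (g z)) \<in> trig_polys"
    "\<And>z. \<bar>g z - Re (\<Phi> (torus_point z))\<bar> < e / 2"
    using assms(2) by (rule_tac torus_Stone_Weierstrass_real[of "\<lambda>x. Re (\<Phi> x)" "e/2"])
      (auto intro!: continuous_intros assms(1))
  obtain h where h: "(\<lambda>z. complex_of_real (h z)) \<in> trig_polys"
    "\<And>z. \<bar>h z - Im (\<Phi> (torus_point z))\<bar> < e / 2"
    using assms(2) by (rule_tac torus_Stone_Weierstrass_real[of "\<lambda>x. Im (\<Phi> x)" "e/2"])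
      (auto intro!: continuous_intros assms(1))
  show ?thesis
  proof (rule that[of "\<lambda>z. complex_of_real (g z) + \<i> * complex_of_real (h z)"])
    show "(\<lambda>z. complex_of_real (g z) + \<i> * complex_of_real (h z)) \<in> trig_polys"
      by (intro trig_polys.add trig_polys_cmult g h)
    fix z
    let ?w = "complex_of_real (g z) + \<i> * complex_of_real (h z) - \<Phi> (torus_point z)"
    have "norm ?w \<le> \<bar>Re ?w\<bar> + \<bar>Im ?w\<bar>" by (rule cmod_le)
    also have "\<dots> < e" using g(2)[of z] h(2)[of z] by simp
    finally show "norm ?w < e" .
  qed
qed

text \<open>Terms of equal frequency \<open>l k\<close> are collected. The cut \<open>P\<close>
  depends on the frequency alone and so survives the regrouping; a sum over an arbitrary index set
  becomes an ordinary trigonometric sum.\<close>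

lemma sum_echar_group:
  fixes l :: "'a \<Rightarrow> int" and d :: "'a \<Rightarrow> complex"
  assumes S: "finite S" and D: "l ` S \<subseteq> {- int D..int D}"
  shows "(\<Sum>k\<in>{k\<in>S. P (l k)}. d k * echar (l k) t)
    = (\<Sum>j\<in>{j\<in>{- int D..int D}. P j}. (\<Sum>k\<in>{k\<in>S. l k = j}. d k) * echar j t)"
proof -
  have "finite {j\<in>{- int D..int D}. P j}"
    by (rule finite_subset[of _ "{- int D..int D}"]) auto
  then have "(\<Sum>k\<in>{k\<in>S. P (l k)}. d k * echar (l k) t)
    = (\<Sum>j\<in>{j\<in>{- int D..int D}. P j}. \<Sum>k\<in>{k\<in>{k\<in>S. P (l k)}. l k = j}. d k * echar (l k) t)"
    using S D by (intro sum.group[symmetric]) auto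
  also have "\<dots> = (\<Sum>j\<in>{j\<in>{- int D..int D}. P j}. (\<Sum>k\<in>{k\<in>S. l k = j}. d k) * echar j t)"
    unfolding sum_distrib_right by (intro sum.cong refl) auto
  finally show ?thesis .
qed

lemma finite_int_set_bound:
  assumes "finite (A :: int set)"
  obtains D where "D \<ge> D0" "A \<subseteq> {- int D..int D}"
proof -
  define B where "B = Max (insert 0 (abs ` A))"
  have B: "\<bar>a\<bar> \<le> B" if "a \<in> A" for a
    using that assms by (auto simp: B_def intro!: Max_ge)
  show ?thesis
    by (rule that[of "max D0 (nat B)"]) (use B in \<open>fastforce\<close>)+
qed

lemma Re_trig_poly:
  "complex_of_real (Re (trig_sum D c t))
    = (\<Sum>k\<in>{- int D..int D}. ((c k + cnj (c (- k))) / 2) * echar k t)"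
proof -
  define q where "q = (trig_sum D c t)"
  have "cnj q = (\<Sum>k\<in>{- int D..int D}. cnj (c k) * echar (- k) t)"
    by (simp add: q_def cnj_echar)
  also have "\<dots> = (\<Sum>k\<in>{- int D..int D}. cnj (c (- k)) * echar k t)"
    by (rule sum.reindex_bij_witness[of _ uminus uminus]) auto
  finally have "(q + cnj q) / 2 = (\<Sum>k\<in>{- int D..int D}. ((c k + cnj (c (- k))) / 2) * echar k t)"
    unfolding q_def by (simp add: sum.distrib[symmetric] sum_divide_distrib field_simps)
  moreover have "(q + cnj q) / 2 = of_real (Re q)" by (simp add: complex_eq_iff)
  ultimately show ?thesis by (simp add: q_def)
qed

text \<open>The torus version for a function of the first coordinate, with the second coordinate set
  to 0. The prescribed lower bound \<open>D0\<close> for the degree lets several approximants be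
  compared at one common degree.\<close>

lemma circle_Stone_Weierstrass:
  fixes \<Phi> :: "complex \<Rightarrow> complex"
  assumes "continuous_on (sphere 0 1) \<Phi>" "e > 0"
  obtains c D where "D \<ge> D0"
    "\<And>t. norm ((trig_sum D c t) - \<Phi> (cis (2 * pi * t))) < e"
proof -
  obtain g where g: "g \<in> trig_polys"
    "\<And>z. norm (g z - \<Phi> (cis (2 * pi * fst z))) < e"
  proof (rule torus_Stone_Weierstrass[of "\<lambda>x. \<Phi> (fst x)" e])
    show "continuous_on (sphere 0 1 \<times> sphere 0 1) (\<lambda>x::complex \<times> complex. \<Phi> (fst x))"
      by (intro continuous_on_compose2[OF assms(1)] continuous_intros) auto
  qed (use assms in auto)
  obtain S c where S: "finite S" and gS: "g = (torus_sum S c)"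
    using trig_polys_sum_rep[OF g(1)] by metis
  obtain D where D: "D \<ge> D0" "fst ` S \<subseteq> {- int D..int D}"
    using finite_int_set_bound[of "fst ` S"] S by blast
  define d where "d j = (\<Sum>k\<in>{k\<in>S. fst k = j}. c k)" for j
  have gt: "g (t, 0) = (trig_sum D d t)" for t
  proof -
    have "g (t, 0) = (\<Sum>k\<in>S. c k * echar (fst k) t)"
      using echar_of_int[of _ 0] by (simp add: gS torus_char_def)
    then show ?thesis
      using sum_echar_group[OF S D(2), where P = "\<lambda>_. True" and d = c and t = t]
      unfolding d_def by (simp del: atLeastAtMost_iff)
  qed
  show ?thesis
    using D(1) g(2)[of "(_, 0)"] by (intro that[of D d]) (auto simp: gt)
qed

text \<open>Taking the real part of an approximant makes its coefficients Hermitian and does not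
  increase its distance from a real function.\<close>

lemma circle_Stone_Weierstrass_real:
  fixes \<Phi> :: "complex \<Rightarrow> real"
  assumes "continuous_on (sphere 0 1) \<Phi>" "e > 0"
  obtains c D where "D \<ge> D0" "\<And>k. c (- k) = cnj (c k)"
    "\<And>t. norm ((trig_sum D c t) - of_real (\<Phi> (cis (2 * pi * t)))) < e"
proof -
  obtain d D where D: "D \<ge> D0"
    and d: "\<And>t. norm ((trig_sum D d t) - of_real (\<Phi> (cis (2 * pi * t)))) < e"
    using assms by (rule_tac circle_Stone_Weierstrass[of "\<lambda>z. of_real (\<Phi> z)" e D0]) (auto intro!: continuous_intros)
  define h where "h k = (d k + cnj (d (- k))) / 2" for k
  have "norm ((trig_sum D h t) - of_real (\<Phi> (cis (2 * pi * t)))) < e" for t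
  proof -
    define q where "q = (trig_sum D d t)"
    define x where "x = \<Phi> (cis (2 * pi * t))"
    have "(trig_sum D h t) = of_real (Re q)"
      unfolding h_def q_def by (rule Re_trig_poly[symmetric])
    moreover have "norm (of_real (Re q) - complex_of_real x) = \<bar>Re (q - of_real x)\<bar>"
      by (metis Re_complex_of_real minus_complex.sel(1) norm_of_real of_real_diff)
    moreover have "\<bar>Re (q - of_real x)\<bar> < e"
      using abs_Re_le_cmod[of "q - of_real x"] d[of t] unfolding q_def x_def by linarith
    ultimately show ?thesis by (simp add: x_def)
  qed
  moreover have "h (- k) = cnj (h k)" for k by (simp add: h_def)
  ultimately show ?thesis using D by (intro that[of D h])
qed

section \<open>Integrals of p-th powers on the circle\<close>

text \<open>The p-th power of the norm, without the root. The arguments of interest are continuous,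
  so the gauge integral suffices; its default value 0 is what makes nonnegativity
  unconditional.\<close>

definition circle_pint :: "real \<Rightarrow> (real \<Rightarrow> complex) \<Rightarrow> real" where
  "circle_pint p f = integral {0..1} (\<lambda>t. norm (f t) powr p)"

lemma norm_powr_integrable:
  fixes f :: "real \<Rightarrow> complex"
  assumes "continuous_on {0..1} f" "p > 0"
  shows "(\<lambda>t. norm (f t) powr p) integrable_on {0..1}"
  using assms by (intro integrable_continuous_interval continuous_on_powr' continuous_intros) auto

lemma circle_pint_nonneg: "circle_pint p f \<ge> 0"
  unfolding circle_pint_def by (cases "(\<lambda>t. norm (f t) powr p) integrable_on {0..1}")
    (auto simp: integral_nonneg not_integrable_integral)

lemma circle_pint_le:
  assumes "continuous_on {0..1} f" "p > 0" "g integrable_on {0..1}"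
    "\<And>t. t \<in> {0..1} \<Longrightarrow> norm (f t) powr p \<le> g t"
  shows "circle_pint p f \<le> integral {0..1} g"
  unfolding circle_pint_def using assms by (intro integral_le norm_powr_integrable) auto

lemma circle_pint_mono:
  assumes "continuous_on {0..1} f" "continuous_on {0..1} g" "p > 0"
    "\<And>t. t \<in> {0..1} \<Longrightarrow> norm (f t) \<le> norm (g t)"
  shows "circle_pint p f \<le> circle_pint p g"
  unfolding circle_pint_def[of p g] using assms
  by (intro circle_pint_le norm_powr_integrable powr_mono2) auto

lemma circle_pint_bound:
  assumes "continuous_on {0..1} f" "p > 0" "\<And>t. t \<in> {0..1} \<Longrightarrow> norm (f t) \<le> d"
  shows "circle_pint p f \<le> d powr p"
proof -
  have "circle_pint p f \<le> integral {0..1::real} (\<lambda>_. d powr p)"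
    using assms by (intro circle_pint_le powr_mono2) auto
  then show ?thesis by simp
qed

lemma circle_pint_add:
  assumes "continuous_on {0..1} f" "continuous_on {0..1} g" "p > 0"
  shows "circle_pint p (\<lambda>t. f t + g t) \<le> 2 powr p * (circle_pint p f + circle_pint p g)"
proof -
  have i: "(\<lambda>t. norm (f t) powr p) integrable_on {0..1}" "(\<lambda>t. norm (g t) powr p) integrable_on {0..1}"
    using assms norm_powr_integrable by auto
  have "circle_pint p (\<lambda>t. f t + g t) \<le> integral {0..1} (\<lambda>t. 2 powr p * (norm (f t) powr p + norm (g t) powr p))"
  proof (rule circle_pint_le)
    fix t :: real
    have "norm (f t + g t) powr p \<le> (norm (f t) + norm (g t)) powr p"
      using assms by (intro powr_mono2 norm_triangle_ineq) auto
    also have "\<dots> \<le> 2 powr p * (norm (f t) powr p + norm (g t) powr p)"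
      using assms by (intro powr_add_le) auto
    finally show "norm (f t + g t) powr p \<le> 2 powr p * (norm (f t) powr p + norm (g t) powr p)" .
  qed (use assms i in \<open>auto intro!: continuous_intros integrable_on_mult_right integrable_add\<close>)
  also have "\<dots> = 2 powr p * (circle_pint p f + circle_pint p g)"
    using i by (simp add: circle_pint_def integral_add)
  finally show ?thesis .
qed

lemma trig_poly_inner:
  assumes "finite A" "finite B"
  shows "((\<lambda>t. (\<Sum>j\<in>A. c j * echar j t) * cnj (\<Sum>k\<in>B. d k * echar k t))
    has_integral (\<Sum>k\<in>A \<inter> B. c k * cnj (d k))) {0..1}"
proof -
  have "((\<lambda>t. \<Sum>j\<in>A. \<Sum>k\<in>B. c j * cnj (d k) * echar (j - k) t)
      has_integral (\<Sum>j\<in>A. \<Sum>k\<in>B. c j * cnj (d k) * (if j - k = 0 then 1 else 0))) {0..1}"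
    by (intro has_integral_sum assms has_integral_mult_right has_integral_echar)
  moreover have "(\<Sum>j\<in>A. \<Sum>k\<in>B. c j * cnj (d k) * (if j - k = 0 then 1 else 0))
      = (\<Sum>k\<in>A \<inter> B. c k * cnj (d k))"
  proof -
    have "(\<Sum>k\<in>B. c j * cnj (d k) * (if j - k = 0 then 1 else 0)) = (if j \<in> B then c j * cnj (d j) else 0)" for j
    proof -
      have "(\<Sum>k\<in>B. c j * cnj (d k) * (if j - k = 0 then 1 else 0)) = (\<Sum>k\<in>B. if j = k then c j * cnj (d j) else 0)"
        by (intro sum.cong) auto
      then show ?thesis using assms by simp
    qed
    then show ?thesis using assms(1) by (simp add: sum.inter_restrict)
  qed
  moreover have "(\<Sum>j\<in>A. \<Sum>k\<in>B. c j * cnj (d k) * echar (j - k) t)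
      = (\<Sum>j\<in>A. c j * echar j t) * cnj (\<Sum>k\<in>B. d k * echar k t)" for t
    by (simp add: sum_product cnj_echar mult_ac echar_add[of _ "- _", simplified])
  ultimately show ?thesis by simp
qed

text \<open>Parseval: discarding the negative frequencies removes nonnegative terms from the sum of
  the squared coefficients.\<close>

lemma Riesz_L2:
  "circle_pint 2 (analytic_sum D c) \<le> circle_pint 2 (trig_sum D c)"
proof -
  have *: "circle_pint 2 (\<lambda>t. \<Sum>k\<in>A. c k * echar k t) = (\<Sum>k\<in>A. (norm (c k))\<^sup>2)" if "finite A" for A
  proof -
    have "((\<lambda>t. of_real ((norm (\<Sum>k\<in>A. c k * echar k t))\<^sup>2)) has_integral (of_real (\<Sum>k\<in>A. (norm (c k))\<^sup>2) :: complex)) {0..1}"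
      using trig_poly_inner[OF that that, of c c] by (simp only: complex_norm_square of_real_sum Int_absorb)
    from has_integral_Re[OF this]
    have "((\<lambda>t. (norm (\<Sum>k\<in>A. c k * echar k t))\<^sup>2) has_integral (\<Sum>k\<in>A. (norm (c k))\<^sup>2)) {0..1}"
      by (simp only: Re_complex_of_real)
    then show ?thesis
      by (simp add: circle_pint_def integral_unique)
  qed
  show ?thesis by (subst (1 2) *) (auto intro!: sum_mono2)
qed

lemma trig_poly_pad:
  assumes "\<And>k. \<bar>k\<bar> > int D \<Longrightarrow> c k = 0" "D \<le> M"
  shows "(trig_sum M c t) = (trig_sum D c t)"
    "(analytic_sum M c t) = (analytic_sum D c t)"
  using assms by (intro sum.mono_neutral_right; auto)+

text \<open>Negative frequencies become powers of the conjugate. With the sum realised as a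
  continuous function on the plane, continuous expressions in it, such as its positive part, can be
  approximated by Stone-Weierstrass.\<close>

lemma trig_poly_on_circle:
  obtains \<Phi> where "continuous_on UNIV \<Phi>"
    "\<And>t. \<Phi> (cis (2 * pi * t)) = (trig_sum D c t)"
proof
  let ?\<Phi> = "\<lambda>z. c 0 + (\<Sum>k=1..D. c (int k) * z ^ k + c (- int k) * cnj z ^ k)"
  show "continuous_on UNIV ?\<Phi>" by (intro continuous_intros)
  show "?\<Phi> (cis (2 * pi * t)) = (trig_sum D c t)" for t
    unfolding sum_symmetric_int
    by (simp add: cnj_echar[symmetric] echar_power)
qed

text \<open>Pointwise |f|^p <= d^p + d^(p-2) |f|^2, by comparing |f| with \<open>d\<close>; the case
  |f| > d uses p <= 2. This converts the only control available for a projected error, a square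
  integral of order d^2, into a p-th power integral of order d^p.\<close>

lemma small_powr_integral_of_L2:
  assumes p: "0 < p" "p \<le> 2" and d: "0 < d" and f: "continuous_on {0..1} f"
    and L2: "circle_pint 2 f \<le> K * d powr 2"
  shows "circle_pint p f \<le> (1 + K) * d powr p"
proof -
  have i2: "(\<lambda>t. norm (f t) powr 2) integrable_on {0..1}"
    using f by (intro norm_powr_integrable) auto
  have "circle_pint p f \<le> integral {0..1} (\<lambda>t. d powr p + d powr (p - 2) * norm (f t) powr 2)"
  proof (rule circle_pint_le)
    fix t :: real
    show "norm (f t) powr p \<le> d powr p + d powr (p - 2) * norm (f t) powr 2"
    proof (cases "norm (f t) \<le> d")
      case True
      then have "norm (f t) powr p \<le> d powr p" using p by (intro powr_mono2) auto
      then show ?thesis by (simp add: add_increasing2)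
    next
      case False
      then have pos: "norm (f t) > 0" using d by linarith
      have "norm (f t) powr p = norm (f t) powr (p - 2) * norm (f t) powr 2"
        by (subst powr_add[symmetric]) simp
      also have "\<dots> \<le> d powr (p - 2) * norm (f t) powr 2"
        using False p d by (intro mult_right_mono powr_mono2') auto
      finally show ?thesis by (simp add: add_increasing)
    qed
  qed (use p f i2 in \<open>auto intro!: integrable_add integrable_on_mult_right\<close>)
  also have "\<dots> = d powr p + d powr (p - 2) * circle_pint 2 f"
    using i2 by (subst integral_add) (auto simp: circle_pint_def intro!: integrable_on_mult_right)
  also have "\<dots> \<le> d powr p + d powr (p - 2) * (K * d powr 2)"
    using L2 by (intro add_left_mono mult_left_mono) auto
  also have "\<dots> = (1 + K) * d powr p"
    using d by (simp add: powr_diff algebra_simps)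
  finally show ?thesis .
qed

section \<open>From positive to arbitrary polynomials for p at most 2\<close>

text \<open>A real polynomial \<open>q\<close> is compared with \<open>r1 - r2\<close>, where
  \<open>r1\<close> and \<open>r2\<close> are polynomials within \<open>d\<close> of the positive
  and the negative part of \<open>q\<close>, both raised by 2d. The shift makes them strictly
  positive and cancels in the difference. The positive case bounds their projections, the L^2
  argument that of the remainder \<open>s\<close>, and d tends to 0 with \<open>q\<close>
  fixed.\<close>

lemma Riesz_real:
  fixes p :: real
  assumes p: "1 < p" "p \<le> 2"
  obtains C where "C \<ge> 0"
    "\<And>c D. (\<And>k. c (- k) = cnj (c k)) \<Longrightarrow>
      circle_pint p (analytic_sum D c)
        \<le> C * circle_pint p (trig_sum D c)"
proof -
  obtain C where C: "C \<ge> 0"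
    and pos: "\<And>c D. \<lbrakk>\<And>k. c (- k) = cnj (c k); \<And>t. Re (trig_sum D c t) > 0\<rbrakk>
      \<Longrightarrow> circle_pint p (analytic_sum D c)
        \<le> C * circle_pint p (trig_sum D c)"
    by (rule Riesz_positive[OF p, folded circle_pint_def]) blast
  define T where "T = 2 powr p"
  have T: "T \<ge> 0" by (simp add: T_def)
  have p0: "p > 0" using p by simp
  have main: "circle_pint p (analytic_sum D c)
        \<le> (T * T * C * T * 2 ) * circle_pint p (trig_sum D c)"
    if c: "\<And>k. c (- k) = cnj (c k)" and c0: "\<And>k. \<bar>k\<bar> > int D \<Longrightarrow> c k = 0" for c D
  proof -
    define q where "q t = (trig_sum D c t)" for t
    have contq: "continuous_on {0..1} q" unfolding q_def by (intro continuous_intros)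
    have imq: "q t = of_real (Re (q t))" for t
      unfolding q_def Re_trig_poly by (simp add: c)
    define K where "K = T * T * C * T * 2 * 3 powr p + T * 5"
    have est: "circle_pint p (analytic_sum D c)
        \<le> (T * T * C * T * 2) * circle_pint p q + K * d powr p" if d: "0 < d" for d
    proof -
      obtain \<Phi> where \<Phi>: "continuous_on UNIV \<Phi>" "\<And>t. \<Phi> (cis (2 * pi * t)) = q t"
        unfolding q_def using trig_poly_on_circle by blast
      have cR: "continuous_on S (\<lambda>z. Re (\<Phi> z))" for S
        by (intro continuous_intros continuous_on_subset[OF \<Phi>(1)]) auto
      obtain a A where A: "A \<ge> D" "\<And>k. a (- k) = cnj (a k)"
        "\<And>t. norm ((trig_sum A a t) - of_real (max (Re (\<Phi> (cis (2 * pi * t)))) 0 + 2 * d)) < d"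
        using d by (rule_tac circle_Stone_Weierstrass_real[of "\<lambda>z. max (Re (\<Phi> z)) 0 + 2 * d" d D])
          (auto intro!: continuous_intros cR)
      obtain b B where B: "B \<ge> A" "\<And>k. b (- k) = cnj (b k)"
        "\<And>t. norm ((trig_sum B b t) - of_real (max (- Re (\<Phi> (cis (2 * pi * t)))) 0 + 2 * d)) < d"
        using d by (rule_tac circle_Stone_Weierstrass_real[of "\<lambda>z. max (- Re (\<Phi> z)) 0 + 2 * d" d A])
          (auto intro!: continuous_intros cR)
      \<comment> \<open>The coefficients of \<open>a\<close> beyond \<open>A\<close> are unspecified
        and have to be cut off before the degree is raised to \<open>B\<close>.\<close>
      define a' where "a' k = (if \<bar>k\<bar> \<le> int A then a k else 0)" for k
      define s where "s k = c k - (a' k - b k)" for k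
      define r1 where "r1 t = (trig_sum B a' t)" for t
      define r2 where "r2 t = (trig_sum B b t)" for t
      define P where "P e t = (analytic_sum B e t)" for e :: "int \<Rightarrow> complex" and t
      have a'herm: "a' (- k) = cnj (a' k)" for k by (simp add: a'_def A(2))
      have r1A: "r1 t = (trig_sum A a t)" for t
      proof -
        have "r1 t = (trig_sum A a' t)"
          unfolding r1_def by (rule trig_poly_pad(1)) (auto simp: a'_def B(1))
        also have "\<dots> = (trig_sum A a t)"
          by (intro sum.cong) (auto simp: a'_def)
        finally show ?thesis .
      qed
      have qB: "q t = (trig_sum B c t)" for t
        unfolding q_def using trig_poly_pad(1)[OF c0, where M = B] A(1) B(1) by simp
      have PB: "(analytic_sum D c t) = P c t" for t
        unfolding P_def using trig_poly_pad(2)[OF c0, where M = B] A(1) B(1) by simp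
      have n1: "norm (r1 t - of_real (max (Re (q t)) 0 + 2 * d)) < d" for t
        using A(3)[of t] by (simp only: r1A \<Phi>(2))
      have n2: "norm (r2 t - of_real (max (- Re (q t)) 0 + 2 * d)) < d" for t
        using B(3)[of t] by (simp only: r2_def \<Phi>(2))
      have bd: "Re (r t) > 0 \<and> norm (r t) \<le> norm (q t) + 3 * d"
        if "norm (r t - of_real (max x 0 + 2 * d)) < d" "\<bar>x\<bar> \<le> norm (q t)" for r t and x :: real
      proof
        have "\<bar>Re (r t - of_real (max x 0 + 2 * d))\<bar> < d"
          using that(1) abs_Re_le_cmod order_le_less_trans by blast
        then have "\<bar>Re (r t) - (max x 0 + 2 * d)\<bar> < d" by (simp del: of_real_add)
        then show "Re (r t) > 0" using d by linarith
        have "norm (r t) \<le> norm (r t - of_real (max x 0 + 2 * d)) + norm (complex_of_real (max x 0 + 2 * d))"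
          by (metis diff_add_cancel norm_triangle_ineq)
        also have "norm (complex_of_real (max x 0 + 2 * d)) = max x 0 + 2 * d"
          using d by (simp only: norm_of_real; simp)
        finally show "norm (r t) \<le> norm (q t) + 3 * d" using that by linarith
      qed
      have b1: "Re (r1 t) > 0" "norm (r1 t) \<le> norm (q t) + 3 * d" for t
        using bd[of r1 t "Re (q t)", OF n1] abs_Re_le_cmod[of "q t"] by auto
      have b2: "Re (r2 t) > 0" "norm (r2 t) \<le> norm (q t) + 3 * d" for t
        using bd[of r2 t "- Re (q t)", OF n2] abs_Re_le_cmod[of "q t"] by auto
      have contr: "continuous_on {0..1} r1" "continuous_on {0..1} r2" "continuous_on {0..1} (P e)" for e
        unfolding r1_def r2_def P_def by (intro continuous_intros)+
      have rint: "circle_pint p r \<le> T * (circle_pint p q + 3 powr p * d powr p)"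
        if "continuous_on {0..1} r" "\<And>t. norm (r t) \<le> norm (q t) + 3 * d" for r
      proof -
        have "circle_pint p r \<le> circle_pint p (\<lambda>t. of_real (norm (q t)) + of_real (3 * d))"
        proof (intro circle_pint_mono that)
          show "continuous_on {0..1} (\<lambda>t. complex_of_real (norm (q t)) + of_real (3 * d))"
            by (intro continuous_intros contq)
          fix t
          have "norm (complex_of_real (norm (q t)) + of_real (3 * d)) = norm (q t) + 3 * d"
            using d by (simp only: of_real_add[symmetric] norm_of_real; simp)
          then show "norm (r t) \<le> norm (complex_of_real (norm (q t)) + of_real (3 * d))"
            using that(2)[of t] by simp
        qed (use p0 in auto)
        also have "\<dots> \<le> 2 powr p * (circle_pint p (\<lambda>t. of_real (norm (q t))) + circle_pint p (\<lambda>t. of_real (3 * d)))"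
          by (intro circle_pint_add continuous_intros contq p0)
        also have "circle_pint p (\<lambda>t. of_real (3 * d)) \<le> (3 * d) powr p"
          using d p0 by (intro circle_pint_bound continuous_intros) auto
        also have "(3 * d) powr p = 3 powr p * d powr p" using d by (simp add: powr_mult)
        finally show ?thesis by (simp add: T_def circle_pint_def mult_left_mono)
      qed
      have P1: "circle_pint p (P a') \<le> C * (T * (circle_pint p q + 3 powr p * d powr p))"
      proof -
        have "circle_pint p (P a') \<le> C * circle_pint p r1"
          using pos[of a' B] a'herm b1 unfolding P_def r1_def by simp
        also have "\<dots> \<le> C * (T * (circle_pint p q + 3 powr p * d powr p))"
          by (intro mult_left_mono rint contr b1 C)
        finally show ?thesis .
      qed
      have P2: "circle_pint p (P b) \<le> C * (T * (circle_pint p q + 3 powr p * d powr p))"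
      proof -
        have "circle_pint p (P b) \<le> C * circle_pint p r2"
          using pos[of b B] B(2) b2 unfolding P_def r2_def by simp
        also have "\<dots> \<le> C * (T * (circle_pint p q + 3 powr p * d powr p))"
          by (intro mult_left_mono rint contr b2 C)
        finally show ?thesis .
      qed
      \<comment> \<open>The sum with coefficients \<open>s\<close> is at most 2d in modulus: two
        approximation errors below \<open>d\<close>, the shifts having cancelled. Hence the constant
        4 = 2^2.\<close>
      have P3: "circle_pint p (P s) \<le> (1 + 4) * d powr p"
      proof (rule small_powr_integral_of_L2)
        have "circle_pint 2 (P s) \<le> circle_pint 2 (trig_sum B s)"
          unfolding P_def by (rule Riesz_L2)
        also have "\<dots> \<le> (2 * d) powr 2"
        proof (intro circle_pint_bound continuous_intros)
          fix t
          have "(trig_sum B s t) = q t - (r1 t - r2 t)"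
            unfolding qB r1_def r2_def s_def by (simp add: algebra_simps sum.distrib sum_subtractf)
          also have "\<dots> = (r2 t - of_real (max (- Re (q t)) 0 + 2 * d)) - (r1 t - of_real (max (Re (q t)) 0 + 2 * d))"
            by (subst imq) (simp add: max_def)
          finally show "norm (trig_sum B s t) \<le> 2 * d"
            using norm_triangle_ineq4[of "r2 t - of_real (max (- Re (q t)) 0 + 2 * d)" "r1 t - of_real (max (Re (q t)) 0 + 2 * d)"]
              n1[of t] n2[of t] by (simp del: of_real_add)
        qed auto
        also have "(2 * d) powr 2 = 4 * d powr 2" using d by (simp add: powr_mult)
        finally show "circle_pint 2 (P s) \<le> 4 * d powr 2" .
      qed (use p d contr in auto)
      have "P c = (\<lambda>t. P s t + (P a' t + - P b t))"
        unfolding P_def s_def by (simp add: algebra_simps sum.distrib sum_subtractf)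
      then have "circle_pint p (P c) \<le> T * (circle_pint p (P s) + circle_pint p (\<lambda>t. P a' t + - P b t))"
        unfolding T_def using circle_pint_add[of "P s" "\<lambda>t. P a' t + - P b t" p] contr p0
        by (simp add: continuous_intros)
      also have "circle_pint p (\<lambda>t. P a' t + - P b t) \<le> T * (circle_pint p (P a') + circle_pint p (\<lambda>t. - P b t))"
        unfolding T_def using contr p0 by (intro circle_pint_add continuous_intros) auto
      also have "circle_pint p (\<lambda>t. - P b t) = circle_pint p (P b)" by (simp add: circle_pint_def)
      finally have "circle_pint p (P c) \<le> T * (circle_pint p (P s) + T * (circle_pint p (P a') + circle_pint p (P b)))"
        using T by (simp add: mult_left_mono)
      also have "\<dots> \<le> T * ((1 + 4) * d powr p + T * (C * (T * (circle_pint p q + 3 powr p * d powr p)) + C * (T * (circle_pint p q + 3 powr p * d powr p))))"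
        by (intro mult_left_mono add_mono P1 P2 P3 T)
      also have "\<dots> = (T * T * C * T * 2) * circle_pint p q + K * d powr p"
        by (simp add: K_def algebra_simps)
      finally show ?thesis by (simp only: PB)
    qed
    have K: "K \<ge> 0" using T C by (simp add: K_def)
    have "circle_pint p (analytic_sum D c)
        \<le> (T * T * C * T * 2) * circle_pint p q + e" if e: "e > 0" for e
    proof -
      \<comment> \<open>Solves (K + 1) d^p = e; the added 1 covers K = 0.\<close>
      define d where "d = (e / (K + 1)) powr (1 / p)"
      have d: "d > 0" using e K by (simp add: d_def)
      have "K * d powr p = K * (e / (K + 1))" using e K p0 by (simp add: d_def powr_powr)
      also have "\<dots> \<le> e" using e K by (simp add: field_simps)
      finally show ?thesis using est[OF d] by linarith
    qed
    then have "circle_pint p (analytic_sum D c) \<le> (T * T * C * T * 2) * circle_pint p q"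
      by (rule field_le_epsilon)
    then show ?thesis unfolding q_def .
  qed
  show ?thesis
  proof (rule that[of "T * T * C * T * 2"])
    show "T * T * C * T * 2 \<ge> 0" using T C by simp
    fix c :: "int \<Rightarrow> complex" and D
    assume c: "\<And>k. c (- k) = cnj (c k)"
    define c' where "c' k = (if \<bar>k\<bar> \<le> int D then c k else 0)" for k
    have "(analytic_sum D c t) = (analytic_sum D c' t)"
      "(trig_sum D c t) = (trig_sum D c' t)" for t
      by (auto intro!: sum.cong simp: c'_def)
    then show "circle_pint p (analytic_sum D c)
        \<le> (T * T * C * T * 2 ) * circle_pint p (trig_sum D c)"
      using main[of c' D] c by (simp add: c'_def)
  qed
qed

text \<open>The imaginary part of a sum is the real part of its multiple by -i. So \<open>c\<close>
  is \<open>h c + \<i> * h d\<close> with two Hermitian families, and the sum of each is dominated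
  pointwise by the sum of \<open>c\<close>.\<close>

lemma Riesz_le_2:
  fixes p :: real
  assumes p: "1 < p" "p \<le> 2"
  obtains C where "C \<ge> 0"
    "\<And>c D. circle_pint p (analytic_sum D c)
        \<le> C * circle_pint p (trig_sum D c)"
proof -
  obtain C where C: "C \<ge> 0" and herm: "\<And>c D. (\<And>k. c (- k) = cnj (c k)) \<Longrightarrow>
      circle_pint p (analytic_sum D c)
        \<le> C * circle_pint p (trig_sum D c)"
    by (rule Riesz_real[OF p]) blast
  have p0: "p > 0" using p by simp
  have "circle_pint p (analytic_sum D c)
        \<le> (2 powr p * (C + C)) * circle_pint p (trig_sum D c)" for c D
  proof -
    define P where "P c t = (analytic_sum D c t)" for c t
    define Q where "Q c t = (trig_sum D c t)" for c t
    define h where "h c k = (c k + cnj (c (- k))) / 2" for c and k :: int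
    define d where "d k = - \<i> * c k" for k
    have cont: "continuous_on {0..1} (P c)" "continuous_on {0..1} (Q c)" for c
      unfolding P_def Q_def by (intro continuous_intros)+
    have bound: "circle_pint p (P (h e)) \<le> C * circle_pint p (Q c)" if "\<And>t. norm (Q e t) \<le> norm (Q c t)" for e
    proof -
      have "circle_pint p (P (h e)) \<le> C * circle_pint p (Q (h e))"
        unfolding P_def Q_def by (rule herm) (simp add: h_def)
      also have "circle_pint p (Q (h e)) \<le> circle_pint p (Q c)"
      proof (intro circle_pint_mono cont p0)
        fix t
        have "Q (h e) t = of_real (Re (Q e t))"
          unfolding Q_def h_def by (rule Re_trig_poly[symmetric])
        then have "norm (Q (h e) t) \<le> norm (Q e t)" using abs_Re_le_cmod[of "Q e t"] by simp
        then show "norm (Q (h e) t) \<le> norm (Q c t)" using that[of t] by simp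
      qed
      finally show ?thesis using C by (simp add: mult_left_mono)
    qed
    have "Q d t = - \<i> * Q c t" for t
      by (simp add: Q_def d_def sum_distrib_left sum_negf mult_ac)
    then have nd: "norm (Q d t) = norm (Q c t)" for t by (simp add: norm_mult)
    have "c k = h c k + \<i> * h d k" for k
      by (simp add: h_def d_def complex_eq_iff field_simps)
    then have "P c = (\<lambda>t. P (h c) t + \<i> * P (h d) t)"
      unfolding P_def by (simp add: sum_distrib_left sum.distrib[symmetric] distrib_right[symmetric] mult.assoc[symmetric])
    then have "circle_pint p (P c) \<le> 2 powr p * (circle_pint p (P (h c)) + circle_pint p (\<lambda>t. \<i> * P (h d) t))"
      using circle_pint_add[of "P (h c)" "\<lambda>t. \<i> * P (h d) t" p] cont p0
      by (simp add: continuous_intros)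
    also have "circle_pint p (\<lambda>t. \<i> * P (h d) t) = circle_pint p (P (h d))"
      by (simp add: circle_pint_def norm_mult)
    finally have "circle_pint p (P c) \<le> 2 powr p * (circle_pint p (P (h c)) + circle_pint p (P (h d)))" .
    also have "\<dots> \<le> 2 powr p * (C * circle_pint p (Q c) + C * circle_pint p (Q c))"
      by (intro mult_left_mono add_mono bound) (auto simp: nd)
    finally show ?thesis unfolding P_def Q_def by (simp add: algebra_simps)
  qed
  then show ?thesis using C by (intro that[of "2 powr p * (C + C)"]) auto
qed

section \<open>Duality for p greater than 2\<close>

text \<open>A large weight \<open>l\<close> makes the coefficient of b^q as small as desired, so
  that this term can be absorbed on the left in the duality argument.\<close>

lemma Young_scaled:
  fixes a b l p q :: real
  assumes "1 < p" "1 < q" "1 / p + 1 / q = 1" "a \<ge> 0" "b \<ge> 0" "l > 0"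
  shows "a * b \<le> l powr p * a powr p + l powr (- q) * b powr q"
proof -
  have "a * b = (l * a) * (b / l)" using assms by simp
  also have "\<dots> \<le> (l * a) powr p / p + (b / l) powr q / q"
    using assms by (intro Youngs_inequality) auto
  also have "\<dots> \<le> (l * a) powr p + (b / l) powr q"
  proof -
    have "x / s \<le> x" if "0 \<le> x" "1 < s" for x s :: real
      using that mult_left_mono[of 1 s x] by (simp add: field_simps)
    then show ?thesis using assms by (intro add_mono) auto
  qed
  also have "\<dots> = l powr p * a powr p + l powr (- q) * b powr q"
    using assms by (simp add: powr_mult powr_divide powr_minus field_simps)
  finally show ?thesis .
qed

text \<open>The projection \<open>P\<close> is tested against g = |P|^(p-2) P, for which P cnj(g) =
  |P|^p = |g|^q. Self-adjointness moves the projection onto a polynomial close to \<open>g\<close>,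
  where the bound for the conjugate exponent q <= 2 applies. This produces a multiple of the very
  integral to be bounded, small enough to be absorbed since that integral is finite.\<close>

lemma Riesz_gt_2:
  fixes p :: real
  assumes p: "2 < p"
  obtains C where "C \<ge> 0"
    "\<And>c D. circle_pint p (analytic_sum D c)
        \<le> C * circle_pint p (trig_sum D c)"
proof -
  define q where "q = p / (p - 1)"
  have q: "1 < q" "q \<le> 2" and pq: "1 / p + 1 / q = 1" and pq1: "(p - 1) * q = p"
    using p by (auto simp: q_def field_simps)
  obtain Cq where Cq: "Cq \<ge> 0" and dual: "\<And>c D. circle_pint q (analytic_sum D c)
        \<le> Cq * circle_pint q (trig_sum D c)"
    by (rule Riesz_le_2[OF q]) blast
  define K where "K = Cq * 2 powr q + 1"
  have K: "K \<ge> 1" using Cq by (simp add: K_def)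
  \<comment> \<open>Chosen so that l^(-q) K = 1/4; the summand 1 in \<open>K\<close> secures
    positivity when \<open>Cq\<close> is 0.\<close>
  define l where "l = (4 * K) powr (1 / q)"
  have l: "l > 0" using K by (simp add: l_def)
  have lq: "l powr (- q) * K = 1 / 4"
    using K q by (simp add: l_def powr_powr powr_minus field_simps)
  have main: "circle_pint p (analytic_sum D c)
      \<le> (2 * l powr p) * circle_pint p (trig_sum D c)"
    if c0: "\<And>k. \<bar>k\<bar> > int D \<Longrightarrow> c k = 0" for c D
  proof -
    define P where "P t = (analytic_sum D c t)" for t
    define f where "f t = (trig_sum D c t)" for t
    define g where "g t = of_real (norm (P t) powr (p - 2)) * P t" for t
    define X where "X = circle_pint p P"
    define Y where "Y = circle_pint p f"
    have cont: "continuous_on {0..1} P" "continuous_on {0..1} f"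
      unfolding P_def f_def by (intro continuous_intros)+
    have contn: "continuous_on S (\<lambda>x. norm (\<phi> x) powr e)" if "continuous_on S \<phi>" "e > 0"
      for S :: "'z::topological_space set" and \<phi> :: "'z \<Rightarrow> complex" and e
      using that by (intro continuous_on_powr' continuous_intros) auto
    have contg: "continuous_on {0..1} g"
      unfolding g_def using p by (intro continuous_intros contn cont) auto
    have normg: "norm (g t) powr q = norm (P t) powr p" for t
    proof -
      have "norm (g t) = norm (P t) powr (p - 1)"
        using powr_add[of "norm (P t)" "p - 2" 1] by (simp add: g_def norm_mult)
      then show ?thesis by (simp add: powr_powr pq1)
    qed
    have Pg: "P t * cnj (g t) = of_real (norm (P t) powr p)" for t
    proof -
      have "P t * cnj (g t) = of_real (norm (P t) powr (p - 2)) * (P t * cnj (P t))" by (simp add: g_def)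
      also have "P t * cnj (P t) = of_real (norm (P t) powr 2)"
        using complex_norm_square[of "P t"] by simp
      also have "complex_of_real (norm (P t) powr (p - 2)) * of_real (norm (P t) powr 2) = of_real (norm (P t) powr p)"
        unfolding of_real_mult[symmetric] powr_add[symmetric] by simp
      finally show ?thesis .
    qed
    have intP: "(\<lambda>t. norm (P t) powr p) integrable_on {0..1}" "(\<lambda>t. norm (f t) powr p) integrable_on {0..1}"
      using p by (intro norm_powr_integrable cont; simp)+
    obtain \<Phi> where \<Phi>: "continuous_on UNIV \<Phi>" "\<And>t. \<Phi> (cis (2 * pi * t)) = P t"
    proof -
      have "P t = (\<Sum>k\<in>{- int D..int D}. (if k \<ge> 0 then c k else 0) * echar k t)" for t
        unfolding P_def by (intro sum.mono_neutral_cong_left) auto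
      moreover obtain \<Phi> where "continuous_on UNIV \<Phi>"
        "\<And>t. \<Phi> (cis (2 * pi * t)) = (\<Sum>k\<in>{- int D..int D}. (if k \<ge> 0 then c k else 0) * echar k t)"
        by (rule trig_poly_on_circle[where c = "\<lambda>k. if k \<ge> 0 then c k else 0" and D = D]) blast
      ultimately show ?thesis by (intro that[of \<Phi>]) simp_all
    qed
    \<comment> \<open>The bound d <= 1/4 serves twice: the term d X is at most X/4, and d^q <=
      d.\<close>
    have est: "X \<le> 2 * l powr p * Y + 4 * d" if d: "0 < d" "d \<le> 1 / 4" for d
    proof -
      obtain e M where M: "M \<ge> D"
        and e: "\<And>t. norm ((trig_sum M e t) - of_real (norm (\<Phi> (cis (2 * pi * t))) powr (p - 2)) * \<Phi> (cis (2 * pi * t))) < d"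
        using d p \<Phi>(1) by (rule_tac circle_Stone_Weierstrass[of "\<lambda>z. of_real (norm (\<Phi> z) powr (p - 2)) * \<Phi> z" d D])
          (auto intro!: continuous_intros contn intro: continuous_on_subset)
      define r where "r t = (trig_sum M e t)" for t
      define Pr where "Pr t = (analytic_sum M e t)" for t
      have contr: "continuous_on {0..1} r" "continuous_on {0..1} Pr"
        unfolding r_def Pr_def by (intro continuous_intros)+
      have rg: "norm (r t - g t) < d" for t
        using e[of t] unfolding \<Phi>(2) r_def g_def .
      have fM: "f t = (trig_sum M c t)" for t
        unfolding f_def using trig_poly_pad(1)[OF c0, where M = M] M by simp
      have PM: "P t = (analytic_sum M c t)" for t
        unfolding P_def using trig_poly_pad(2)[OF c0, where M = M] M by simp
      \<comment> \<open>Self-adjointness of the projection: both pairings equal the sum of c k cnj(e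
        k) over the nonnegative frequencies.\<close>
      have i1: "((\<lambda>t. P t * cnj (r t)) has_integral (\<Sum>k\<in>{0..int M}. c k * cnj (e k))) {0..1}"
        using trig_poly_inner[of "{0..int M}" "{- int M..int M}" c e]
        unfolding PM r_def by (simp add: Int_absorb2 Int_atLeastAtMost)
      have i2: "((\<lambda>t. f t * cnj (Pr t)) has_integral (\<Sum>k\<in>{0..int M}. c k * cnj (e k))) {0..1}"
        using trig_poly_inner[of "{- int M..int M}" "{0..int M}" c e]
        unfolding fM Pr_def by (simp add: Int_absorb1 Int_atLeastAtMost)
      have PrI: "((\<lambda>t. P t * cnj (r t) - f t * cnj (Pr t)) has_integral 0) {0..1}"
        using has_integral_diff[OF i1 i2] by simp
      have "((\<lambda>t. P t * cnj (g t)) has_integral of_real X) {0..1}"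
        unfolding Pg X_def circle_pint_def using intP by (intro has_integral_of_real integrable_integral)
      from has_integral_diff[OF this PrI]
      have "((\<lambda>t. P t * cnj (g t - r t) + f t * cnj (Pr t)) has_integral of_real X) {0..1}"
        by (simp add: algebra_simps)
      then have X: "X = norm (integral {0..1} (\<lambda>t. P t * cnj (g t - r t) + f t * cnj (Pr t)))"
        by (simp add: integral_unique X_def circle_pint_nonneg)
      have iPr: "(\<lambda>t. norm (Pr t) powr q) integrable_on {0..1}"
        using q by (intro norm_powr_integrable contr) simp
      let ?B = "\<lambda>t. d * (1 + norm (P t) powr p) + (l powr p * norm (f t) powr p + l powr (- q) * norm (Pr t) powr q)"
      have "X \<le> integral {0..1} ?B"
        unfolding X
      proof (rule integral_norm_bound_integral)
        show "(\<lambda>t. P t * cnj (g t - r t) + f t * cnj (Pr t)) integrable_on {0..1}"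
          by (intro integrable_continuous_interval continuous_intros cont contg contr)
        show "?B integrable_on {0..1}"
          by (intro integrable_add integrable_on_mult_right intP iPr) auto
        fix t :: real
        have "norm (P t) * norm (g t - r t) \<le> (1 + norm (P t) powr p) * d"
        proof (intro mult_mono)
          show "norm (P t) \<le> 1 + norm (P t) powr p"
          proof (cases "norm (P t) \<le> 1")
            case False
            then have "norm (P t) powr 1 \<le> norm (P t) powr p" using p by (intro powr_mono) auto
            then show ?thesis using False by simp
          qed (simp add: add_increasing2)
          show "norm (g t - r t) \<le> d" using rg[of t] by (simp add: norm_minus_commute)
        qed auto
        moreover have "norm (f t) * norm (Pr t) \<le> l powr p * norm (f t) powr p + l powr (- q) * norm (Pr t) powr q"
          using p q pq l by (intro Young_scaled) auto
        moreover have "norm (P t * cnj (g t - r t) + f t * cnj (Pr t)) \<le> norm (P t) * norm (g t - r t) + norm (f t) * norm (Pr t)"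
          by (metis complex_mod_cnj norm_mult norm_triangle_ineq)
        ultimately show "norm (P t * cnj (g t - r t) + f t * cnj (Pr t)) \<le> ?B t" by (simp add: mult.commute)
      qed
      also have "integral {0..1} ?B = d * (1 + X) + (l powr p * Y + l powr (- q) * circle_pint q Pr)"
      proof -
        have "(?B has_integral d * (1 + X) + (l powr p * Y + l powr (- q) * circle_pint q Pr)) {0..1}"
          unfolding X_def Y_def circle_pint_def
          using intP iPr has_integral_const_real[of "1::real" 0 1]
          by (intro has_integral_add has_integral_mult_right integrable_integral) auto
        then show ?thesis by (rule integral_unique)
      qed
      also have "circle_pint q Pr \<le> K * (X + d)"
      proof -
        have "circle_pint q Pr \<le> Cq * circle_pint q r"
          unfolding Pr_def r_def by (rule dual)
        also have "circle_pint q r \<le> 2 powr q * (X + d)"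
        proof -
          have "circle_pint q (\<lambda>t. g t + (r t - g t)) \<le> 2 powr q * (circle_pint q g + circle_pint q (\<lambda>t. r t - g t))"
            using q by (intro circle_pint_add continuous_intros contg contr) auto
          also have "circle_pint q g = X" unfolding X_def circle_pint_def normg ..
          also have "circle_pint q (\<lambda>t. r t - g t) \<le> d powr q"
            using q rg by (intro circle_pint_bound continuous_intros contg contr) (auto simp: less_imp_le)
          also have "d powr q \<le> d powr 1" using d q by (intro powr_mono') auto
          finally show ?thesis using d by (simp add: mult_left_mono)
        qed
        finally have "circle_pint q Pr \<le> Cq * (2 powr q * (X + d))" using Cq by (simp add: mult_left_mono)
        also have "\<dots> \<le> K * (X + d)"
          using d circle_pint_nonneg[of p P] by (simp add: K_def X_def algebra_simps)
        finally show ?thesis .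
      qed
      finally have "X \<le> d * (1 + X) + (l powr p * Y + l powr (- q) * (K * (X + d)))"
        by (simp add: mult_left_mono)
      also have "l powr (- q) * (K * (X + d)) = (X + d) / 4"
        using lq by (simp add: mult.assoc[symmetric])
      finally have "X \<le> d * (1 + X) + (l powr p * Y + (X + d) / 4)" .
      moreover have "d * X \<le> 1 / 4 * X"
        using d circle_pint_nonneg[of p P] unfolding X_def by (intro mult_right_mono) auto
      \<comment> \<open>The two absorbed terms take X/4 each, leaving X/2 on the left; hence the
        factor 2.\<close>
      moreover have "x \<le> 2 * w + 4 * d"
        if "x \<le> d + u + (w + (x + d) / 4)" "u \<le> 1 / 4 * x" for x u w :: real
        using that d by (simp add: field_simps)
      ultimately show ?thesis unfolding distrib_left mult.assoc mult_1_right by blast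
    qed
    have "X \<le> 2 * l powr p * Y + s" if "s > 0" for s
    proof -
      have "X \<le> 2 * l powr p * Y + 4 * min (1 / 4) (s / 4)" using that by (intro est) auto
      moreover have "4 * min (1 / 4) (s / 4) \<le> s" by (simp add: min_def)
      ultimately show ?thesis by linarith
    qed
    then have "X \<le> 2 * l powr p * Y" by (rule field_le_epsilon)
    then show ?thesis unfolding X_def Y_def P_def f_def .
  qed
  show ?thesis
  proof (rule that[of "2 * l powr p"])
    show "2 * l powr p \<ge> 0" by simp
    fix c :: "int \<Rightarrow> complex" and D
    define c' where "c' k = (if \<bar>k\<bar> \<le> int D then c k else 0)" for k
    have "(analytic_sum D c t) = (analytic_sum D c' t)"
      "(trig_sum D c t) = (trig_sum D c' t)" for t
      by (auto intro!: sum.cong simp: c'_def)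
    then show "circle_pint p (analytic_sum D c)
        \<le> (2 * l powr p) * circle_pint p (trig_sum D c)"
      using main[where c = c' and D = D] by (simp add: c'_def)
  qed
qed

theorem Riesz_projection:
  fixes p :: real
  assumes "1 < p"
  obtains C where "C \<ge> 0"
    "\<And>c D. circle_pint p (analytic_sum D c)
        \<le> C * circle_pint p (trig_sum D c)"
proof (cases "p \<le> 2")
  case True
  show ?thesis by (rule Riesz_le_2[OF assms True]) (rule that)
next
  case False
  then have "2 < p" by simp
  then show ?thesis by (rule Riesz_gt_2) (rule that)
qed

text \<open>Multiplication by a character shifts all frequencies and keeps the modulus, so every
  threshold \<open>m\<close> reduces to 0 with the same constant. The abstract index set and the map
  \<open>l\<close> are made for the torus: along a line of direction \<open>v\<close> the character
  \<open>k\<close> has as frequency the inner product of k and v, which may agree for different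
  \<open>k\<close>.\<close>

corollary Riesz_half_line:
  fixes p :: real
  assumes "1 < p"
  obtains C where "C \<ge> 0"
    "\<And>(S :: 'a set) l d m. finite S \<Longrightarrow> circle_pint p (\<lambda>t. \<Sum>k\<in>{k\<in>S. m \<le> l k}. d k * echar (l k) t)
        \<le> C * circle_pint p (\<lambda>t. \<Sum>k\<in>S. d k * echar (l k) t)"
proof -
  obtain C where C: "C \<ge> 0" and R: "\<And>c D. circle_pint p (analytic_sum D c)
        \<le> C * circle_pint p (trig_sum D c)"
    by (rule Riesz_projection[OF assms]) blast
  have "circle_pint p (\<lambda>t. \<Sum>k\<in>{k\<in>S. m \<le> l k}. d k * echar (l k) t)
        \<le> C * circle_pint p (\<lambda>t. \<Sum>k\<in>S. d k * echar (l k) t)"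
    if S: "finite S" for S :: "'a set" and l d m
  proof -
    define j where "j k = l k - m" for k
    obtain D where D: "j ` S \<subseteq> {- int D..int D}"
      using finite_int_set_bound[of "j ` S" 0] S by blast
    define c where "c i = (\<Sum>k\<in>{k\<in>S. j k = i}. d k)" for i
    have shift: "norm (\<Sum>k\<in>A. d k * echar (l k) t) = norm (\<Sum>k\<in>A. d k * echar (j k) t)" for A t
    proof -
      have "(\<Sum>k\<in>A. d k * echar (l k) t) = echar m t * (\<Sum>k\<in>A. d k * echar (j k) t)"
        unfolding sum_distrib_left j_def
        using echar_add[of m "l _ - m" t] by (intro sum.cong) auto
      then show ?thesis by (simp add: norm_mult)
    qed
    have 1: "(\<Sum>k\<in>{k\<in>S. m \<le> l k}. d k * echar (j k) t) = (\<Sum>i\<in>{0..int D}. c i * echar i t)" for t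
    proof -
      have "{k\<in>S. m \<le> l k} = {k\<in>S. 0 \<le> j k}" by (auto simp: j_def)
      moreover have "{i\<in>{- int D..int D}. 0 \<le> i} = {0..int D}" by auto
      ultimately show ?thesis
        using sum_echar_group[OF S D, where P = "\<lambda>i. 0 \<le> i" and d = d and t = t] by (simp only: c_def)
    qed
    have 2: "(\<Sum>k\<in>S. d k * echar (j k) t) = (\<Sum>i\<in>{- int D..int D}. c i * echar i t)" for t
      using sum_echar_group[OF S D, where P = "\<lambda>_. True" and d = d and t = t]
      unfolding c_def by (simp del: atLeastAtMost_iff)
    show ?thesis
      using R[where c = c and D = D] unfolding circle_pint_def shift 1 2 by simp
  qed
  then show ?thesis using C that by blast
qed

section \<open>Hexagonal partial sums on the torus\<close>

abbreviation unit_square :: "(real \<times> real) set" where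
  "unit_square \<equiv> {0..1} \<times> {0..1}"

text \<open>Extended values, unlike on the circle: the functions are now merely measurable, and
  membership in L^p is expressed by finiteness of this integral.\<close>

definition torus_pint :: "real \<Rightarrow> (real \<times> real \<Rightarrow> complex) \<Rightarrow> ennreal" where
  "torus_pint p g = (\<integral>\<^sup>+z\<in>unit_square. ennreal (norm (g z) powr p) \<partial>lborel)"

lemma set_nn_integral_product:
  fixes F :: "real \<times> real \<Rightarrow> ennreal"
  assumes [measurable]: "F \<in> borel_measurable borel" "A \<in> sets borel" "B \<in> sets borel"
  shows "(\<integral>\<^sup>+z\<in>A \<times> B. F z \<partial>lborel) = (\<integral>\<^sup>+x\<in>A. (\<integral>\<^sup>+y\<in>B. F (x, y) \<partial>lborel) \<partial>lborel)"
    and "(\<integral>\<^sup>+z\<in>A \<times> B. F z \<partial>lborel) = (\<integral>\<^sup>+y\<in>B. (\<integral>\<^sup>+x\<in>A. F (x, y) \<partial>lborel) \<partial>lborel)"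
proof -
  let ?I = "\<integral>\<^sup>+z\<in>A \<times> B. F z \<partial>lborel"
  have M [measurable]: "F \<in> borel_measurable (lborel \<Otimes>\<^sub>M lborel)"
    by (simp add: lborel_prod)
  have ind: "F (x, y) * indicator (A \<times> B) (x, y) = (F (x, y) * indicator B y) * indicator A x"
    "F (x, y) * indicator (A \<times> B) (x, y) = (F (x, y) * indicator A x) * indicator B y" for x y
    by (simp_all add: indicator_times mult_ac)
  have "?I = (\<integral>\<^sup>+x. \<integral>\<^sup>+y. F (x, y) * indicator (A \<times> B) (x, y) \<partial>lborel \<partial>lborel)"
    unfolding lborel_prod[symmetric] by (subst lborel.nn_integral_fst[symmetric]) simp_all
  also have "\<dots> = (\<integral>\<^sup>+x\<in>A. (\<integral>\<^sup>+y\<in>B. F (x, y) \<partial>lborel) \<partial>lborel)"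
    unfolding ind(1) by (intro nn_integral_cong nn_integral_multc) simp
  finally show "?I = (\<integral>\<^sup>+x\<in>A. (\<integral>\<^sup>+y\<in>B. F (x, y) \<partial>lborel) \<partial>lborel)" .
  have "?I = (\<integral>\<^sup>+y. \<integral>\<^sup>+x. F (x, y) * indicator (A \<times> B) (x, y) \<partial>lborel \<partial>lborel)"
    unfolding lborel_prod[symmetric] by (subst lborel_pair.nn_integral_snd[symmetric]) (simp_all add: case_prod_beta')
  also have "\<dots> = (\<integral>\<^sup>+y\<in>B. (\<integral>\<^sup>+x\<in>A. F (x, y) \<partial>lborel) \<partial>lborel)"
    unfolding ind(2) by (intro nn_integral_cong nn_integral_multc) simp
  finally show "?I = (\<integral>\<^sup>+y\<in>B. (\<integral>\<^sup>+x\<in>A. F (x, y) \<partial>lborel) \<partial>lborel)" .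
qed

lemma set_nn_integral_Fubini:
  fixes F :: "'a::euclidean_space \<times> real \<Rightarrow> ennreal"
  assumes [measurable]: "F \<in> borel_measurable borel" "A \<in> sets borel" "B \<in> sets borel"
  shows "(\<integral>\<^sup>+x\<in>A. (\<integral>\<^sup>+y\<in>B. F (x, y) \<partial>lborel) \<partial>lborel) = (\<integral>\<^sup>+y\<in>B. (\<integral>\<^sup>+x\<in>A. F (x, y) \<partial>lborel) \<partial>lborel)"
proof -
  have M [measurable]: "F \<in> borel_measurable (lborel \<Otimes>\<^sub>M lborel)"
    by (simp add: lborel_prod)
  have "(\<integral>\<^sup>+x\<in>A. (\<integral>\<^sup>+y\<in>B. F (x, y) \<partial>lborel) \<partial>lborel) = (\<integral>\<^sup>+x. \<integral>\<^sup>+y. F (x, y) * indicator B y * indicator A x \<partial>lborel \<partial>lborel)"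
    by (intro nn_integral_cong nn_integral_multc[symmetric]) simp
  also have "\<dots> = (\<integral>\<^sup>+y. \<integral>\<^sup>+x. F (x, y) * indicator B y * indicator A x \<partial>lborel \<partial>lborel)"
    by (intro lborel_pair.Fubini'[symmetric]) (simp add: case_prod_beta')
  also have "\<dots> = (\<integral>\<^sup>+y. \<integral>\<^sup>+x. F (x, y) * indicator A x * indicator B y \<partial>lborel \<partial>lborel)"
    by (simp add: mult_ac)
  also have "\<dots> = (\<integral>\<^sup>+y\<in>B. (\<integral>\<^sup>+x\<in>A. F (x, y) \<partial>lborel) \<partial>lborel)"
    by (intro nn_integral_cong nn_integral_multc) simp
  finally show ?thesis .
qed

text \<open>Only the fractional part of \<open>s\<close> matters; the shifted interval is cut at 1
  and its right-hand piece moved back by one period.\<close>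

lemma periodic_shift_nn_integral:
  fixes \<psi> :: "real \<Rightarrow> ennreal"
  assumes [measurable]: "\<psi> \<in> borel_measurable borel" and per: "\<And>x. \<psi> (x + 1) = \<psi> x"
  shows "(\<integral>\<^sup>+x\<in>{0..1}. \<psi> (x + s) \<partial>lborel) = (\<integral>\<^sup>+x\<in>{0..1}. \<psi> x \<partial>lborel)"
proof -
  have perN: "\<psi> (x + real n) = \<psi> x" for x n
  proof (induction n)
    case (Suc n)
    then show ?case using per[of "x + real n"] by (simp add: add_ac)
  qed simp
  have perI: "\<psi> (x + of_int j) = \<psi> x" for x j
  proof (cases "j \<ge> 0")
    case True
    then show ?thesis using perN[of x "nat j"] by simp
  next
    case False
    then show ?thesis using perN[of "x + of_int j" "nat (- j)"] by simp
  qed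
  have ae: "(\<integral>\<^sup>+x\<in>{0..1}. \<phi> x \<partial>lborel) = (\<integral>\<^sup>+x\<in>{0..<1}. \<phi> x \<partial>lborel)" for \<phi> :: "real \<Rightarrow> ennreal"
  proof (rule nn_integral_cong_AE)
    have "AE x in lborel. x \<noteq> (1::real)" by (rule AE_lborel_singleton)
    then show "AE x in lborel. \<phi> x * indicator {0..1} x = \<phi> x * indicator {0..<1} x"
      by eventually_elim (auto simp: indicator_def)
  qed
  define r where "r = frac s"
  have r: "0 \<le> r" "r < 1" by (auto simp: r_def frac_lt_1)
  have "\<psi> (x + s) = \<psi> (x + r)" for x
    using perI[of "x + r" "\<lfloor>s\<rfloor>"] by (simp add: r_def frac_def)
  then have "(\<integral>\<^sup>+x\<in>{0..1}. \<psi> (x + s) \<partial>lborel) = (\<integral>\<^sup>+x\<in>{0..<1}. \<psi> (x + r) \<partial>lborel)"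
    by (simp add: ae)
  also have "\<dots> = (\<integral>\<^sup>+x. \<psi> (r + 1 * x) * indicator {r..<r + 1} (r + 1 * x) \<partial>lborel)"
    by (intro nn_integral_cong) (auto simp: indicator_def add_ac)
  also have "\<dots> = (\<integral>\<^sup>+x. \<psi> x * indicator {r..<r + 1} x \<partial>lborel)"
    by (subst nn_integral_real_affine[of _ 1 r]) simp_all
  also have "\<dots> = (\<integral>\<^sup>+x. \<psi> x * indicator {r..<1} x + \<psi> x * indicator {1..<r + 1} x \<partial>lborel)"
    using r by (intro nn_integral_cong) (auto simp: indicator_def)
  also have "\<dots> = (\<integral>\<^sup>+x. \<psi> x * indicator {r..<1} x \<partial>lborel) + (\<integral>\<^sup>+x. \<psi> x * indicator {1..<r + 1} x \<partial>lborel)"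
    by (intro nn_integral_add) auto
  also have "(\<integral>\<^sup>+x. \<psi> x * indicator {1..<r + 1} x \<partial>lborel) = (\<integral>\<^sup>+x. \<psi> (1 + 1 * x) * indicator {1..<r + 1} (1 + 1 * x) \<partial>lborel)"
    by (subst nn_integral_real_affine[of _ 1 1]) simp_all
  also have "\<dots> = (\<integral>\<^sup>+x. \<psi> x * indicator {0..<r} x \<partial>lborel)"
    using per by (intro nn_integral_cong) (auto simp: indicator_def add_ac)
  also have "(\<integral>\<^sup>+x. \<psi> x * indicator {r..<1} x \<partial>lborel) + \<dots> = (\<integral>\<^sup>+x. \<psi> x * indicator {r..<1} x + \<psi> x * indicator {0..<r} x \<partial>lborel)"
    by (intro nn_integral_add[symmetric]) auto
  also have "\<dots> = (\<integral>\<^sup>+x\<in>{0..<1}. \<psi> x \<partial>lborel)"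
    using r by (intro nn_integral_cong) (auto simp: indicator_def)
  finally show ?thesis by (simp add: ae)
qed

lemma torus_shift_nn_integral:
  fixes F :: "real \<times> real \<Rightarrow> ennreal"
  assumes [measurable]: "F \<in> borel_measurable borel"
    and per: "\<And>x y. F (x + 1, y) = F (x, y)" "\<And>x y. F (x, y + 1) = F (x, y)"
  shows "(\<integral>\<^sup>+z\<in>unit_square. F (z + w) \<partial>lborel) = (\<integral>\<^sup>+z\<in>unit_square. F z \<partial>lborel)"
proof -
  obtain s t where w: "w = (s, t)" by force
  have [measurable]: "F \<in> borel_measurable (borel \<Otimes>\<^sub>M borel)" by (simp add: borel_prod)
  have "(\<integral>\<^sup>+z\<in>unit_square. F (z + w) \<partial>lborel) = (\<integral>\<^sup>+x\<in>{0..1}. (\<integral>\<^sup>+y\<in>{0..1}. F (x + s, y + t) \<partial>lborel) \<partial>lborel)"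
    by (subst set_nn_integral_product(1)) (auto simp: w)
  also have "\<dots> = (\<integral>\<^sup>+x\<in>{0..1}. (\<integral>\<^sup>+y\<in>{0..1}. F (x + s, y) \<partial>lborel) \<partial>lborel)"
    using per by (subst periodic_shift_nn_integral) simp_all
  also have "\<dots> = (\<integral>\<^sup>+y\<in>{0..1}. (\<integral>\<^sup>+x\<in>{0..1}. F (x + s, y) \<partial>lborel) \<partial>lborel)"
    by (subst set_nn_integral_product(1)[of "\<lambda>(x, y). F (x + s, y)", simplified, symmetric])
       (simp_all add: set_nn_integral_product(2) borel_prod[symmetric])
  also have "\<dots> = (\<integral>\<^sup>+y\<in>{0..1}. (\<integral>\<^sup>+x\<in>{0..1}. F (x, y) \<partial>lborel) \<partial>lborel)"
    using per by (subst periodic_shift_nn_integral[of "\<lambda>x. F (x, _)"]) simp_all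
  also have "\<dots> = (\<integral>\<^sup>+z\<in>unit_square. F z \<partial>lborel)"
    by (rule set_nn_integral_product(2)[symmetric]) auto
  finally show ?thesis .
qed

lemma continuous_on_torus_char [continuous_intros]:
  "continuous_on S g \<Longrightarrow> continuous_on S (\<lambda>x. torus_char k (g x))"
  unfolding torus_char_def by (intro continuous_intros)

lemma measurable_torus_char [measurable]: "torus_char k \<in> borel_measurable borel"
  by (intro borel_measurable_continuous_onI continuous_intros)

lemma norm_torus_char [simp]: "norm (torus_char k z) = 1"
  by (simp add: torus_char_def norm_mult)

lemma circle_pint_nn_integral:
  assumes "continuous_on UNIV f" "p > 0"
  shows "(\<integral>\<^sup>+t\<in>{0..1}. ennreal (norm (f t) powr p) \<partial>lborel) = ennreal (circle_pint p f)"
proof -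
  have cont: "continuous_on UNIV (\<lambda>t. norm (f t) powr p)"
    using assms by (intro continuous_on_powr' continuous_intros) auto
  have [measurable]: "(\<lambda>t. norm (f t) powr p) \<in> borel_measurable borel"
    by (intro borel_measurable_continuous_onI cont)
  have "((\<lambda>t. norm (f t) powr p) has_integral circle_pint p f) {0..1}"
    unfolding circle_pint_def using assms
    by (intro integrable_integral norm_powr_integrable) (auto intro: continuous_on_subset)
  then have "((\<lambda>t. if t \<in> {0..1} then norm (f t) powr p else 0) has_integral circle_pint p f) UNIV"
    by (simp only: has_integral_restrict_UNIV)
  then have "(\<integral>\<^sup>+t. ennreal (if t \<in> {0..1} then norm (f t) powr p else 0) \<partial>lborel) = ennreal (circle_pint p f)"
    by (intro nn_integral_has_integral_lborel) auto
  moreover have "(\<integral>\<^sup>+t. ennreal (if t \<in> {0..1} then norm (f t) powr p else 0) \<partial>lborel)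
      = (\<integral>\<^sup>+t\<in>{0..1}. ennreal (norm (f t) powr p) \<partial>lborel)"
    by (intro nn_integral_cong) (auto simp: indicator_def)
  ultimately show ?thesis by simp
qed

text \<open>The directional estimate is transferred from the circle: averaging over the translations by
  \<open>s v\<close> does not change the integral, and along such a line the sum is a one-dimensional one.\<close>

lemma torus_half_plane:
  fixes p :: real
  assumes p: "1 < p"
  obtains C where "C \<ge> 0"
    "\<And>S c v m. finite S \<Longrightarrow>
       torus_pint p (\<lambda>z. \<Sum>k\<in>{k\<in>S. m \<le> fst k * fst v + snd k * snd v}. c k * torus_char k z)
        \<le> ennreal C * torus_pint p (torus_sum S c)"
proof -
  obtain C where C: "C \<ge> 0" and R:
    "\<And>(S :: (int \<times> int) set) l d m. finite S \<Longrightarrow> circle_pint p (\<lambda>t. \<Sum>k\<in>{k\<in>S. m \<le> l k}. d k * echar (l k) t)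
        \<le> C * circle_pint p (\<lambda>t. \<Sum>k\<in>S. d k * echar (l k) t)"
    by (rule Riesz_half_line[OF p, where 'a = "int \<times> int"]) blast
  have p0: "p > 0" using p by simp
  have "torus_pint p (\<lambda>z. \<Sum>k\<in>{k\<in>S. m \<le> fst k * fst v + snd k * snd v}. c k * torus_char k z)
        \<le> ennreal C * torus_pint p (torus_sum S c)"
    if S: "finite S" for S :: "(int \<times> int) set" and c m v
  proof -
    define l where "l k = fst k * fst v + snd k * snd v" for k :: "int \<times> int"
    define g where "g A z = (\<Sum>k\<in>A. c k * torus_char k z)" for A :: "(int \<times> int) set" and z
    define V :: "real \<Rightarrow> real \<times> real" where "V s = (s * of_int (fst v), s * of_int (snd v))" for s
    \<comment> \<open>Since \<open>v\<close> is integral, \<open>l k\<close> is an integer: in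
      \<open>s\<close> this is a trigonometric sum on the circle whose coefficients depend on
      \<open>z\<close>.\<close>
    have shift: "g A (z + V s) = (\<Sum>k\<in>A. (c k * torus_char k z) * echar (l k) s)" for A z s
      by (auto simp: g_def torus_char_def V_def l_def echar_def cis_mult algebra_simps intro!: sum.cong)
    have contg: "continuous_on UNIV (\<lambda>x. g A (f x))" if "continuous_on UNIV f" for A and f :: "'z::topological_space \<Rightarrow> _"
      unfolding g_def using that by (intro continuous_intros)
    have meas: "(\<lambda>x. ennreal (norm (g A (f x)) powr p)) \<in> borel_measurable borel"
      if "continuous_on UNIV f" for A and f :: "'z::topological_space \<Rightarrow> _"
      using p0 by (intro measurable_compose[OF _ measurable_ennreal] borel_measurable_continuous_onI
          continuous_on_powr' continuous_intros contg that) auto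
    have mj: "(\<lambda>x :: (real \<times> real) \<times> real. ennreal (norm (g A (fst x + V (snd x))) powr p)) \<in> borel_measurable borel" for A
      unfolding V_def by (intro meas continuous_intros)
    have sq: "unit_square \<in> sets borel" by (intro borel_closed closed_Times) auto
    have avg: "torus_pint p (g A) = (\<integral>\<^sup>+z\<in>unit_square. ennreal (circle_pint p (\<lambda>s. g A (z + V s))) \<partial>lborel)" for A
    proof -
      have "torus_pint p (g A) = (\<integral>\<^sup>+s\<in>{0..1::real}. torus_pint p (g A) \<partial>lborel)"
        by (subst nn_integral_cmult_indicator) auto
      also have "\<dots> = (\<integral>\<^sup>+s\<in>{0..1}. (\<integral>\<^sup>+z\<in>unit_square. ennreal (norm (g A (z + V s)) powr p) \<partial>lborel) \<partial>lborel)"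
      proof (intro nn_integral_cong arg_cong2[of _ _ _ _ "(*)"] refl)
        fix s :: real
        show "torus_pint p (g A) = (\<integral>\<^sup>+z\<in>unit_square. ennreal (norm (g A (z + V s)) powr p) \<partial>lborel)"
          unfolding torus_pint_def
        proof (rule torus_shift_nn_integral[symmetric])
          show "(\<lambda>z. ennreal (norm (g A z) powr p)) \<in> borel_measurable borel"
            by (intro meas continuous_intros)
        qed (auto simp: g_def torus_char_def echar_plus_one)
      qed
      also have "\<dots> = (\<integral>\<^sup>+z\<in>unit_square. (\<integral>\<^sup>+s\<in>{0..1}. ennreal (norm (g A (z + V s)) powr p) \<partial>lborel) \<partial>lborel)"
        using set_nn_integral_Fubini[OF mj[of A] sq, of "{0..1}"] by simp
      also have "\<dots> = (\<integral>\<^sup>+z\<in>unit_square. ennreal (circle_pint p (\<lambda>s. g A (z + V s))) \<partial>lborel)"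
        by (subst circle_pint_nn_integral) (auto simp: V_def intro!: contg continuous_intros p0)
      finally show ?thesis .
    qed
    have "torus_pint p (g {k\<in>S. m \<le> l k})
        = (\<integral>\<^sup>+z\<in>unit_square. ennreal (circle_pint p (\<lambda>s. g {k\<in>S. m \<le> l k} (z + V s))) \<partial>lborel)"
      by (rule avg)
    also have "\<dots> \<le> (\<integral>\<^sup>+z\<in>unit_square. ennreal C * ennreal (circle_pint p (\<lambda>s. g S (z + V s))) \<partial>lborel)"
      unfolding shift
      by (intro nn_integral_mono mult_right_mono)
         (auto simp: ennreal_mult[symmetric] C circle_pint_nonneg intro!: ennreal_leI R S)
    also have "\<dots> = (\<integral>\<^sup>+z. ennreal C * (ennreal (circle_pint p (\<lambda>s. g S (z + V s))) * indicator unit_square z) \<partial>lborel)"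
      by (simp add: mult_ac)
    also have "\<dots> = ennreal C * (\<integral>\<^sup>+z\<in>unit_square. ennreal (circle_pint p (\<lambda>s. g S (z + V s))) \<partial>lborel)"
    proof (rule nn_integral_cmult)
      have "(\<lambda>z. \<integral>\<^sup>+s\<in>{0..1}. ennreal (norm (g S (z + V s)) powr p) \<partial>lborel) \<in> borel_measurable lborel"
      proof (rule lborel.borel_measurable_nn_integral)
        have [measurable]: "(\<lambda>x :: (real \<times> real) \<times> real. ennreal (norm (g S (fst x + V (snd x))) powr p)) \<in> borel_measurable (lborel \<Otimes>\<^sub>M lborel)"
          using mj by (simp add: lborel_prod)
        show "(\<lambda>(z, s). ennreal (norm (g S (z + V s)) powr p) * indicator {0..1} s) \<in> borel_measurable (lborel \<Otimes>\<^sub>M lborel)"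
          by (simp add: case_prod_beta')
      qed
      then have m1: "(\<lambda>z. ennreal (circle_pint p (\<lambda>s. g S (z + V s)))) \<in> borel_measurable lborel"
        by (subst (asm) circle_pint_nn_integral) (auto simp: V_def intro!: contg continuous_intros p0)
      show "(\<lambda>z. ennreal (circle_pint p (\<lambda>s. g S (z + V s))) * indicator unit_square z) \<in> borel_measurable lborel"
        by (intro borel_measurable_times_ennreal m1 borel_measurable_indicator) (use sq in simp)
    qed
    also have "\<dots> = ennreal C * torus_pint p (g S)" by (simp add: avg)
    finally show ?thesis unfolding g_def l_def .
  qed
  then show ?thesis using C that by blast
qed

definition hexagon :: "nat \<Rightarrow> (int \<times> int) set" where
  "hexagon N = {(a, b). \<bar>a\<bar> \<le> int N \<and> \<bar>b\<bar> \<le> int N \<and> \<bar>a + b\<bar> \<le> int N}"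

lemma finite_hexagon: "finite (hexagon N)"
  by (rule finite_subset[of _ "{- int N..int N} \<times> {- int N..int N}"]) (auto simp: hexagon_def)

text \<open>The cuts are applied successively, each to the finite index set left by the one before,
  whence the sixth power of the half-plane constant. All six have the threshold -N, on which that
  constant does not depend.\<close>

theorem torus_hexagon:
  fixes p :: real
  assumes p: "1 < p"
  obtains C where "C \<ge> 0"
    "\<And>S c N. finite S \<Longrightarrow>
       torus_pint p (torus_sum (S \<inter> hexagon N) c)
        \<le> ennreal C * torus_pint p (torus_sum S c)"
proof -
  obtain C where C: "C \<ge> 0" and H:
    "\<And>S c v m. finite S \<Longrightarrow>
       torus_pint p (\<lambda>z. \<Sum>k\<in>{k\<in>S. m \<le> fst k * fst v + snd k * snd v}. c k * torus_char k z)
        \<le> ennreal C * torus_pint p (torus_sum S c)"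
    by (rule torus_half_plane[OF p]) blast
  have "torus_pint p (torus_sum (S \<inter> hexagon N) c)
        \<le> ennreal (C ^ 6) * torus_pint p (torus_sum S c)"
    if S: "finite S" for S c N
  proof -
    define h where "h v S = {k\<in>S. - int N \<le> fst k * fst v + snd k * snd v}" for v :: "int \<times> int" and S :: "(int \<times> int) set"
    define T where "T S = torus_pint p (torus_sum S c)" for S
    have fin: "finite (h v S)" if "finite S" for v S using that by (simp add: h_def)
    have step: "T (h v S) \<le> ennreal (C ^ Suc n) * X" if "finite S" "T S \<le> ennreal (C ^ n) * X" for v S n X
    proof -
      have "T (h v S) \<le> ennreal C * T S" unfolding T_def h_def by (rule H) fact
      also have "\<dots> \<le> ennreal C * (ennreal (C ^ n) * X)" by (intro mult_left_mono that) simp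
      finally show ?thesis using C by (simp add: ennreal_mult mult_ac)
    qed
    have "S \<inter> hexagon N = h (1, 1) (h (-1, -1) (h (0, 1) (h (0, -1) (h (1, 0) (h (-1, 0) S)))))"
      by (auto simp: h_def hexagon_def)
    moreover have "T (h (1, 1) (h (-1, -1) (h (0, 1) (h (0, -1) (h (1, 0) (h (-1, 0) S))))))
        \<le> ennreal (C ^ Suc (Suc (Suc (Suc (Suc (Suc 0)))))) * T S"
      by (intro step fin S) simp
    ultimately show ?thesis by (simp add: T_def numeral_eq_Suc)
  qed
  then show ?thesis using C by (intro that[of "C ^ 6"]) auto
qed

section \<open>Density of trigonometric polynomials in L^p\<close>

lemma sets_unit_square [measurable]: "unit_square \<in> sets borel"
  by (intro borel_closed closed_Times) auto

lemma emeasure_unit_square: "emeasure lborel unit_square = 1"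
proof -
  have "unit_square = cbox (0, 0) (1, 1)" by (simp add: cbox_Pair_eq)
  then show ?thesis by (simp add: emeasure_lborel_cbox_eq Basis_prod_def prod.union_disjoint inner_prod_def)
qed

lemma torus_pint_add:
  assumes [measurable]: "f \<in> borel_measurable borel" "g \<in> borel_measurable borel" and p: "0 < p"
  shows "torus_pint p (\<lambda>z. f z + g z) \<le> ennreal (2 powr p) * (torus_pint p f + torus_pint p g)"
proof -
  have le: "norm (f z + g z) powr p \<le> 2 powr p * (norm (f z) powr p + norm (g z) powr p)" for z
  proof -
    have "norm (f z + g z) powr p \<le> (norm (f z) + norm (g z)) powr p"
      using p by (intro powr_mono2 norm_triangle_ineq) auto
    also have "\<dots> \<le> 2 powr p * (norm (f z) powr p + norm (g z) powr p)"
      using p by (intro powr_add_le) auto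
    finally show ?thesis .
  qed
  have "torus_pint p (\<lambda>z. f z + g z)
      \<le> (\<integral>\<^sup>+z. ennreal (2 powr p) * (ennreal (norm (f z) powr p) * indicator unit_square z + ennreal (norm (g z) powr p) * indicator unit_square z) \<partial>lborel)"
    unfolding torus_pint_def
    by (intro nn_integral_mono) (auto simp: indicator_def ennreal_mult[symmetric] ennreal_plus[symmetric] simp del: ennreal_plus intro!: ennreal_leI le)
  also have "\<dots> = ennreal (2 powr p) * (torus_pint p f + torus_pint p g)"
    unfolding torus_pint_def by (subst nn_integral_cmult) (auto simp: nn_integral_add)
  finally show ?thesis .
qed

lemma torus_pint_minus_commute: "torus_pint p (\<lambda>z. f z - g z) = torus_pint p (\<lambda>z. g z - f z)"
  by (simp add: torus_pint_def norm_minus_commute)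

lemma torus_pint_bound:
  assumes "0 < p" "0 \<le> d" "\<And>z. z \<in> unit_square \<Longrightarrow> norm (f z) \<le> d"
  shows "torus_pint p f \<le> ennreal (d powr p)"
proof -
  have "torus_pint p f \<le> (\<integral>\<^sup>+z. ennreal (d powr p) * indicator unit_square z \<partial>lborel)"
    unfolding torus_pint_def using assms
    by (intro nn_integral_mono) (auto simp: indicator_def intro!: ennreal_leI powr_mono2)
  also have "\<dots> = ennreal (d powr p)"
    by (subst nn_integral_cmult_indicator) (auto simp: emeasure_unit_square)
  finally show ?thesis .
qed

lemma torus_pint_tendsto_0:
  fixes h :: "real \<times> real \<Rightarrow> complex"
  assumes p: "0 < p" and [measurable]: "\<And>n. u n \<in> borel_measurable borel" "w \<in> borel_measurable borel"
    and bound: "\<And>n z. z \<in> unit_square \<Longrightarrow> norm (u n z) \<le> norm (w z)" and w: "torus_pint p w < \<infinity>"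
    and lim: "AE z in lborel. z \<in> unit_square \<longrightarrow> (\<lambda>n. u n z) \<longlonglongrightarrow> 0"
  shows "(\<lambda>n. torus_pint p (u n)) \<longlonglongrightarrow> 0"
proof -
  have "(\<lambda>n. torus_pint p (u n)) \<longlonglongrightarrow> (\<integral>\<^sup>+z. 0 \<partial>(lborel :: (real \<times> real) measure))"
    unfolding torus_pint_def
  proof (rule nn_integral_dominated_convergence[where w = "\<lambda>z. ennreal (norm (w z) powr p) * indicator unit_square z"])
    show "AE z in lborel. ennreal (norm (u n z) powr p) * indicator unit_square z \<le> ennreal (norm (w z) powr p) * indicator unit_square z" for n
      using bound p by (intro AE_I2) (auto simp: indicator_def intro!: ennreal_leI powr_mono2)
    show "(\<integral>\<^sup>+z. ennreal (norm (w z) powr p) * indicator unit_square z \<partial>lborel) < \<infinity>"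
      using w by (simp add: torus_pint_def)
    show "AE z in lborel. (\<lambda>n. ennreal (norm (u n z) powr p) * indicator unit_square z) \<longlonglongrightarrow> 0"
      using lim
    proof eventually_elim
      case (elim z)
      show ?case
      proof (cases "z \<in> unit_square")
        case True
        then have "(\<lambda>n. norm (u n z)) \<longlonglongrightarrow> 0" using elim by (simp add: tendsto_norm_zero)
        then have "(\<lambda>n. norm (u n z) powr p) \<longlonglongrightarrow> 0"
          using p by (intro tendsto_zero_powrI[where b = p]) auto
        then have "(\<lambda>n. ennreal (norm (u n z) powr p)) \<longlonglongrightarrow> ennreal 0"
          by (rule tendsto_ennrealI)
        then show ?thesis using True by simp
      qed simp
    qed
  qed auto
  then show ?thesis by simp
qed

lemma cis_eq_unit_interval:
  assumes "cis (2 * pi * x) = cis (2 * pi * y)" "x \<in> {0..1}" "y \<in> {0..1}"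
  shows "x = y \<or> (x \<in> {0, 1} \<and> y \<in> {0, 1})"
proof -
  have "cis (2 * pi * x) / cis (2 * pi * y) = 1" using assms(1) by simp
  then have "cis (2 * pi * (x - y)) = 1" by (simp add: cis_divide right_diff_distrib)
  then have "cos (2 * pi * (x - y)) = 1" by (metis cis.sel(1) one_complex.sel(1))
  then obtain n :: int where "2 * pi * (x - y) = of_int n * 2 * pi"
    using cos_one_2pi_int by blast
  then have n: "x - y = of_int n" by simp
  have "of_int n \<le> (1::real)" "of_int n \<ge> (-1::real)" using assms n by auto
  then have "n \<in> {-1, 0, 1}" by auto
  then show ?thesis using n assms by auto
qed

text \<open>Vanishing on the boundary makes \<open>k\<close> compatible with the identification of
  opposite sides, so it factors through \<open>torus_point\<close>. The factor is continuous because
  preimages of closed sets under it are images of compact sets.\<close>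

lemma continuous_on_torus_quotient:
  fixes k :: "real \<times> real \<Rightarrow> complex"
  assumes cont: "continuous_on unit_square k"
    and bdry: "\<And>x y. (x, y) \<in> unit_square \<Longrightarrow> x \<in> {0, 1} \<or> y \<in> {0, 1} \<Longrightarrow> k (x, y) = 0"
  obtains \<Phi> where "continuous_on (sphere 0 1 \<times> sphere 0 1) \<Phi>"
    "\<And>z. z \<in> unit_square \<Longrightarrow> \<Phi> (torus_point z) = k z"
proof -
  define \<phi> where "\<phi> z = (cis (2 * pi * fst z), cis (2 * pi * snd z))" for z :: "real \<times> real"
  define \<Phi> where "\<Phi> w = k (SOME z. z \<in> unit_square \<and> \<phi> z = w)" for w
  have eq: "k z = k z'" if "z \<in> unit_square" "z' \<in> unit_square" "\<phi> z = \<phi> z'" for z z'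
  proof -
    obtain x y x' y' where z: "z = (x, y)" "z' = (x', y')" by (metis surj_pair)
    have "x = x' \<or> (x \<in> {0, 1} \<and> x' \<in> {0, 1})" "y = y' \<or> (y \<in> {0, 1} \<and> y' \<in> {0, 1})"
      using that by (intro cis_eq_unit_interval; simp add: z \<phi>_def)+
    then consider "z = z'" | "(x \<in> {0, 1} \<and> x' \<in> {0, 1}) \<or> (y \<in> {0, 1} \<and> y' \<in> {0, 1})"
      unfolding z by blast
    then show ?thesis
    proof cases
      case 2
      then have "k z = 0" "k z' = 0"
        unfolding z using that by (auto intro!: bdry simp: z)
      then show ?thesis by simp
    qed simp
  qed
  have \<Phi>: "\<Phi> (\<phi> z) = k z" if "z \<in> unit_square" for z
  proof -
    have "(SOME z'. z' \<in> unit_square \<and> \<phi> z' = \<phi> z) \<in> unit_square \<and> \<phi> (SOME z'. z' \<in> unit_square \<and> \<phi> z' = \<phi> z) = \<phi> z"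
      by (rule someI[of _ z]) (use that in auto)
    then show ?thesis unfolding \<Phi>_def using that by (intro eq) auto
  qed
  have sq: "compact unit_square" by (intro compact_Times) auto
  have cont\<phi>: "continuous_on S \<phi>" for S unfolding \<phi>_def by (intro continuous_intros)
  have onto: "\<exists>z\<in>unit_square. w = \<phi> z" if "w \<in> sphere 0 1 \<times> sphere 0 1" for w
  proof -
    have "\<exists>t\<in>{0..1}. cis (2 * pi * t) = u" if "norm u = 1" for u :: complex
    proof -
      have u0: "u \<noteq> 0" using that by auto
      then have "cis (Arg2pi u) = u" using Arg2pi_eq[of u] that by (simp add: cis_conv_exp)
      then have "cis (2 * pi * (Arg2pi u / (2 * pi))) = u" by simp
      moreover have "Arg2pi u / (2 * pi) \<in> {0..1}"
        using Arg2pi[of u] by (auto simp: field_simps)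
      ultimately show ?thesis by blast
    qed
    then show ?thesis using that unfolding \<phi>_def by (cases w) (force simp: prod_eq_iff)
  qed
  have "continuous_on (sphere 0 1 \<times> sphere 0 1) \<Phi>"
  proof (subst continuous_on_closed_vimage)
    show "closed (sphere (0::complex) 1 \<times> sphere (0::complex) 1)" by (intro closed_Times) auto
    show "\<forall>B. closed B \<longrightarrow> closed (\<Phi> -` B \<inter> sphere 0 1 \<times> sphere 0 1)"
    proof (intro allI impI)
      fix B :: "complex set" assume B: "closed B"
      have "\<Phi> -` B \<inter> sphere 0 1 \<times> sphere 0 1 = \<phi> ` (k -` B \<inter> unit_square)"
      proof (intro set_eqI iffI)
        fix w assume w: "w \<in> \<Phi> -` B \<inter> sphere 0 1 \<times> sphere 0 1"
        then obtain z where "z \<in> unit_square" "w = \<phi> z" using onto by blast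
        then show "w \<in> \<phi> ` (k -` B \<inter> unit_square)" using w \<Phi> by auto
      next
        fix w assume "w \<in> \<phi> ` (k -` B \<inter> unit_square)"
        then obtain z where "z \<in> unit_square" "w = \<phi> z" "k z \<in> B" by blast
        then show "w \<in> \<Phi> -` B \<inter> sphere 0 1 \<times> sphere 0 1" using \<Phi>[of z] by (auto simp: \<phi>_def)
      qed
      moreover have "compact (k -` B \<inter> unit_square)"
      proof -
        have "closed (k -` B \<inter> unit_square)"
          using cont B sq by (simp add: continuous_on_closed_vimage compact_imp_closed)
        then have "compact (unit_square \<inter> (k -` B \<inter> unit_square))" using sq by (intro compact_Int_closed)
        then show ?thesis by (simp add: Int_commute Int_left_commute)
      qed
      ultimately show "closed (\<Phi> -` B \<inter> sphere 0 1 \<times> sphere 0 1)"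
        using cont\<phi> by (simp add: compact_continuous_image compact_imp_closed)
    qed
  qed
  then show ?thesis using \<Phi> that unfolding \<phi>_def by blast
qed

lemma measurable_trig_polys: "f \<in> trig_polys \<Longrightarrow> f \<in> borel_measurable borel"
  by (induction rule: trig_polys.induct) auto

lemma AE_lborel_not_negligible:
  assumes "negligible (N :: 'a::euclidean_space set)"
  shows "AE z in lborel. z \<notin> N"
proof -
  have "AE z in lebesgue. z \<notin> N"
    using assms by (simp add: negligible_iff_null_sets AE_not_in)
  then show ?thesis by (simp add: AE_completion_iff)
qed

lemma AE_lborel_square_interior:
  "AE z in lborel. z \<in> unit_square \<longrightarrow> 0 < fst z \<and> fst z < (1::real) \<and> 0 < snd z \<and> snd z < (1::real)"
  using AE_lborel_not_negligible[OF negligible_frontier_interval[of "(0, 0)" "(1, 1) :: real \<times> real"]]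
  by eventually_elim (auto simp: mem_box Basis_prod_def cbox_Pair_eq)

text \<open>A truncation of \<open>h\<close> is approximated by continuous functions that vanish on
  the boundary of the square; these live on the torus, where trigonometric polynomials approximate
  them uniformly.\<close>

lemma trig_polys_dense:
  fixes h :: "real \<times> real \<Rightarrow> real"
  assumes p: "0 < p" and h [measurable]: "h \<in> borel_measurable borel"
    and fin: "torus_pint p (\<lambda>z. of_real (h z)) < \<infinity>" and e: "0 < e"
  obtains q where "q \<in> trig_polys" "torus_pint p (\<lambda>z. of_real (h z) - q z) \<le> e"
proof -
  \<comment> \<open>The condition mirrors the two nested uses of \<open>torus_pint_add\<close> at
    the end, for three errors of size \<open>d\<close>.\<close>
  obtain d where d: "0 < d" "ennreal (2 powr p) * (d + ennreal (2 powr p) * (d + d)) \<le> e" "d \<noteq> \<infinity>"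
  proof (cases e)
    case (real r)
    then have r: "r > 0" using e by simp
    define c where "c = 2 powr p * (1 + 2 powr p * 2)"
    define D where "D = r / c"
    have pos: "c > 0" by (simp add: c_def add_pos_pos)
    have D: "D > 0" using r pos by (simp add: D_def)
    have "2 powr p * (D + 2 powr p * (D + D)) = c * D"
      by (simp add: c_def algebra_simps)
    also have "\<dots> = r" using pos by (simp add: D_def)
    finally have "2 powr p * (D + 2 powr p * (D + D)) = r" .
    then have "ennreal (2 powr p) * (ennreal D + ennreal (2 powr p) * (ennreal D + ennreal D)) = e"
      using D real by (simp add: ennreal_mult[symmetric] ennreal_plus[symmetric] del: ennreal_plus)
    then show ?thesis using D that[of "ennreal D"] by simp
  next
    case top
    then show ?thesis using that[of 1] by simp
  qed
  define hn where "hn n z = max (- real n) (min (real n) (h z))" for n z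
  have [measurable]: "hn n \<in> borel_measurable borel" for n unfolding hn_def by measurable
  have "(\<lambda>n. torus_pint p (\<lambda>z. of_real (h z) - of_real (hn n z))) \<longlonglongrightarrow> 0"
  proof (rule torus_pint_tendsto_0[where w = "\<lambda>z. of_real (h z)"])
    show "norm (complex_of_real (h z) - of_real (hn n z)) \<le> norm (complex_of_real (h z))" for n z
      unfolding of_real_diff[symmetric] norm_of_real by (auto simp: hn_def)
    show "AE z in lborel. z \<in> unit_square \<longrightarrow> (\<lambda>n. complex_of_real (h z) - of_real (hn n z)) \<longlonglongrightarrow> 0"
    proof (intro AE_I2 impI)
      fix z
      obtain N :: nat where "\<bar>h z\<bar> \<le> real N" using real_arch_simple by blast
      then have "\<forall>n\<ge>N. hn n z = h z" by (auto simp: hn_def)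
      then have "eventually (\<lambda>n. complex_of_real (h z) - of_real (hn n z) = 0) sequentially"
        unfolding eventually_sequentially by (intro exI[of _ N]) simp
      then show "(\<lambda>n. complex_of_real (h z) - of_real (hn n z)) \<longlonglongrightarrow> 0"
        by (rule tendsto_eventually)
    qed
  qed (use p fin in auto)
  then have "eventually (\<lambda>n. torus_pint p (\<lambda>z. of_real (h z) - of_real (hn n z)) < d) sequentially"
    using d(1) by (rule order_tendstoD(2))
  then obtain K where K: "torus_pint p (\<lambda>z. of_real (h z) - of_real (hn K z)) < d"
    by (auto simp: eventually_sequentially)
  have "hn K measurable_on UNIV"
    by (intro lebesgue_measurable_imp_measurable_on measurable_completion) auto
  \<comment> \<open>The definition of \<open>measurable_on\<close> itself supplies continuous
    functions converging outside a negligible set.\<close>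
  then obtain N g where N: "negligible N" and contg: "\<And>n. continuous_on UNIV (g n)"
    and glim: "\<And>x. x \<notin> N \<Longrightarrow> (\<lambda>n. g n x) \<longlonglongrightarrow> hn K x"
    unfolding measurable_on_def by auto
  \<comment> \<open>Zero on the boundary and eventually 1 at each interior point. Clipping
    \<open>g n\<close> at height \<open>K\<close> below provides the dominating constant 2K.\<close>
  define cut where "cut n z = min 1 (max 0 (real n * (fst z * (1 - fst z) * (snd z * (1 - snd z)))))" for n and z :: "real \<times> real"
  define k where "k n z = cut n z * max (- real K) (min (real K) (g n z))" for n z
  have contk: "continuous_on UNIV (k n)" for n
    unfolding k_def cut_def by (intro continuous_intros contg)
  have [measurable]: "k n \<in> borel_measurable borel" for n
    by (intro borel_measurable_continuous_onI contk)
  have aeN: "AE z in lborel. z \<notin> N" using N by (rule AE_lborel_not_negligible)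
  have "(\<lambda>n. torus_pint p (\<lambda>z. of_real (hn K z) - of_real (k n z))) \<longlonglongrightarrow> 0"
  proof (rule torus_pint_tendsto_0[where w = "\<lambda>z. of_real (2 * real K)"])
    show "norm (complex_of_real (hn K z) - of_real (k n z)) \<le> norm (complex_of_real (2 * real K))" for n z
    proof -
      have "\<bar>k n z\<bar> \<le> 1 * real K"
        unfolding k_def abs_mult by (intro mult_mono) (auto simp: cut_def)
      moreover have "\<bar>hn K z\<bar> \<le> real K" by (auto simp: hn_def)
      ultimately show ?thesis unfolding of_real_diff[symmetric] norm_of_real by simp
    qed
    have "torus_pint p (\<lambda>z. of_real (2 * real K)) \<le> ennreal ((2 * real K) powr p)"
      using p by (intro torus_pint_bound) auto
    then show "torus_pint p (\<lambda>z. of_real (2 * real K)) < \<infinity>"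
      by (simp add: le_less_trans)
    show "AE z in lborel. z \<in> unit_square \<longrightarrow> (\<lambda>n. complex_of_real (hn K z) - of_real (k n z)) \<longlonglongrightarrow> 0"
      using aeN AE_lborel_square_interior
    proof eventually_elim
      case (elim z)
      show ?case
      proof
        assume "z \<in> unit_square"
        then have z: "0 < fst z" "fst z < 1" "0 < snd z" "snd z < 1" using elim by auto
        define r where "r = fst z * (1 - fst z) * (snd z * (1 - snd z))"
        have r: "r > 0" using z by (simp add: r_def)
        obtain M :: nat where M: "1 / r \<le> real M" using real_arch_simple by blast
        have "cut n z = 1" if "n \<ge> M" for n
        proof -
          have "1 / r \<le> real n" using M that by linarith
          then have "1 \<le> real n * r" using r by (simp add: field_simps)
          then show ?thesis by (simp add: cut_def r_def)
        qed
        then have "eventually (\<lambda>n. cut n z = 1) sequentially"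
          unfolding eventually_sequentially by blast
        then have "(\<lambda>n. cut n z) \<longlonglongrightarrow> 1" by (rule tendsto_eventually)
        then have "(\<lambda>n. k n z) \<longlonglongrightarrow> 1 * max (- real K) (min (real K) (hn K z))"
          unfolding k_def using glim elim by (intro tendsto_intros) auto
        also have "1 * max (- real K) (min (real K) (hn K z)) = hn K z" by (auto simp: hn_def)
        finally have "(\<lambda>n. complex_of_real (hn K z) - of_real (k n z)) \<longlonglongrightarrow> of_real (hn K z) - of_real (hn K z)"
          by (intro tendsto_intros)
        then show "(\<lambda>n. complex_of_real (hn K z) - of_real (k n z)) \<longlonglongrightarrow> 0" by simp
      qed
    qed
  qed (use p in auto)
  then have "eventually (\<lambda>n. torus_pint p (\<lambda>z. of_real (hn K z) - of_real (k n z)) < d) sequentially"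
    using d(1) by (rule order_tendstoD(2))
  then obtain n where n: "torus_pint p (\<lambda>z. of_real (hn K z) - of_real (k n z)) < d"
    by (auto simp: eventually_sequentially)
  obtain \<Phi> where \<Phi>: "continuous_on (sphere 0 1 \<times> sphere 0 1) \<Phi>"
    "\<And>z. z \<in> unit_square \<Longrightarrow> \<Phi> (torus_point z) = complex_of_real (k n z)"
  proof (rule continuous_on_torus_quotient[of "\<lambda>z. complex_of_real (k n z)"])
    show "continuous_on unit_square (\<lambda>z. complex_of_real (k n z))"
      by (intro continuous_intros continuous_on_subset[OF contk]) auto
    show "complex_of_real (k n (x, y)) = 0" if "x \<in> {0, 1} \<or> y \<in> {0, 1}" for x y
      using that by (auto simp: k_def cut_def)
  qed blast
  obtain \<delta> where \<delta>: "\<delta> > 0" "ennreal (\<delta> powr p) \<le> d"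
  proof -
    obtain D where "d = ennreal D" "D > 0" using d by (cases d) auto
    then show ?thesis using p by (intro that[of "D powr (1 / p)"]) (auto simp: powr_powr)
  qed
  obtain q where q: "q \<in> trig_polys"
    "\<And>z. norm (q z - \<Phi> (torus_point z)) < \<delta>"
    using torus_Stone_Weierstrass[OF \<Phi>(1) \<delta>(1)] by blast
  have [measurable]: "q \<in> borel_measurable borel" using q(1) by (rule measurable_trig_polys)
  have kq: "torus_pint p (\<lambda>z. of_real (k n z) - q z) \<le> d"
  proof -
    have "torus_pint p (\<lambda>z. of_real (k n z) - q z) \<le> ennreal (\<delta> powr p)"
    proof (rule torus_pint_bound[OF p])
      show "norm (complex_of_real (k n z) - q z) \<le> \<delta>" if "z \<in> unit_square" for z
        using q(2)[of z] \<Phi>(2)[OF that] by (simp add: norm_minus_commute less_imp_le)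
    qed (use \<delta> in simp)
    then show ?thesis using \<delta>(2) by order
  qed
  have "torus_pint p (\<lambda>z. of_real (h z) - q z)
      = torus_pint p (\<lambda>z. (of_real (h z) - of_real (hn K z)) + ((of_real (hn K z) - of_real (k n z)) + (of_real (k n z) - q z)))"
    by simp
  also have "\<dots> \<le> ennreal (2 powr p) * (torus_pint p (\<lambda>z. of_real (h z) - of_real (hn K z))
      + torus_pint p (\<lambda>z. (of_real (hn K z) - of_real (k n z)) + (of_real (k n z) - q z)))"
    using p by (intro torus_pint_add) auto
  also have "torus_pint p (\<lambda>z. (of_real (hn K z) - of_real (k n z)) + (of_real (k n z) - q z))
      \<le> ennreal (2 powr p) * (torus_pint p (\<lambda>z. of_real (hn K z) - of_real (k n z)) + torus_pint p (\<lambda>z. of_real (k n z) - q z))"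
    using p by (intro torus_pint_add) auto
  finally have "torus_pint p (\<lambda>z. of_real (h z) - q z)
      \<le> ennreal (2 powr p) * (torus_pint p (\<lambda>z. of_real (h z) - of_real (hn K z))
      + ennreal (2 powr p) * (torus_pint p (\<lambda>z. of_real (hn K z) - of_real (k n z)) + torus_pint p (\<lambda>z. of_real (k n z) - q z)))"
    by (simp add: mult_left_mono)
  also have "\<dots> \<le> ennreal (2 powr p) * (d + ennreal (2 powr p) * (d + d))"
    using K n kq by (intro mult_left_mono add_mono) auto
  also have "\<dots> \<le> e" by (rule d(2))
  finally show ?thesis using q(1) that by blast
qed

section \<open>Hexagonal sums of functions in L^p\<close>

definition torus_coeff :: "(real \<times> real \<Rightarrow> complex) \<Rightarrow> int \<times> int \<Rightarrow> complex" where
  "torus_coeff f k = (LINT z:unit_square|lborel. f z * cnj (torus_char k z))"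

definition hexagonal_sum :: "nat \<Rightarrow> (real \<times> real \<Rightarrow> complex) \<Rightarrow> real \<times> real \<Rightarrow> complex" where
  "hexagonal_sum N f z = (\<Sum>k\<in>hexagon N. torus_coeff f k * torus_char k z)"

lemma torus_char_integral:
  "(LINT z:unit_square|lborel. torus_char k z) = (if k = (0, 0) then 1 else 0)"
proof -
  define u where "u j t = indicator {0..1} t *\<^sub>R echar j t" for j t
  have int: "integrable lborel (\<lambda>z. indicator unit_square z *\<^sub>R torus_char k z)"
    by (intro borel_integrable_compact compact_Times continuous_intros) auto
  have eq: "indicator unit_square (x, y) *\<^sub>R torus_char k (x, y) = u (fst k) x * u (snd k) y" for x y
    by (simp add: u_def torus_char_def indicator_times)
  have I: "(LINT t|lborel. u j t) = (if j = 0 then 1 else 0)" for j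
  proof -
    have "set_integrable lborel {0..1} (echar j)"
      by (intro borel_integrable_atLeastAtMost' continuous_intros)
    from set_borel_integral_eq_integral(2)[OF this] show ?thesis
      using integral_unique[OF has_integral_echar[of j]] by (simp add: u_def set_lebesgue_integral_def)
  qed
  have "(LINT z:unit_square|lborel. torus_char k z)
      = (LINT x|lborel. LINT y|lborel. indicator unit_square (x, y) *\<^sub>R torus_char k (x, y))"
    unfolding set_lebesgue_integral_def using int unfolding lborel_prod[symmetric]
    by (rule lborel_pair.integral_fst'[symmetric])
  also have "\<dots> = (if fst k = 0 then 1 else 0) * (if snd k = 0 then 1 else 0)"
    unfolding eq by (simp add: I)
  also have "\<dots> = (if k = (0, 0) then 1 else 0)" by (cases k) auto
  finally show ?thesis .
qed

text \<open>The square has measure 1, and |f| <= 1 + |f|^p pointwise.\<close>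

lemma set_integrable_torus:
  assumes p: "1 \<le> p" and [measurable]: "f \<in> borel_measurable borel" and fin: "torus_pint p f < \<infinity>"
    and g [measurable]: "g \<in> borel_measurable borel" and gb: "\<And>z. norm (g z) \<le> 1"
  shows "set_integrable lborel unit_square (\<lambda>z. f z * g z)"
  unfolding set_integrable_def integrable_iff_bounded
proof
  show "(\<lambda>z. indicator unit_square z *\<^sub>R (f z * g z)) \<in> borel_measurable lborel" by simp
  have le: "norm (f z * g z) \<le> 1 + norm (f z) powr p" for z
  proof -
    have "norm (f z * g z) \<le> norm (f z) * 1"
      unfolding norm_mult by (intro mult_left_mono gb) auto
    also have "norm (f z) \<le> 1 + norm (f z) powr p"
    proof (cases "norm (f z) \<le> 1")
      case False
      then have "norm (f z) powr 1 \<le> norm (f z) powr p" using p by (intro powr_mono) auto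
      then show ?thesis using False by simp
    qed (simp add: add_increasing2)
    finally show ?thesis by simp
  qed
  have "(\<integral>\<^sup>+z. ennreal (norm (indicator unit_square z *\<^sub>R (f z * g z))) \<partial>lborel)
      \<le> (\<integral>\<^sup>+z. indicator unit_square z + ennreal (norm (f z) powr p) * indicator unit_square z \<partial>lborel)"
  proof (intro nn_integral_mono)
    fix z
    show "ennreal (norm (indicator unit_square z *\<^sub>R (f z * g z))) \<le> indicator unit_square z + ennreal (norm (f z) powr p) * indicator unit_square z"
    proof (cases "z \<in> unit_square")
      case True
      have "ennreal (norm (f z * g z)) \<le> ennreal (1 + norm (f z) powr p)" by (rule ennreal_leI) (rule le)
      also have "\<dots> = 1 + ennreal (norm (f z) powr p)" by (subst ennreal_plus) auto
      finally show ?thesis using True by simp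
    qed simp
  qed
  also have "\<dots> = 1 + torus_pint p f"
    unfolding torus_pint_def by (subst nn_integral_add) (auto simp: emeasure_unit_square)
  also have "\<dots> < \<infinity>" using fin by simp
  finally show "(\<integral>\<^sup>+z. ennreal (norm (indicator unit_square z *\<^sub>R (f z * g z))) \<partial>lborel) < \<infinity>" .
qed

lemma measurable_cnj [measurable]: "cnj \<in> borel_measurable borel"
  by (intro borel_measurable_continuous_onI continuous_intros)

lemma torus_coeff_integrable:
  assumes "1 \<le> p" "f \<in> borel_measurable borel" "torus_pint p f < \<infinity>"
  shows "set_integrable lborel unit_square (\<lambda>z. f z * cnj (torus_char k z))"
  by (rule set_integrable_torus[OF assms]) simp_all

lemma torus_coeff_add:
  assumes "1 \<le> p" "f \<in> borel_measurable borel" "torus_pint p f < \<infinity>"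
    "g \<in> borel_measurable borel" "torus_pint p g < \<infinity>"
  shows "torus_coeff (\<lambda>z. f z + g z) k = torus_coeff f k + torus_coeff g k"
  unfolding torus_coeff_def distrib_right
  by (intro set_integral_add torus_coeff_integrable[OF assms(1-3)] torus_coeff_integrable[OF assms(1,4,5)])

text \<open>An elementary form of Hoelder's inequality: |f| <= d + d^(1-p) |f|^p at every point,
  integrated over a set of measure 1.\<close>

lemma torus_coeff_bound:
  assumes p: "1 \<le> p" and [measurable]: "f \<in> borel_measurable borel" and d: "0 < d"
    and f: "torus_pint p f \<le> ennreal (d powr p)"
  shows "norm (torus_coeff f k) \<le> 2 * d"
proof -
  have le: "norm (f z) \<le> d + d powr (1 - p) * norm (f z) powr p" for z
  proof (cases "norm (f z) \<le> d")
    case False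
    then have "d powr (1 - p) * norm (f z) powr p \<ge> norm (f z) powr (1 - p) * norm (f z) powr p"
      using p d by (intro mult_right_mono powr_mono2') auto
    also have "norm (f z) powr (1 - p) * norm (f z) powr p = norm (f z)"
      by (subst powr_add[symmetric]) simp
    finally show ?thesis using d by simp
  qed (simp add: add_increasing2)
  have int: "set_integrable lborel unit_square (\<lambda>z. f z * cnj (torus_char k z))"
    using le_less_trans[OF f] by (intro torus_coeff_integrable[OF p]) auto
  have "ennreal (norm (torus_coeff f k)) \<le> (\<integral>\<^sup>+z. ennreal (norm (indicator unit_square z *\<^sub>R (f z * cnj (torus_char k z)))) \<partial>lborel)"
    unfolding torus_coeff_def set_lebesgue_integral_def
    using int unfolding set_integrable_def by (rule integral_norm_bound_ennreal)
  also have "\<dots> \<le> (\<integral>\<^sup>+z. ennreal d * indicator unit_square z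
      + ennreal (d powr (1 - p)) * (ennreal (norm (f z) powr p) * indicator unit_square z) \<partial>lborel)"
  proof (intro nn_integral_mono)
    fix z
    show "ennreal (norm (indicator unit_square z *\<^sub>R (f z * cnj (torus_char k z))))
      \<le> ennreal d * indicator unit_square z + ennreal (d powr (1 - p)) * (ennreal (norm (f z) powr p) * indicator unit_square z)"
      using le[of z] d
      by (cases "z \<in> unit_square")
         (auto simp: norm_mult ennreal_mult[symmetric] ennreal_plus[symmetric] simp del: ennreal_plus intro!: ennreal_leI)
  qed
  also have "\<dots> = ennreal d + ennreal (d powr (1 - p)) * torus_pint p f"
    unfolding torus_pint_def
    by (subst nn_integral_add) (auto simp: nn_integral_cmult emeasure_unit_square)
  also have "\<dots> \<le> ennreal d + ennreal (d powr (1 - p)) * ennreal (d powr p)"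
    by (intro add_left_mono mult_left_mono f) simp
  also have "\<dots> = ennreal (2 * d)"
    using d by (simp add: ennreal_mult[symmetric] ennreal_plus[symmetric] powr_add[symmetric] del: ennreal_plus)
  finally show ?thesis using d by simp
qed

lemma torus_coeff_trig_poly:
  assumes "finite S"
  shows "torus_coeff (\<lambda>z. \<Sum>j\<in>S. c j * torus_char j z) k = (if k \<in> S then c k else 0)"
proof -
  have prod: "torus_char j z * cnj (torus_char k z) = torus_char (j - k) z" for j z
    by (simp add: torus_char_def cnj_echar diff_conv_add_uminus echar_add mult_ac del: add_uminus_conv_diff)
  have int: "set_integrable lborel unit_square (torus_char l)" for l
    unfolding set_integrable_def by (intro borel_integrable_compact compact_Times continuous_intros) auto
  have "torus_coeff (\<lambda>z. \<Sum>j\<in>S. c j * torus_char j z) k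
      = (LINT z:unit_square|lborel. \<Sum>j\<in>S. c j * torus_char (j - k) z)"
    unfolding torus_coeff_def by (simp add: sum_distrib_right mult.assoc prod)
  also have "\<dots> = (\<Sum>j\<in>S. LINT z:unit_square|lborel. c j * torus_char (j - k) z)"
    unfolding set_lebesgue_integral_def scaleR_sum_right
    using set_integrable_mult_right[OF int] unfolding set_integrable_def
    by (intro Bochner_Integration.integral_sum) auto
  also have "\<dots> = (\<Sum>j\<in>S. if j = k then c k else 0)"
    by (intro sum.cong refl) (auto simp: torus_char_integral prod_eq_iff)
  also have "\<dots> = (if k \<in> S then c k else 0)" using assms by simp
  finally show ?thesis .
qed

lemma hexagonal_sum_trig_poly:
  assumes "finite S"
  shows "hexagonal_sum N (\<lambda>z. \<Sum>j\<in>S. c j * torus_char j z) = (torus_sum (S \<inter> hexagon N) c)"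
proof
  fix z
  show "hexagonal_sum N (\<lambda>z. \<Sum>j\<in>S. c j * torus_char j z) z = (torus_sum (S \<inter> hexagon N) c z)"
    unfolding hexagonal_sum_def torus_coeff_trig_poly[OF assms]
    by (rule sum.mono_neutral_cong_right) (auto simp: finite_hexagon)
qed

lemma hexagonal_sum_add:
  assumes "1 \<le> p" "f \<in> borel_measurable borel" "torus_pint p f < \<infinity>"
    "g \<in> borel_measurable borel" "torus_pint p g < \<infinity>"
  shows "hexagonal_sum N (\<lambda>z. f z + g z) = (\<lambda>z. hexagonal_sum N f z + hexagonal_sum N g z)"
  unfolding hexagonal_sum_def torus_coeff_add[OF assms] by (simp add: distrib_right sum.distrib)

lemma measurable_hexagonal_sum [measurable]: "hexagonal_sum N f \<in> borel_measurable borel"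
  unfolding hexagonal_sum_def by measurable

lemma torus_pint_trig_polys:
  assumes "q \<in> trig_polys" "0 < p"
  shows "torus_pint p q < \<infinity>"
proof -
  have "\<exists>B\<ge>0. \<forall>z. norm (q z) \<le> B"
    using assms(1)
  proof induction
    case (char c k)
    then show ?case by (intro exI[of _ "norm c"]) (simp add: norm_mult)
  next
    case (add f g)
    then obtain A B where "A \<ge> 0" "B \<ge> 0" "\<And>z. norm (f z) \<le> A" "\<And>z. norm (g z) \<le> B" by blast
    then show ?case by (intro exI[of _ "A + B"]) (auto intro!: norm_triangle_le add_mono)
  qed
  then obtain B where "B \<ge> 0" "\<And>z. norm (q z) \<le> B" by blast
  then have "torus_pint p q \<le> ennreal (B powr p)" using assms(2) by (intro torus_pint_bound) auto
  then show ?thesis by (simp add: le_less_trans)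
qed

text \<open>For fixed \<open>N\<close> the coefficients depend continuously on \<open>f\<close>, so
  the bound passes from trigonometric polynomials to their limits, still uniformly in
  \<open>N\<close>. Approximability is a separate hypothesis because the lemma is applied to
  differences f - q with complex q, while density is established for real functions.\<close>

lemma hexagonal_sum_bounded:
  assumes p: "1 < p"
  obtains C where "C \<ge> 0"
    "\<And>N f t. \<lbrakk>f \<in> borel_measurable borel; t \<ge> 0; torus_pint p f \<le> ennreal t;
        \<And>e. e > 0 \<Longrightarrow> \<exists>q\<in>trig_polys. torus_pint p (\<lambda>z. f z - q z) \<le> e\<rbrakk>
      \<Longrightarrow> torus_pint p (hexagonal_sum N f) \<le> ennreal (C * t)"
proof -
  obtain C where C: "C \<ge> 0" and H: "\<And>S c N. finite S \<Longrightarrow>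
       torus_pint p (torus_sum (S \<inter> hexagon N) c)
        \<le> ennreal C * torus_pint p (torus_sum S c)"
    by (rule torus_hexagon[OF p]) blast
  define T where "T = 2 powr p"
  have T: "T \<ge> 0" by (simp add: T_def)
  have p0: "p > 0" "1 \<le> p" using p by auto
  have "torus_pint p (hexagonal_sum N f) \<le> ennreal (T * C * T * t)"
    if [measurable]: "f \<in> borel_measurable borel" and t: "t \<ge> 0" "torus_pint p f \<le> ennreal t"
      and dense: "\<And>e. e > 0 \<Longrightarrow> \<exists>q\<in>trig_polys. torus_pint p (\<lambda>z. f z - q z) \<le> e" for N f t
  proof -
    \<comment> \<open>A bound that grows with the number of frequencies is harmless here:
      \<open>N\<close> stays fixed while \<open>d\<close> tends to 0.\<close>
    define M where "M = real (card (hexagon N)) * 2"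
    define A where "A = T * (M powr p + C * T)"
    have A: "A \<ge> 0" using T C by (simp add: A_def)
    have est: "torus_pint p (hexagonal_sum N f) \<le> ennreal (T * C * T * t + A * d powr p)" if d: "d > 0" for d
    proof -
      obtain q where q: "q \<in> trig_polys" "torus_pint p (\<lambda>z. f z - q z) \<le> ennreal (d powr p)"
        using dense[of "ennreal (d powr p)"] d by auto
      obtain S c where S: "finite S" "q = (torus_sum S c)"
        using trig_polys_sum_rep[OF q(1)] by metis
      have [measurable]: "q \<in> borel_measurable borel" using q(1) by (rule measurable_trig_polys)
      have fq: "torus_pint p (\<lambda>z. f z - q z) < \<infinity>" using q(2) by (simp add: le_less_trans)
      have "torus_pint p q = torus_pint p (\<lambda>z. (q z - f z) + f z)" by simp
      also have "\<dots> \<le> ennreal T * (torus_pint p (\<lambda>z. q z - f z) + torus_pint p f)"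
        unfolding T_def using p0 by (intro torus_pint_add) auto
      also have "\<dots> \<le> ennreal T * (ennreal (d powr p) + ennreal t)"
        using q(2) t(2) by (intro mult_left_mono add_mono) (auto simp: torus_pint_minus_commute[of p q f])
      finally have Tq: "torus_pint p q \<le> ennreal (T * (d powr p + t))"
        using T t by (simp add: ennreal_mult[symmetric] ennreal_plus[symmetric] del: ennreal_plus)
      have "torus_pint p (hexagonal_sum N q) \<le> ennreal C * torus_pint p q"
        unfolding S(2) hexagonal_sum_trig_poly[OF S(1)] by (rule H) fact
      also have "\<dots> \<le> ennreal C * ennreal (T * (d powr p + t))" by (intro mult_left_mono Tq) simp
      finally have Hq: "torus_pint p (hexagonal_sum N q) \<le> ennreal (C * (T * (d powr p + t)))"
        using C T t by (simp add: ennreal_mult[symmetric])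
      have Hfq: "torus_pint p (hexagonal_sum N (\<lambda>z. f z - q z)) \<le> ennreal (M powr p * d powr p)"
      proof -
        have "norm (hexagonal_sum N (\<lambda>z. f z - q z) z) \<le> M * d" for z
        proof -
          have "norm (hexagonal_sum N (\<lambda>z. f z - q z) z) \<le> real (card (hexagon N)) * (2 * d)"
            unfolding hexagonal_sum_def
            by (rule sum_norm_bound)
               (simp add: norm_mult torus_coeff_bound[OF p0(2) _ d q(2)])
          then show ?thesis by (simp add: M_def mult.assoc)
        qed
        then have "torus_pint p (hexagonal_sum N (\<lambda>z. f z - q z)) \<le> ennreal ((M * d) powr p)"
          using p0 d by (intro torus_pint_bound) (auto simp: M_def)
        then show ?thesis using d by (simp add: powr_mult M_def)
      qed
      have "hexagonal_sum N f = hexagonal_sum N (\<lambda>z. (f z - q z) + q z)" by simp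
      also have "\<dots> = (\<lambda>z. hexagonal_sum N (\<lambda>z. f z - q z) z + hexagonal_sum N q z)"
        using fq torus_pint_trig_polys[OF q(1) p0(1)] by (intro hexagonal_sum_add[OF p0(2)]) auto
      finally have "torus_pint p (hexagonal_sum N f)
          \<le> ennreal T * (torus_pint p (hexagonal_sum N (\<lambda>z. f z - q z)) + torus_pint p (hexagonal_sum N q))"
        unfolding T_def using p0 by (simp only:) (intro torus_pint_add; measurable)
      also have "\<dots> \<le> ennreal T * (ennreal (M powr p * d powr p) + ennreal (C * (T * (d powr p + t))))"
        by (intro mult_left_mono add_mono Hfq Hq) simp
      also have "\<dots> = ennreal (T * (M powr p * d powr p + C * (T * (d powr p + t))))"
        using C T t by (simp add: ennreal_mult[symmetric] ennreal_plus[symmetric] del: ennreal_plus)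
      also have "T * (M powr p * d powr p + C * (T * (d powr p + t))) = T * C * T * t + A * d powr p"
        by (simp add: A_def algebra_simps)
      finally show ?thesis .
    qed
    show ?thesis
    proof (rule ennreal_le_epsilon)
      fix e :: real assume e: "e > 0"
      define d where "d = (e / (A + 1)) powr (1 / p)"
      have d: "d > 0" using e A by (simp add: d_def)
      have "A * d powr p = A * (e / (A + 1))" using e A p0 by (simp add: d_def powr_powr)
      also have "\<dots> \<le> e" using e A by (simp add: field_simps)
      finally have "ennreal (T * C * T * t + A * d powr p) \<le> ennreal (T * C * T * t + e)"
        by (intro ennreal_leI) simp
      also have "\<dots> = ennreal (T * C * T * t) + ennreal e"
        using C T t e by (intro ennreal_plus) auto
      finally show "torus_pint p (hexagonal_sum N f) \<le> ennreal (T * C * T * t) + ennreal e"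
        using est[OF d] by (rule order_trans[rotated])
    qed
  qed
  then show ?thesis using C T by (intro that[of "T * C * T"]) auto
qed

text \<open>Uniform boundedness and density: a trigonometric polynomial is reproduced exactly once
  the hexagon contains its frequencies, and the sums of the remainder are bounded by the
  approximation error.\<close>

theorem hexagonal_sum_tendsto:
  fixes h :: "real \<times> real \<Rightarrow> real"
  assumes p: "1 < p" and h: "h \<in> borel_measurable borel" and fin: "torus_pint p (\<lambda>z. of_real (h z)) < \<infinity>"
  shows "(\<lambda>N. torus_pint p (\<lambda>z. hexagonal_sum N (\<lambda>z. of_real (h z)) z - of_real (h z))) \<longlonglongrightarrow> 0"
proof -
  define f where "f z = complex_of_real (h z)" for z
  have [measurable]: "f \<in> borel_measurable borel" using h unfolding f_def by measurable
  have p0: "p > 0" "1 \<le> p" using p by auto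
  have dense: "\<exists>q\<in>trig_polys. torus_pint p (\<lambda>z. f z - q z) \<le> e" if "e > 0" for e
    unfolding f_def by (rule trig_polys_dense[OF p0(1) h fin that]) blast
  obtain C where C: "C \<ge> 0" and bdd: "\<And>N f t. \<lbrakk>f \<in> borel_measurable borel; t \<ge> 0; torus_pint p f \<le> ennreal t;
        \<And>e. e > 0 \<Longrightarrow> \<exists>q\<in>trig_polys. torus_pint p (\<lambda>z. f z - q z) \<le> e\<rbrakk>
      \<Longrightarrow> torus_pint p (hexagonal_sum N f) \<le> ennreal (C * t)"
    by (rule hexagonal_sum_bounded[OF p]) blast
  define T where "T = 2 powr p"
  have T: "T > 0" by (simp add: T_def)
  have ev: "eventually (\<lambda>N. torus_pint p (\<lambda>z. hexagonal_sum N f z - f z) \<le> ennreal (T * (C + 1) * t)) sequentially"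
    if t: "t > 0" for t
  proof -
    obtain q where q: "q \<in> trig_polys" "torus_pint p (\<lambda>z. f z - q z) \<le> ennreal t"
      using dense[of "ennreal t"] t by auto
    obtain S c where S: "finite S" "q = (torus_sum S c)"
      using trig_polys_sum_rep[OF q(1)] by metis
    have [measurable]: "q \<in> borel_measurable borel" using q(1) by (rule measurable_trig_polys)
    have fq: "torus_pint p (\<lambda>z. f z - q z) < \<infinity>" using q(2) by (simp add: le_less_trans)
    have dense': "\<exists>r\<in>trig_polys. torus_pint p (\<lambda>z. f z - q z - r z) \<le> e" if e: "e > 0" for e
    proof -
      obtain r where r: "r \<in> trig_polys" "torus_pint p (\<lambda>z. f z - r z) \<le> e" using dense[OF e] by blast
      have "(\<lambda>z. r z + (-1) * q z) \<in> trig_polys" using r(1) q(1) by (intro trig_polys.add trig_polys_cmult)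
      moreover have "torus_pint p (\<lambda>z. f z - q z - (r z + (-1) * q z)) \<le> e" using r(2) by simp
      ultimately show ?thesis by (intro bexI[of _ "\<lambda>z. r z + (-1) * q z"])
    qed
    obtain N0 where N0: "S \<subseteq> hexagon N0"
    proof -
      obtain D where D: "(\<lambda>k. \<bar>fst k\<bar> + \<bar>snd k\<bar>) ` S \<subseteq> {- int D..int D}"
        using finite_int_set_bound[of "(\<lambda>k. \<bar>fst k\<bar> + \<bar>snd k\<bar>) ` S" 0] S(1) by blast
      have "S \<subseteq> hexagon D" using D by (force simp: hexagon_def)
      then show ?thesis by (rule that)
    qed
    have "torus_pint p (\<lambda>z. hexagonal_sum N f z - f z) \<le> ennreal (T * (C + 1) * t)" if N: "N \<ge> N0" for N
    proof -
      have "hexagon N0 \<subseteq> hexagon N" using N by (auto simp: hexagon_def)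
      then have SN: "S \<inter> hexagon N = S" using N0 by blast
      have Hq: "hexagonal_sum N q = q"
        unfolding S(2) hexagonal_sum_trig_poly[OF S(1)] SN ..
      have "hexagonal_sum N f = hexagonal_sum N (\<lambda>z. (f z - q z) + q z)" by simp
      also have "\<dots> = (\<lambda>z. hexagonal_sum N (\<lambda>z. f z - q z) z + hexagonal_sum N q z)"
        using fq torus_pint_trig_polys[OF q(1) p0(1)] by (intro hexagonal_sum_add[OF p0(2)]) auto
      finally have "torus_pint p (\<lambda>z. hexagonal_sum N f z - f z)
          = torus_pint p (\<lambda>z. hexagonal_sum N (\<lambda>z. f z - q z) z + (q z - f z))"
        by (simp add: Hq algebra_simps)
      also have "\<dots> \<le> ennreal T * (torus_pint p (hexagonal_sum N (\<lambda>z. f z - q z)) + torus_pint p (\<lambda>z. q z - f z))"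
        unfolding T_def using p0 by (intro torus_pint_add) auto
      also have "\<dots> \<le> ennreal T * (ennreal (C * t) + ennreal t)"
        using q(2) t dense' by (intro mult_left_mono add_mono bdd) (auto simp: torus_pint_minus_commute[of p q f])
      also have "\<dots> = ennreal (T * (C + 1) * t)"
        using T C t by (simp add: ennreal_mult[symmetric] ennreal_plus[symmetric] algebra_simps del: ennreal_plus)
      finally show ?thesis .
    qed
    then show ?thesis unfolding eventually_sequentially by blast
  qed
  have "(\<lambda>N. torus_pint p (\<lambda>z. hexagonal_sum N f z - f z)) \<longlonglongrightarrow> 0"
  proof (rule order_tendstoI)
    fix a :: ennreal assume a: "0 < a"
    obtain b where b: "b > 0" "ennreal b < a"
    proof -
      obtain c where "0 < c" "c < a" using Orderings.dense[OF a] by blast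
      then show ?thesis using that[of "enn2real c"] by (cases c) (auto simp: top.extremum_strict)
    qed
    have tt: "b / (T * (C + 1)) > 0" using b T C by simp
    show "eventually (\<lambda>N. torus_pint p (\<lambda>z. hexagonal_sum N f z - f z) < a) sequentially"
      using ev[OF tt]
    proof eventually_elim
      case (elim N)
      have "T * (C + 1) * (b / (T * (C + 1))) = b" using T C by simp
      then show ?case using elim b(2) by (simp add: le_less_trans)
    qed
  qed simp
  then show ?thesis unfolding f_def .
qed

section \<open>The reflection group of the hemiequilateral triangle\<close>

lemma nn_integral_lborel_pair:
  fixes \<psi> :: "real \<times> real \<Rightarrow> ennreal"
  assumes [measurable]: "\<psi> \<in> borel_measurable borel"
  shows "(\<integral>\<^sup>+z. \<psi> z \<partial>lborel) = (\<integral>\<^sup>+x. \<integral>\<^sup>+y. \<psi> (x, y) \<partial>lborel \<partial>lborel)"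
    and "(\<integral>\<^sup>+z. \<psi> z \<partial>lborel) = (\<integral>\<^sup>+y. \<integral>\<^sup>+x. \<psi> (x, y) \<partial>lborel \<partial>lborel)"
  using set_nn_integral_product[of \<psi> UNIV UNIV] by simp_all

text \<open>An invertible matrix with nonzero upper left entry is a product of two triangular ones,
  so two one-dimensional substitutions and an exchange of the integrals suffice. If that entry
  vanishes, the roles of the two variables are interchanged.\<close>

lemma affine_nn_integral:
  fixes \<psi> :: "real \<times> real \<Rightarrow> ennreal" and a b c d s t :: real
  assumes \<psi> [measurable]: "\<psi> \<in> borel_measurable borel" and D: "a * d - b * c \<noteq> 0"
  shows "(\<integral>\<^sup>+z. \<psi> z \<partial>lborel)
    = ennreal \<bar>a * d - b * c\<bar> * (\<integral>\<^sup>+z. \<psi> (s + a * fst z + b * snd z, t + c * fst z + d * snd z) \<partial>lborel)"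
proof -
  have [measurable]: "\<psi> \<in> borel_measurable (borel \<Otimes>\<^sub>M borel)" by (simp add: borel_prod)
  have meas [measurable]: "(\<lambda>z. \<psi> (s + a * fst z + b * snd z, t + c * fst z + d * snd z)) \<in> borel_measurable borel"
    for a b c d s t
    unfolding borel_prod[symmetric] by measurable
  have core: "(\<integral>\<^sup>+z. \<psi> z \<partial>lborel)
    = ennreal \<bar>a * d - b * c\<bar> * (\<integral>\<^sup>+y. \<integral>\<^sup>+x. \<psi> (s + a * x + b * y, t + c * x + d * y) \<partial>lborel \<partial>lborel)"
    if D: "a * d - b * c \<noteq> 0" and a: "a \<noteq> 0" for a b c d
  proof -
    define D where "D = a * d - b * c"
    have D0: "D / a \<noteq> 0" using that by (simp add: D_def)
    have "(\<integral>\<^sup>+z. \<psi> z \<partial>lborel) = (\<integral>\<^sup>+x. \<integral>\<^sup>+y. \<psi> (x, y) \<partial>lborel \<partial>lborel)"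
      by (rule nn_integral_lborel_pair) fact
    also have "\<dots> = (\<integral>\<^sup>+x. ennreal \<bar>D / a\<bar> * (\<integral>\<^sup>+y. \<psi> (x, (t + c / a * (x - s)) + D / a * y) \<partial>lborel) \<partial>lborel)"
      by (intro nn_integral_cong nn_integral_real_affine D0) measurable
    also have "\<dots> = ennreal \<bar>D / a\<bar> * (\<integral>\<^sup>+x. (\<integral>\<^sup>+y. \<psi> (x, (t + c / a * (x - s)) + D / a * y) \<partial>lborel) \<partial>lborel)"
      by (rule nn_integral_cmult) measurable
    also have "(\<integral>\<^sup>+x. (\<integral>\<^sup>+y. \<psi> (x, (t + c / a * (x - s)) + D / a * y) \<partial>lborel) \<partial>lborel)
        = (\<integral>\<^sup>+y. (\<integral>\<^sup>+x. \<psi> (x, (t + c / a * (x - s)) + D / a * y) \<partial>lborel) \<partial>lborel)"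
      by (rule lborel_pair.Fubini'[symmetric]) measurable
    also have "\<dots> = (\<integral>\<^sup>+y. ennreal \<bar>a\<bar> * (\<integral>\<^sup>+x. \<psi> ((s + b * y) + a * x, (t + c / a * (((s + b * y) + a * x) - s)) + D / a * y) \<partial>lborel) \<partial>lborel)"
      by (intro nn_integral_cong nn_integral_real_affine a) measurable
    also have "\<dots> = ennreal \<bar>a\<bar> * (\<integral>\<^sup>+y. (\<integral>\<^sup>+x. \<psi> ((s + b * y) + a * x, (t + c / a * (((s + b * y) + a * x) - s)) + D / a * y) \<partial>lborel) \<partial>lborel)"
      by (rule nn_integral_cmult) measurable
    also have "(\<lambda>y x. \<psi> ((s + b * y) + a * x, (t + c / a * (((s + b * y) + a * x) - s)) + D / a * y))
        = (\<lambda>y x. \<psi> (s + a * x + b * y, t + c * x + d * y))"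
      using a by (intro ext arg_cong[where f = \<psi>]) (simp add: D_def field_simps)
    finally show ?thesis
      using a by (simp add: D_def[symmetric] mult.assoc[symmetric] ennreal_mult[symmetric] abs_mult)
  qed
  show ?thesis
  proof (cases "a = 0")
    case False
    show ?thesis
      unfolding core[OF D False]
      by (subst nn_integral_lborel_pair(2)[OF meas]) simp
  next
    case True
    then have b: "b \<noteq> 0" "b * c - a * d \<noteq> 0" using D by auto
    have "(\<integral>\<^sup>+z. \<psi> z \<partial>lborel)
        = ennreal \<bar>b * c - a * d\<bar> * (\<integral>\<^sup>+y. \<integral>\<^sup>+x. \<psi> (s + b * x + a * y, t + d * x + c * y) \<partial>lborel \<partial>lborel)"
      by (rule core[OF b(2,1)])
    also have "(\<integral>\<^sup>+y. \<integral>\<^sup>+x. \<psi> (s + b * x + a * y, t + d * x + c * y) \<partial>lborel \<partial>lborel)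
        = (\<integral>\<^sup>+z. \<psi> (s + a * fst z + b * snd z, t + c * fst z + d * snd z) \<partial>lborel)"
      by (subst nn_integral_lborel_pair(1)[OF meas]) (simp add: add_ac)
    finally show ?thesis by (simp add: abs_minus_commute)
  qed
qed

text \<open>A tuple \<open>(\<sigma>, a, b, s, c, d, t)\<close> stands for the affine map
  \<open>(x, y) \<mapsto> (s + a x + b y, t + c x + d y)\<close> with sign \<open>\<sigma>\<close>, its determinant as an isometry of the
  hexagonal lattice. These are the twelve elements of the point group, each composed with the lattice
  translation that moves the image of the chamber below into the unit square.\<close>

type_synonym affine_data = "int \<times> int \<times> int \<times> int \<times> int \<times> int \<times> int"

definition chamber_maps :: "affine_data list" where
  "chamber_maps =
    [(1, 1, 0, 0, 0, 1, 0), (-1, 0, 1, 0, 1, 0, 0), (-1, -1, 0, 1, -1, 1, 1), (-1, 1, -1, 0, 0, -1, 1),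
     (1, -1, 1, 1, -1, 0, 1), (1, 0, -1, 1, 1, -1, 0), (1, -1, 0, 1, 0, -1, 1), (-1, 0, -1, 1, -1, 0, 1),
     (-1, 1, 0, 0, 1, -1, 0), (-1, -1, 1, 1, 0, 1, 0), (1, 1, -1, 0, 1, 0, 0), (1, 0, 1, 0, -1, 1, 1)]"

fun map_sign :: "affine_data \<Rightarrow> int" where
  "map_sign (\<sigma>, a, b, s, c, d, t) = \<sigma>"

fun map_point :: "affine_data \<Rightarrow> real \<times> real \<Rightarrow> real \<times> real" where
  "map_point (\<sigma>, a, b, s, c, d, t) z
    = (of_int s + of_int a * fst z + of_int b * snd z, of_int t + of_int c * fst z + of_int d * snd z)"

text \<open>The transpose of the linear part. The translation part is integral and therefore
  invisible to characters.\<close>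

fun map_freq :: "affine_data \<Rightarrow> int \<times> int \<Rightarrow> int \<times> int" where
  "map_freq (\<sigma>, a, b, s, c, d, t) k = (a * fst k + c * snd k, b * fst k + d * snd k)"

text \<open>Cramer's rule: for the maps in the list the determinant is 1 or -1 and thus equals its
  reciprocal.\<close>

fun map_freq_inv :: "affine_data \<Rightarrow> int \<times> int \<Rightarrow> int \<times> int" where
  "map_freq_inv (\<sigma>, a, b, s, c, d, t) k
    = ((a * d - b * c) * (d * fst k - c * snd k), (a * d - b * c) * (a * snd k - b * fst k))"

section \<open>Chamber, sector and alternating characters\<close>

text \<open>The triangle with vertices (0, 0), (1/2, 1/2), (2/3, 1/3), which \<open>hemi_map\<close>
  sends to (0, 1), (0, 0), (1 / sqrt 3, 0).\<close>

definition chamber :: "(real \<times> real) set" where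
  "chamber = {(x, y). y \<le> x \<and> x \<le> 2 * y \<and> x + y \<le> 1}"

definition open_chamber :: "(real \<times> real) set" where
  "open_chamber = {(x, y). y < x \<and> x < 2 * y \<and> x + y < 1}"

text \<open>The condition 0 < m < n <= N in the coordinates m = a - b, n = a + b.\<close>

definition sector :: "nat \<Rightarrow> (int \<times> int) set" where
  "sector N = {(a, b). 0 < b \<and> b < a \<and> a + b \<le> int N}"

definition alternating_char :: "int \<times> int \<Rightarrow> real \<times> real \<Rightarrow> complex" where
  "alternating_char k z = (\<Sum>g\<leftarrow>chamber_maps. of_int (map_sign g) * torus_char (map_freq g k) z)"

lemma torus_char_map_point: "torus_char k (map_point g z) = torus_char (map_freq g k) z"
proof (cases g)
  case (fields \<sigma> a b s c d t)
  have "torus_char k (map_point g z)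
      = cis (2 * pi * of_int (fst k * s + snd k * t)) * torus_char (map_freq g k) z"
    by (simp add: fields torus_char_def echar_def cis_mult algebra_simps)
  then show ?thesis by (simp only: cis_of_int_eq mult_1_left)
qed

lemma map_point_nn_integral:
  assumes "g \<in> set chamber_maps" "\<psi> \<in> borel_measurable borel"
  shows "(\<integral>\<^sup>+z. \<psi> (map_point g z) \<partial>lborel) = (\<integral>\<^sup>+z. \<psi> z \<partial>lborel)"
proof (cases g)
  case (fields \<sigma> a b s c d t)
  have det: "\<bar>a * d - b * c\<bar> = 1"
    using assms(1) unfolding fields by (auto simp: chamber_maps_def)
  then have "\<bar>of_int a * of_int d - of_int b * of_int c :: real\<bar> = 1"
    by (metis of_int_1 of_int_abs of_int_diff of_int_mult)
  then show ?thesis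
    using affine_nn_integral[OF assms(2), of "of_int a" "of_int d" "of_int b" "of_int c" "of_int s" "of_int t"]
    by (simp add: fields)
qed

text \<open>For each map both claims are linear inequalities. Strictness matters for the second one:
  a reflection fixes the points of its own wall.\<close>

lemma map_point_open_chamber:
  assumes "g \<in> set chamber_maps" "z \<in> open_chamber"
  shows "map_point g z \<in> unit_square"
    and "g \<noteq> (1, 1, 0, 0, 0, 1, 0) \<Longrightarrow> map_point g z \<notin> chamber"
proof -
  obtain x y where z: "z = (x, y)" by force
  have xy: "y < x" "x < 2 * y" "x + y < 1" using assms(2) by (auto simp: z open_chamber_def)
  show "map_point g z \<in> unit_square"
    using assms(1) xy by (auto simp: chamber_maps_def z)
  show "map_point g z \<notin> chamber" if "g \<noteq> (1, 1, 0, 0, 0, 1, 0)"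
    using assms(1) xy that by (auto simp: chamber_maps_def z chamber_def)
qed

text \<open>Composition with \<open>g\<close> permutes the twelve frequencies of the orbit and
  multiplies all signs by that of \<open>g\<close>.\<close>

lemma alternating_char_map:
  assumes "g \<in> set chamber_maps"
  shows "alternating_char (map_freq g k) z = of_int (map_sign g) * alternating_char k z"
proof (cases k)
  case (Pair a b)
  have c: "- b - a = - a - b" by simp
  show ?thesis using assms
    unfolding Pair chamber_maps_def
    by (auto simp: alternating_char_def chamber_maps_def algebra_simps c)
qed

text \<open>A frequency on a wall is fixed by a reflection, which makes the value its own negative.
  Each case names the reflection in question.\<close>

lemma alternating_char_wall:
  assumes "a = 0 \<or> b = 0 \<or> a + b = 0 \<or> a = b \<or> a + 2 * b = 0 \<or> 2 * a + b = 0"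
  shows "alternating_char (a, b) z = 0"
proof -
  have fix0: "alternating_char (a, b) z = 0"
    if "g \<in> set chamber_maps" "map_sign g = -1" "map_freq g (a, b) = (a, b)" for g
    using alternating_char_map[OF that(1), of "(a, b)" z] that(2,3) by simp
  from assms show ?thesis
  proof (elim disjE)
    assume "a = 0" then show ?thesis
      by (intro fix0[of "(-1, -1, 1, 1, 0, 1, 0)"]) (simp_all add: chamber_maps_def)
  next
    assume "b = 0" then show ?thesis
      by (intro fix0[of "(-1, 1, 0, 0, 1, -1, 0)"]) (simp_all add: chamber_maps_def)
  next
    assume "a + b = 0" then show ?thesis
      by (intro fix0[of "(-1, 0, -1, 1, -1, 0, 1)"]) (simp_all add: chamber_maps_def)
  next
    assume "a = b" then show ?thesis
      by (intro fix0[of "(-1, 0, 1, 0, 1, 0, 0)"]) (simp_all add: chamber_maps_def)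
  next
    assume "a + 2 * b = 0" then show ?thesis
      by (intro fix0[of "(-1, 1, -1, 0, 0, -1, 1)"]) (simp_all add: chamber_maps_def)
  next
    assume "2 * a + b = 0" then show ?thesis
      by (intro fix0[of "(-1, -1, 0, 1, -1, 1, 1)"]) (simp_all add: chamber_maps_def)
  qed
qed

text \<open>Minus the identity belongs to the point group with sign 1, so the frequencies come in
  pairs k, -k of equal sign.\<close>

lemma cnj_alternating_char: "cnj (alternating_char k z) = alternating_char k z"
proof -
  have "cnj (torus_char j z) = torus_char (- j) z" for j
    by (simp add: torus_char_def cnj_echar)
  then show ?thesis
    by (cases k) (simp add: alternating_char_def chamber_maps_def algebra_simps)
qed

text \<open>On triples (a, b, -a-b) the point group acts by permutations and a common change of
  sign. Off the walls the entries are nonzero and distinct. Exactly one choice of sign makes two of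
  them positive, and exactly one order puts the larger of these first and the smaller second. The
  third entry has the largest modulus, so the hexagon condition becomes the bound a + b <= N of the
  sector.\<close>

lemma sum_sector_count:
  assumes "(a, b) \<in> hexagon N" "\<not> (a = 0 \<or> b = 0 \<or> a + b = 0 \<or> a = b \<or> a + 2 * b = 0 \<or> 2 * a + b = 0)"
  shows "(\<Sum>g\<leftarrow>chamber_maps. if map_freq_inv g (a, b) \<in> sector N then 1 else 0 :: complex) = 1"
proof -
  define M where "M = int N"
  have h: "a \<le> M" "- M \<le> a" "b \<le> M" "- M \<le> b" "a + b \<le> M" "- M \<le> a + b"
    using assms(1) by (auto simp: hexagon_def M_def)
  have n: "a \<noteq> 0" "b \<noteq> 0" "a + b \<noteq> 0" "a \<noteq> b" "a + 2 * b \<noteq> 0" "2 * a + b \<noteq> 0" using assms(2) by auto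
  have inv: "map (\<lambda>g. map_freq_inv g (a, b)) chamber_maps
      = [(a, b), (b, a), (- a - b, b), (a, - a - b), (b, - a - b), (- a - b, a),
         (- a, - b), (- b, - a), (a + b, - b), (- a, a + b), (- b, a + b), (a + b, - a)]"
    by (simp add: chamber_maps_def)
  \<comment> \<open>Counted in the integers, where only linear inequalities are involved, and
    transferred to \<open>complex\<close> afterwards.\<close>
  have "(\<Sum>g\<leftarrow>chamber_maps. if map_freq_inv g (a, b) \<in> sector N then 1 else 0 :: int)
      = (\<Sum>k\<leftarrow>map (\<lambda>g. map_freq_inv g (a, b)) chamber_maps. if k \<in> sector N then 1 else 0)"
    by (simp only: map_map comp_def)
  also have "\<dots> = 1"
    using h n unfolding inv list.map sum_list.Cons sum_list.Nil sector_def mem_Collect_eq case_prod_conv M_def[symmetric]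
    by (smt (verit))
  finally have "(\<Sum>g\<leftarrow>chamber_maps. if map_freq_inv g (a, b) \<in> sector N then 1 else 0 :: int) = 1" .
  moreover have "(\<Sum>g\<leftarrow>xs. if P g then 1 else 0 :: complex) = of_int (\<Sum>g\<leftarrow>xs. if P g then 1 else 0)"
    for xs :: "affine_data list" and P
    by (induction xs) auto
  ultimately show ?thesis by simp
qed

lemma sum_sum_list_swap:
  fixes f :: "'a \<Rightarrow> 'b \<Rightarrow> 'c::comm_monoid_add"
  shows "(\<Sum>k\<in>A. \<Sum>g\<leftarrow>xs. f g k) = (\<Sum>g\<leftarrow>xs. \<Sum>k\<in>A. f g k)"
  by (induction xs) (auto simp: sum.distrib)

lemma map_freq_inverse:
  assumes "g \<in> set chamber_maps"
  shows "map_freq g (map_freq_inv g k) = k" "map_freq_inv g (map_freq g k) = k"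
  using assms by (cases k; auto simp: chamber_maps_def)+

lemma map_freq_sector:
  assumes "g \<in> set chamber_maps" "k \<in> sector N"
  shows "map_freq g k \<in> hexagon N"
  using assms by (auto simp: chamber_maps_def sector_def hexagon_def)

text \<open>Wall frequencies contribute nothing, and every other one is \<open>map_freq g k\<close>
  for exactly one \<open>g\<close> and one \<open>k\<close> in the sector. Antisymmetry then
  replaces its alternating character by a signed copy of that of \<open>k\<close>.\<close>

lemma hexagon_alternating_sum:
  "(\<Sum>k\<in>hexagon N. c k * alternating_char k z)
    = (\<Sum>k\<in>sector N. (\<Sum>g\<leftarrow>chamber_maps. of_int (map_sign g) * c (map_freq g k)) * alternating_char k z)"
proof -
  define F where "F k = c k * alternating_char k z" for k
  have "(\<Sum>k\<in>hexagon N. F k) = (\<Sum>k\<in>hexagon N. \<Sum>g\<leftarrow>chamber_maps. if map_freq_inv g k \<in> sector N then F k else 0)"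
  proof (rule sum.cong[OF refl])
    fix k assume k: "k \<in> hexagon N"
    obtain a b where ab: "k = (a, b)" by force
    show "F k = (\<Sum>g\<leftarrow>chamber_maps. if map_freq_inv g k \<in> sector N then F k else 0)"
    proof (cases "a = 0 \<or> b = 0 \<or> a + b = 0 \<or> a = b \<or> a + 2 * b = 0 \<or> 2 * a + b = 0")
      case True
      then have "F k = 0" unfolding F_def ab by (simp only: alternating_char_wall mult_zero_right)
      then show ?thesis by (simp only: if_cancel) (simp add: chamber_maps_def)
    next
      case False
      have "(\<Sum>g\<leftarrow>chamber_maps. if map_freq_inv g k \<in> sector N then F k else 0)
          = F k * (\<Sum>g\<leftarrow>chamber_maps. if map_freq_inv g k \<in> sector N then 1 else 0)"
        unfolding sum_list_const_mult[symmetric] by (intro arg_cong[of _ _ sum_list] map_cong) auto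
      also have "\<dots> = F k"
        unfolding ab sum_sector_count[OF k[unfolded ab] False] by simp
      finally show ?thesis ..
    qed
  qed
  also have "\<dots> = (\<Sum>g\<leftarrow>chamber_maps. \<Sum>k\<in>hexagon N. if map_freq_inv g k \<in> sector N then F k else 0)"
    by (rule sum_sum_list_swap)
  also have "\<dots> = (\<Sum>g\<leftarrow>chamber_maps. \<Sum>k\<in>sector N. of_int (map_sign g) * c (map_freq g k) * alternating_char k z)"
  proof (intro arg_cong[of _ _ sum_list] map_cong refl)
    fix g assume g: "g \<in> set chamber_maps"
    have "(\<Sum>k\<in>hexagon N. if map_freq_inv g k \<in> sector N then F k else 0)
        = (\<Sum>k\<in>{k \<in> hexagon N. map_freq_inv g k \<in> sector N}. F k)"
      by (rule sum.inter_filter[symmetric]) (rule finite_hexagon)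
    also have "\<dots> = (\<Sum>k\<in>sector N. F (map_freq g k))"
      by (rule sum.reindex_bij_witness[of _ "map_freq g" "map_freq_inv g"])
         (auto simp: map_freq_inverse[OF g] map_freq_sector[OF g])
    also have "\<dots> = (\<Sum>k\<in>sector N. of_int (map_sign g) * c (map_freq g k) * alternating_char k z)"
      unfolding F_def alternating_char_map[OF g] by (simp add: mult_ac)
    finally show "(\<Sum>k\<in>hexagon N. if map_freq_inv g k \<in> sector N then F k else 0)
        = (\<Sum>k\<in>sector N. of_int (map_sign g) * c (map_freq g k) * alternating_char k z)" .
  qed
  also have "\<dots> = (\<Sum>k\<in>sector N. \<Sum>g\<leftarrow>chamber_maps. of_int (map_sign g) * c (map_freq g k) * alternating_char k z)"
    by (rule sum_sum_list_swap[symmetric])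
  finally show ?thesis by (simp add: F_def sum_list_mult_const)
qed

abbreviation alternating_sum :: "nat \<Rightarrow> (real \<times> real \<Rightarrow> complex) \<Rightarrow> real \<times> real \<Rightarrow> complex" where
  "alternating_sum N f w \<equiv> \<Sum>k\<in>hexagon N. torus_coeff f k * alternating_char k w"

lemma alternating_hexagonal_sum:
  "(\<Sum>g\<leftarrow>chamber_maps. of_int (map_sign g) * hexagonal_sum N f (map_point g z))
    = (\<Sum>k\<in>hexagon N. torus_coeff f k * alternating_char k z)"
proof -
  have "(\<Sum>g\<leftarrow>chamber_maps. of_int (map_sign g) * hexagonal_sum N f (map_point g z))
      = (\<Sum>g\<leftarrow>chamber_maps. \<Sum>k\<in>hexagon N. torus_coeff f k * (of_int (map_sign g) * torus_char (map_freq g k) z))"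
    unfolding hexagonal_sum_def torus_char_map_point sum_distrib_left by (simp add: mult_ac)
  also have "\<dots> = (\<Sum>k\<in>hexagon N. \<Sum>g\<leftarrow>chamber_maps. torus_coeff f k * (of_int (map_sign g) * torus_char (map_freq g k) z))"
    by (rule sum_sum_list_swap[symmetric])
  also have "\<dots> = (\<Sum>k\<in>hexagon N. torus_coeff f k * alternating_char k z)"
    unfolding alternating_char_def sum_list_const_mult ..
  finally show ?thesis .
qed

section \<open>The eigenfunctions as alternating characters\<close>

text \<open>The inverse of the change of coordinates from (x, y) to (\<alpha>, \<beta>).\<close>

definition hemi_map :: "real \<times> real \<Rightarrow> real \<times> real" where
  "hemi_map w = (sqrt 3 * (fst w - snd w), 1 - fst w - snd w)"

lemma powi_minus_one: "(-1 :: 'a::field) powi n = (if even n then 1 else -1)"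
  by (auto simp: power_int_minus_left)

lemma sin_pi_reflect: "sin (pi * of_int n * (1 - s)) = - ((-1) powi n * sin (pi * of_int n * s))"
proof -
  have "sin (pi * of_int n * (1 - s)) = sin (pi * of_int n - pi * of_int n * s)"
    by (simp add: algebra_simps)
  then show ?thesis
    by (simp add: sin_diff sin_npi_int cos_npi_int powi_minus_one)
qed

lemma alternating_char_cos:
  fixes a b :: int and x y :: real
  defines "C \<equiv> \<lambda>k l. cos (2 * pi * (of_int k * x + of_int l * y))"
  shows "alternating_char (a, b) (x, y)
    = of_real (2 * (C a b - C b a - C (a + b) (- b) - C a (- a - b) + C (a + b) (- a) + C b (- a - b)))"
proof -
  have pair: "torus_char (k, l) (x, y) + torus_char (- k, - l) (x, y) = of_real (2 * C k l)" for k l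
  proof -
    have "torus_char (k, l) (x, y) = cis (2 * pi * (of_int k * x + of_int l * y))"
      by (simp add: torus_char_def echar_def cis_mult algebra_simps)
    then have "Re (torus_char (k, l) (x, y)) = C k l" by (simp add: C_def)
    moreover have "torus_char (- k, - l) (x, y) = cnj (torus_char (k, l) (x, y))"
      by (simp add: torus_char_def cnj_echar)
    ultimately show ?thesis by (simp add: complex_eq_iff)
  qed
  have "alternating_char (a, b) (x, y)
     = (torus_char (a, b) (x, y) + torus_char (- a, - b) (x, y))
     - (torus_char (b, a) (x, y) + torus_char (- b, - a) (x, y))
     - (torus_char (a + b, - b) (x, y) + torus_char (- (a + b), - (- b)) (x, y))
     - (torus_char (a, - a - b) (x, y) + torus_char (- a, - (- a - b)) (x, y))
     + (torus_char (a + b, - a) (x, y) + torus_char (- (a + b), - (- a)) (x, y))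
     + (torus_char (b, - a - b) (x, y) + torus_char (- b, - (- a - b)) (x, y))"
    by (simp add: alternating_char_def chamber_maps_def algebra_simps)
  then show ?thesis unfolding pair by simp
qed

text \<open>With d = x - y and s = x + y the second coordinate is 1 - s. Reflecting the sines in 1 -
  s produces parities that combine with the prefactors to (-1)^(a+b), up to sign, in all three
  terms. Each product of two sines is then a difference of two cosines, and together these are the
  six cosines of \<open>alternating_char_cos\<close>.\<close>

lemma hemi_eigenfun_hemi_map:
  "complex_of_real (hemi_eigenfun (a - b) (a + b) (hemi_map w)) = (-1) powi (a + b) * alternating_char (a, b) w / 2"
proof -
  obtain x y where w: "w = (x, y)" by force
  define d where "d = x - y"
  define s where "s = x + y"
  define C where "C k l = cos (2 * pi * (of_int k * x + of_int l * y))" for k l :: int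
  define e :: real where "e = (-1) powi (a + b)"
  have e: "(-1) powi a * (-1) powi b = e" by (simp add: e_def power_int_add)
  have div: "(a - b + (a + b)) div 2 = a" "(a - b - (a + b)) div 2 = - b" by auto
  have mb: "(-1 :: real) powi (- b) = (-1) powi b" by (simp add: powi_minus_one)
  define P where "P n = sin (pi * of_int n * s)" for n :: int
  have refl: "sin (pi * of_int n * (1 - s)) = - ((-1) powi n * P n)" for n
    unfolding P_def by (rule sin_pi_reflect)
  have ss: "2 * sin u * sin v = cos U - cos V" if "u - v = U \<or> v - u = U" "u + v = V" for u v U V :: real
    using that by (auto simp: cos_diff cos_add)
  have S1: "2 * P (a + b) * sin (pi * of_int (a - b) * d) = C b a - C a b"
    unfolding C_def P_def by (rule ss) (simp_all add: d_def s_def algebra_simps)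
  have S2: "2 * P b * sin (pi * of_int (2 * a + b) * d) = C a (- a - b) - C (a + b) (- a)"
    unfolding C_def P_def by (rule ss) (simp_all add: d_def s_def algebra_simps)
  have S3: "2 * P a * sin (pi * of_int (a + 2 * b) * d) = C b (- a - b) - C (a + b) (- b)"
    unfolding C_def P_def by (rule ss) (simp_all add: d_def s_def algebra_simps)
  have "pi * of_int (a - b) * (sqrt 3 * d) / sqrt 3 = pi * of_int (a - b) * d"
    "pi * (sqrt 3 * d) / (2 * sqrt 3) * of_int (a - b + 3 * (a + b)) = pi * of_int (2 * a + b) * d"
    "pi * (1 - s) / 2 * of_int (a - b - (a + b)) = - (pi * of_int b * (1 - s))"
    "pi * (sqrt 3 * d) / (2 * sqrt 3) * of_int (a - b - 3 * (a + b)) = - (pi * of_int (a + 2 * b) * d)"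
    "pi * (1 - s) / 2 * of_int (a - b + (a + b)) = pi * of_int a * (1 - s)"
    by (simp_all add: field_simps)
  moreover have "hemi_map w = (sqrt 3 * d, 1 - s)" by (simp add: hemi_map_def w d_def s_def)
  ultimately have "hemi_eigenfun (a - b) (a + b) (hemi_map w)
      = 2 * sin (pi * of_int (a - b) * d) * sin (pi * of_int (a + b) * (1 - s))
       + 2 * (-1) powi a * sin (pi * of_int (2 * a + b) * d) * sin (pi * of_int b * (1 - s))
       - 2 * (-1) powi b * sin (pi * of_int (a + 2 * b) * d) * sin (pi * of_int a * (1 - s))"
    by (simp only: hemi_eigenfun_def case_prod_conv div mb sin_minus)
  also have "\<dots> = - e * (2 * P (a + b) * sin (pi * of_int (a - b) * d))
      - ((-1) powi a * (-1) powi b) * (2 * P b * sin (pi * of_int (2 * a + b) * d))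
      + ((-1) powi a * (-1) powi b) * (2 * P a * sin (pi * of_int (a + 2 * b) * d))"
    unfolding refl by (simp add: e_def mult_ac)
  also have "\<dots> = e * Re (alternating_char (a, b) w) / 2"
    unfolding e S1 S2 S3 w alternating_char_cos C_def[symmetric] Re_complex_of_real
    by (simp add: field_simps)
  finally have "hemi_eigenfun (a - b) (a + b) (hemi_map w) = e * Re (alternating_char (a, b) w) / 2" .
  moreover have "Im (alternating_char (a, b) w) = 0"
    unfolding w alternating_char_cos by simp
  ultimately have "complex_of_real (hemi_eigenfun (a - b) (a + b) (hemi_map w)) = of_real e * alternating_char (a, b) w / 2"
    by (simp add: complex_eq_iff)
  moreover have "complex_of_real e = (-1) powi (a + b)" by (simp add: e_def powi_minus_one)
  ultimately show ?thesis by simp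
qed

section \<open>The triangles and Lebesgue measure\<close>

lemma hemi_triangle_eq: "hemi_triangle = {(x, y). 0 \<le> x \<and> 0 \<le> y \<and> sqrt 3 * x + y \<le> 1}"
proof (intro set_eqI iffI)
  fix z assume "z \<in> hemi_triangle"
  then obtain u v w where "0 \<le> u" "0 \<le> v" "0 \<le> w" "u + v + w = 1"
    "z = u *\<^sub>R (0, 0) + v *\<^sub>R (1 / sqrt 3, 0) + w *\<^sub>R (0, 1)"
    unfolding hemi_triangle_def convex_hull_3 by auto
  then show "z \<in> {(x, y). 0 \<le> x \<and> 0 \<le> y \<and> sqrt 3 * x + y \<le> 1}" by auto
next
  fix z :: "real \<times> real" assume "z \<in> {(x, y). 0 \<le> x \<and> 0 \<le> y \<and> sqrt 3 * x + y \<le> 1}"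
  then obtain x y where z: "z = (x, y)" "0 \<le> x" "0 \<le> y" "sqrt 3 * x + y \<le> 1" by auto
  have "z = (1 - sqrt 3 * x - y) *\<^sub>R (0, 0) + (sqrt 3 * x) *\<^sub>R (1 / sqrt 3, 0) + y *\<^sub>R (0, 1)"
    using z by simp
  moreover have "0 \<le> 1 - sqrt 3 * x - y" "0 \<le> sqrt 3 * x" using z by auto
  ultimately show "z \<in> hemi_triangle"
    unfolding hemi_triangle_def convex_hull_3 using z(3)
    by (intro CollectI exI[of _ "1 - sqrt 3 * x - y"] exI[of _ "sqrt 3 * x"] exI[of _ y]) auto
qed

lemma hemi_subset_eq_triangle:
  assumes "(x, y) \<in> hemi_triangle"
  shows "(x, y) \<in> eq_triangle" "(- x, y) \<in> eq_triangle"
proof -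
  have *: "(r, y) \<in> eq_triangle" if "sqrt 3 * \<bar>r\<bar> + y \<le> 1" "0 \<le> y" for r
  proof -
    define u where "u = (1 - y - sqrt 3 * r) / 2"
    define v where "v = (1 - y + sqrt 3 * r) / 2"
    have "\<bar>sqrt 3 * r\<bar> \<le> 1 - y" using that by (simp add: abs_mult)
    then have "0 \<le> u" "0 \<le> v" by (auto simp: u_def v_def)
    moreover have "(r, y) = u *\<^sub>R (- 1 / sqrt 3, 0) + v *\<^sub>R (1 / sqrt 3, 0) + y *\<^sub>R (0, 1)"
      by (simp add: u_def v_def field_simps)
    moreover have "u + v + y = 1" by (simp add: u_def v_def field_simps)
    ultimately show ?thesis
      unfolding eq_triangle_def convex_hull_3 using that(2) by blast
  qed
  show "(x, y) \<in> eq_triangle" "(- x, y) \<in> eq_triangle"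
    using assms by (auto simp: hemi_triangle_eq intro!: *)
qed

lemma compact_triangles: "compact hemi_triangle" "compact eq_triangle"
  unfolding hemi_triangle_def eq_triangle_def by (intro finite_imp_compact_convex_hull; simp)+

lemma sets_triangles [measurable]: "hemi_triangle \<in> sets borel" "eq_triangle \<in> sets borel"
  using compact_triangles by (simp_all add: borel_compact)

lemma hemi_map_chamber: "hemi_map w \<in> hemi_triangle \<longleftrightarrow> w \<in> chamber"
proof -
  obtain x y where w: "w = (x, y)" by force
  have "sqrt 3 * (sqrt 3 * (x - y)) = 3 * (x - y)" by (simp add: mult.assoc[symmetric])
  then show ?thesis
    by (auto simp: w hemi_map_def hemi_triangle_eq chamber_def zero_le_mult_iff)
qed

lemma chamber_subset: "chamber \<subseteq> unit_square"
  by (auto simp: chamber_def)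

lemma measurable_chamber [measurable]: "chamber \<in> sets borel"
proof -
  have "closed chamber"
    unfolding chamber_def case_prod_beta' by (intro closed_Collect_conj closed_Collect_le continuous_intros)
  then show ?thesis by (rule borel_closed)
qed

lemma measurable_hemi_map [measurable]: "hemi_map \<in> borel_measurable borel"
  unfolding hemi_map_def by (intro borel_measurable_continuous_onI continuous_intros)

lemma AE_chamber_open: "AE w in lborel. w \<in> chamber \<longrightarrow> w \<in> open_chamber"
proof -
  have l: "negligible {z :: real \<times> real. a \<bullet> z = c}" if "a \<noteq> 0" for a c
    using that by (intro negligible_hyperplane) auto
  have "negligible ({z :: real \<times> real. (1, -1) \<bullet> z = 0} \<union> {z. (1, -2) \<bullet> z = 0} \<union> {z. (1, 1) \<bullet> z = 1})"
    by (intro negligible_Un l) (auto simp: zero_prod_def)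
  from AE_lborel_not_negligible[OF this] show ?thesis
    by eventually_elim (auto simp: chamber_def open_chamber_def inner_Pair)
qed

lemma hemi_map_nn_integral:
  assumes "\<psi> \<in> borel_measurable borel"
  shows "(\<integral>\<^sup>+z. \<psi> z \<partial>lborel) = ennreal (2 * sqrt 3) * (\<integral>\<^sup>+w. \<psi> (hemi_map w) \<partial>lborel)"
  using affine_nn_integral[OF assms, of "sqrt 3" "-1" "- sqrt 3" "-1" 0 1]
  by (simp add: hemi_map_def algebra_simps)

text \<open>The substitution rule for indicators identifies Lebesgue measure with a multiple of its
  image under \<open>hemi_map\<close>; the Bochner integral follows from this identity of
  measures.\<close>

lemma hemi_map_integral:
  fixes \<psi> :: "real \<times> real \<Rightarrow> real"
  assumes [measurable]: "\<psi> \<in> borel_measurable borel"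
  shows "(LINT z|lborel. \<psi> z) = 2 * sqrt 3 * (LINT w|lborel. \<psi> (hemi_map w))"
proof -
  have [measurable]: "hemi_map \<in> lborel \<rightarrow>\<^sub>M borel" by simp
  have "lborel = density (distr lborel borel hemi_map) (\<lambda>_. ennreal (2 * sqrt 3))"
  proof (rule measure_eqI)
    fix A :: "(real \<times> real) set" assume "A \<in> sets lborel"
    then have A [measurable]: "A \<in> sets borel" by simp
    have "emeasure lborel A = (\<integral>\<^sup>+z. indicator A z \<partial>lborel)" by simp
    also have "\<dots> = ennreal (2 * sqrt 3) * (\<integral>\<^sup>+w. indicator A (hemi_map w) \<partial>lborel)"
      by (rule hemi_map_nn_integral) simp
    also have "(\<integral>\<^sup>+w. indicator A (hemi_map w) \<partial>lborel) = (\<integral>\<^sup>+z. indicator A z \<partial>distr lborel borel hemi_map)"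
      by (subst nn_integral_distr) simp_all
    also have "ennreal (2 * sqrt 3) * \<dots> = emeasure (density (distr lborel borel hemi_map) (\<lambda>_. ennreal (2 * sqrt 3))) A"
      by (simp add: emeasure_density nn_integral_cmult)
    finally show "emeasure lborel A = emeasure (density (distr lborel borel hemi_map) (\<lambda>_. ennreal (2 * sqrt 3))) A" .
  qed simp
  then have "(LINT z|lborel. \<psi> z) = (LINT z|density (distr lborel borel hemi_map) (\<lambda>_. ennreal (2 * sqrt 3)). \<psi> z)"
    by simp
  also have "\<dots> = 2 * sqrt 3 * (LINT w|lborel. \<psi> (hemi_map w))"
    by (subst integral_density) (simp_all add: integral_distr)
  finally show ?thesis .
qed

text \<open>The reflection has determinant -1, so it pulls null sets back to null sets.\<close>

lemma AE_reflect:
  fixes P :: "real \<times> real \<Rightarrow> bool"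
  assumes "AE z in lborel. P z"
  shows "AE z in lborel. P (- fst z, snd z)"
proof -
  obtain N where N: "{z \<in> space lborel. \<not> P z} \<subseteq> N" "emeasure lborel N = 0" "N \<in> sets lborel"
    using assms by (rule AE_E)
  then have [measurable]: "N \<in> sets borel" by simp
  have "(\<integral>\<^sup>+z. indicator N (0 + (-1) * fst z + 0 * snd z, 0 + 0 * fst z + 1 * snd z) \<partial>(lborel :: (real \<times> real) measure)) = 0"
    using affine_nn_integral[of "indicator N" "-1" 1 0 0 0 0] N(2) by simp
  moreover have "(\<lambda>z. indicator N (- fst z, snd z :: real) :: ennreal) \<in> borel_measurable lborel"
    by (rule measurable_compose[of _ _ borel]) (auto intro!: borel_measurable_continuous_onI continuous_intros)
  ultimately have "AE z in lborel. indicator N (- fst z, snd z :: real) = (0 :: ennreal)"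
    by (simp add: nn_integral_0_iff_AE)
  then show ?thesis
    by eventually_elim (use N(1) in \<open>auto simp: indicator_def split: if_splits\<close>)
qed

lemma integral_lebesgue_on_borel:
  fixes \<phi> :: "'a::euclidean_space \<Rightarrow> real"
  assumes [measurable]: "\<phi> \<in> borel_measurable borel" "S \<in> sets borel"
  shows "integral\<^sup>L (lebesgue_on S) \<phi> = (LINT z:S|lborel. \<phi> z)"
    and "integrable (lebesgue_on S) \<phi> \<longleftrightarrow> set_integrable lborel S \<phi>"
proof -
  have S: "S \<inter> space lebesgue \<in> sets lebesgue" by simp
  show "integral\<^sup>L (lebesgue_on S) \<phi> = (LINT z:S|lborel. \<phi> z)"
    unfolding integral_restrict_space[OF S] set_lebesgue_integral_def
    by (rule integral_completion) simp
  show "integrable (lebesgue_on S) \<phi> \<longleftrightarrow> set_integrable lborel S \<phi>"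
    unfolding integrable_restrict_space[OF S] set_integrable_def
    by (rule integrable_completion) simp
qed

lemma AE_lebesgue_on:
  assumes "AE z in lborel. z \<in> S \<longrightarrow> P z" "S \<in> sets borel"
  shows "AE z in lebesgue_on S. P z"
  using assms by (simp add: AE_restrict_space_iff AE_completion_iff)

text \<open>Completeness of Lebesgue measure: changing a Borel function on a null set keeps it
  measurable. This is how functions known only almost everywhere become measurable.\<close>

lemma measurable_lebesgue_on_AE:
  fixes f g :: "'a::euclidean_space \<Rightarrow> real"
  assumes g: "g \<in> borel_measurable borel" and eq: "AE z in lborel. z \<in> S \<longrightarrow> f z = g z" and S: "S \<in> sets borel"
  shows "f \<in> borel_measurable (lebesgue_on S)"
proof -
  have S': "S \<in> sets lebesgue" using S by simp
  have "AE z in lebesgue. z \<in> S \<longrightarrow> f z = g z" using eq by (simp add: AE_completion_iff)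
  then obtain N where N: "N \<in> null_sets lebesgue" "{z \<in> space lebesgue. \<not> (z \<in> S \<longrightarrow> f z = g z)} \<subseteq> N"
    by (rule AE_E3) auto
  have "g measurable_on S"
    using g S' by (intro lebesgue_measurable_imp_measurable_on measurable_completion) auto
  then have "f measurable_on S"
    by (rule measurable_on_spike[where S = N])
       (use N in \<open>auto simp: negligible_iff_null_sets\<close>)
  then show ?thesis
    by (rule iffD1[OF measurable_on_iff_borel_measurable[OF S']])
qed

lemma norm_sum_powr_le:
  fixes a :: "'a \<Rightarrow> 'b::real_normed_vector"
  assumes "finite A" "0 < p"
  shows "norm (\<Sum>g\<in>A. a g) powr p \<le> real (card A) powr p * (\<Sum>g\<in>A. norm (a g) powr p)"
proof (cases "A = {}")
  case False
  define M where "M = Max ((\<lambda>g. norm (a g)) ` A)"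
  have M: "norm (a g) \<le> M" if "g \<in> A" for g
    using that assms(1) by (auto simp: M_def)
  have "M \<in> (\<lambda>g. norm (a g)) ` A" unfolding M_def using False assms(1) by (intro Max_in) auto
  then obtain h where h: "h \<in> A" "M = norm (a h)" by blast
  have "norm (\<Sum>g\<in>A. a g) \<le> real (card A) * M" by (rule sum_norm_bound) (rule M)
  then have "norm (\<Sum>g\<in>A. a g) powr p \<le> (real (card A) * M) powr p"
    using assms by (intro powr_mono2) auto
  also have "\<dots> = real (card A) powr p * M powr p" using h by (simp add: powr_mult)
  also have "M powr p \<le> (\<Sum>g\<in>A. norm (a g) powr p)"
    unfolding h(2) using h(1) assms(1) by (intro member_le_sum) auto
  finally show ?thesis by (simp add: mult_left_mono)
qed simp

lemma distinct_chamber_maps: "distinct chamber_maps"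
  by (simp add: chamber_maps_def)

text \<open>From the open chamber only the identity leads back into the support of \<open>F\<close>,
  so \<open>F w\<close> is itself the alternating sum of \<open>F\<close> over the twelve image
  points. The difference is thus the alternating sum of the torus error \<open>D\<close> at these
  points. Each map preserves measure and keeps the points in the unit square. The constant is 12^p
  for the p-th power of a sum of twelve terms, times 12 for the twelve equal integrals.\<close>

lemma chamber_estimate:
  fixes F :: "real \<times> real \<Rightarrow> real"
  assumes p: "0 < p" and F [measurable]: "F \<in> borel_measurable borel" and F0: "\<And>w. w \<notin> chamber \<Longrightarrow> F w = 0"
  shows "(\<integral>\<^sup>+w\<in>chamber. ennreal (norm (alternating_sum N (\<lambda>z. of_real (F z)) w - of_real (F w)) powr p) \<partial>lborel)
    \<le> ennreal (12 powr p * 12) * torus_pint p (\<lambda>z. hexagonal_sum N (\<lambda>z. of_real (F z)) z - of_real (F z))"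
proof -
  define H where "H = hexagonal_sum N (\<lambda>z. complex_of_real (F z))"
  define D where "D z = H z - of_real (F z)" for z
  have [measurable]: "H \<in> borel_measurable borel" unfolding H_def by simp
  have [measurable]: "D \<in> borel_measurable borel" unfolding D_def by measurable
  define A where "A = set chamber_maps"
  have A: "finite A" "card A = 12"
    using distinct_card[OF distinct_chamber_maps] by (simp_all add: A_def chamber_maps_def)
  have id: "(1, 1, 0, 0, 0, 1, 0) \<in> A" by (simp add: A_def chamber_maps_def)
  have sum_A: "(\<Sum>g\<leftarrow>chamber_maps. u g) = (\<Sum>g\<in>A. u g)" for u :: "affine_data \<Rightarrow> complex"
    unfolding A_def by (rule sum_list_distinct_conv_sum_set[OF distinct_chamber_maps])
  have eq: "alternating_sum N (\<lambda>z. of_real (F z)) w - of_real (F w)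
      = (\<Sum>g\<in>A. of_int (map_sign g) * D (map_point g w))" if w: "w \<in> open_chamber" for w
  proof -
    have "(\<Sum>g\<in>A. of_int (map_sign g) * complex_of_real (F (map_point g w)))
        = (\<Sum>g\<in>A. if g = (1, 1, 0, 0, 0, 1, 0) then of_real (F w) else 0)"
      using map_point_open_chamber(2)[OF _ w] F0 unfolding A_def[symmetric]
      by (intro sum.cong refl) auto
    also have "\<dots> = of_real (F w)" using id A by simp
    finally have F': "(\<Sum>g\<in>A. of_int (map_sign g) * complex_of_real (F (map_point g w))) = of_real (F w)" .
    have "alternating_sum N (\<lambda>z. of_real (F z)) w
        = (\<Sum>g\<in>A. of_int (map_sign g) * H (map_point g w))"
      unfolding alternating_hexagonal_sum[symmetric] sum_A H_def ..
    then show ?thesis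
      unfolding F'[symmetric] by (simp add: D_def right_diff_distrib sum_subtractf)
  qed
  have sgn: "\<bar>map_sign g\<bar> = 1" if "g \<in> A" for g using that by (auto simp: A_def chamber_maps_def)
  have [measurable]: "map_point g \<in> borel_measurable borel" for g
    by (cases g) (auto simp: fun_eq_iff intro!: borel_measurable_continuous_onI continuous_intros)
  let ?G = "\<lambda>z. ennreal (norm (D z) powr p) * indicator unit_square z"
  have measG: "(\<lambda>w. ?G (map_point g w)) \<in> borel_measurable borel" for g
    by (rule measurable_compose[of "map_point g" borel borel ?G]) measurable
  have "(\<integral>\<^sup>+w\<in>chamber. ennreal (norm (alternating_sum N (\<lambda>z. of_real (F z)) w - of_real (F w)) powr p) \<partial>lborel)
      \<le> (\<integral>\<^sup>+w. ennreal (12 powr p) * (\<Sum>g\<in>A. ?G (map_point g w)) \<partial>lborel)"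
  proof (rule nn_integral_mono_AE)
    show "AE w in lborel. ennreal (norm (alternating_sum N (\<lambda>z. of_real (F z)) w - of_real (F w)) powr p) * indicator chamber w
        \<le> ennreal (12 powr p) * (\<Sum>g\<in>A. ?G (map_point g w))"
      using AE_chamber_open
    proof eventually_elim
      case (elim w)
      show ?case
      proof (cases "w \<in> chamber")
        case True
        then have w: "w \<in> open_chamber" using elim by simp
        have "norm (\<Sum>g\<in>A. of_int (map_sign g) * D (map_point g w)) powr p
            \<le> real (card A) powr p * (\<Sum>g\<in>A. norm (of_int (map_sign g) * D (map_point g w)) powr p)"
          by (rule norm_sum_powr_le[OF A(1) p])
        also have "(\<Sum>g\<in>A. norm (of_int (map_sign g) * D (map_point g w)) powr p) = (\<Sum>g\<in>A. norm (D (map_point g w)) powr p)"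
          using sgn by (intro sum.cong refl) (simp add: norm_mult of_int_abs[symmetric] del: of_int_abs)
        finally have "ennreal (norm (\<Sum>g\<in>A. of_int (map_sign g) * D (map_point g w)) powr p)
            \<le> ennreal (12 powr p * (\<Sum>g\<in>A. norm (D (map_point g w)) powr p))"
          using A(2) by (simp add: ennreal_leI)
        also have "\<dots> = ennreal (12 powr p) * (\<Sum>g\<in>A. ennreal (norm (D (map_point g w)) powr p))"
          by (simp add: ennreal_mult sum_nonneg sum_ennreal)
        also have "(\<Sum>g\<in>A. ennreal (norm (D (map_point g w)) powr p)) = (\<Sum>g\<in>A. ?G (map_point g w))"
          using map_point_open_chamber(1)[OF _ w] by (intro sum.cong refl) (simp add: A_def)
        finally show ?thesis using True by (simp add: eq[OF w])
      qed simp
    qed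
  qed
  also have "\<dots> = ennreal (12 powr p) * (\<Sum>g\<in>A. \<integral>\<^sup>+w. ?G (map_point g w) \<partial>lborel)"
    using measG by (subst nn_integral_cmult) (simp_all add: nn_integral_sum)
  also have "(\<Sum>g\<in>A. \<integral>\<^sup>+w. ?G (map_point g w) \<partial>lborel) = (\<Sum>g\<in>A. torus_pint p D)"
    unfolding torus_pint_def by (intro sum.cong refl map_point_nn_integral) (auto simp: A_def)
  also have "ennreal (12 powr p) * \<dots> = ennreal (12 powr p * 12) * torus_pint p D"
    using A by (simp add: ennreal_mult mult.assoc)
  finally show ?thesis unfolding D_def H_def .
qed

section \<open>Convergence on the triangle\<close>

text \<open>The alternating character is real, so the conjugation in the Fourier coefficients
  disappears after summation; the rest is linearity.\<close>

lemma alternating_coeff: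
  assumes "1 \<le> p" "f \<in> borel_measurable borel" "torus_pint p f < \<infinity>"
  shows "(\<Sum>g\<leftarrow>chamber_maps. of_int (map_sign g) * torus_coeff f (map_freq g k))
    = (LINT z:unit_square|lborel. f z * alternating_char k z)"
proof -
  define A where "A = set chamber_maps"
  have sum_A: "(\<Sum>g\<leftarrow>chamber_maps. u g) = (\<Sum>g\<in>A. u g)" for u :: "affine_data \<Rightarrow> complex"
    unfolding A_def by (rule sum_list_distinct_conv_sum_set[OF distinct_chamber_maps])
  have int: "set_integrable lborel unit_square (\<lambda>z. of_int (map_sign g) * (f z * cnj (torus_char (map_freq g k) z)))" for g
    by (intro set_integrable_mult_right torus_coeff_integrable[OF assms])
  have "(LINT z:unit_square|lborel. f z * alternating_char k z) = (LINT z:unit_square|lborel. f z * cnj (alternating_char k z))"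
    by (simp only: cnj_alternating_char)
  also have "\<dots> = (LINT z:unit_square|lborel. \<Sum>g\<in>A. of_int (map_sign g) * (f z * cnj (torus_char (map_freq g k) z)))"
    unfolding alternating_char_def sum_A by (simp add: sum_distrib_left mult_ac)
  also have "\<dots> = (\<Sum>g\<in>A. LINT z:unit_square|lborel. of_int (map_sign g) * (f z * cnj (torus_char (map_freq g k) z)))"
    unfolding set_lebesgue_integral_def scaleR_sum_right
    using int unfolding set_integrable_def by (intro Bochner_Integration.integral_sum)
  also have "\<dots> = (\<Sum>g\<in>A. of_int (map_sign g) * torus_coeff f (map_freq g k))"
    by (simp add: torus_coeff_def)
  finally show ?thesis unfolding sum_A ..
qed

lemma continuous_on_hemi_eigenfun: "continuous_on S (hemi_eigenfun m n)"
  unfolding hemi_eigenfun_def case_prod_beta' by (intro continuous_intros) auto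

lemma continuous_on_hemi_partial_sum: "continuous_on S (hemi_partial_sum g N)"
  unfolding hemi_partial_sum_def case_prod_beta'
  by (intro continuous_intros continuous_on_hemi_eigenfun)

lemma bij_sector_hemi_indices:
  "(\<Sum>(m, n)\<in>hemi_indices N. u m n) = (\<Sum>(a, b)\<in>sector N. u (a - b) (a + b))"
proof (rule sum.reindex_bij_witness[of _ "\<lambda>(a, b). (a - b, a + b)" "\<lambda>(m, n). ((m + n) div 2, (n - m) div 2)"])
  fix z assume z: "z \<in> hemi_indices N"
  obtain m n where mn: "z = (m, n)" by force
  have h: "0 < m" "m < n" "n \<le> int N" "m mod 2 = n mod 2" using z by (auto simp: mn hemi_indices_def)
  obtain a where a: "m + n = 2 * a" using h(4) by (metis evenE even_add even_iff_mod_2_eq_zero odd_iff_mod_2_eq_one)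
  have b: "n - m = 2 * (a - m)" and n: "n = 2 * a - m" using a by simp_all
  have d: "(m + n) div 2 = a" "(n - m) div 2 = a - m" unfolding a b by auto
  show "(case case z of (m, n) \<Rightarrow> ((m + n) div 2, (n - m) div 2) of (a, b) \<Rightarrow> (a - b, a + b)) = z"
    using a by (simp add: mn d)
  show "(case z of (m, n) \<Rightarrow> ((m + n) div 2, (n - m) div 2)) \<in> sector N"
    using a h by (simp add: mn d sector_def)
  show "(case case z of (m, n) \<Rightarrow> ((m + n) div 2, (n - m) div 2) of (a, b) \<Rightarrow> u (a - b) (a + b)) = (case z of (m, n) \<Rightarrow> u m n)"
    by (simp add: mn d n algebra_simps)
next
  fix k assume k: "k \<in> sector N"
  obtain a b where ab: "k = (a, b)" by force
  have "(a - b) mod 2 = (a + b) mod 2" by presburger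
  then show "(case k of (a, b) \<Rightarrow> (a - b, a + b)) \<in> hemi_indices N"
    using k by (auto simp: ab sector_def hemi_indices_def)
  show "(case case k of (a, b) \<Rightarrow> (a - b, a + b) of (m, n) \<Rightarrow> ((m + n) div 2, (n - m) div 2)) = k"
    by (simp add: ab)
qed

text \<open>The normalisations match: 2 / sqrt 3 times the Jacobian 2 sqrt 3 is 4, and a factor
  (-1)^(a+b) / 2 comes once from the eigenfunction in the coefficient and once from the one in the
  sum; their product is 1.\<close>

lemma hemi_partial_sum_chamber:
  fixes g g' F :: "real \<times> real \<Rightarrow> real"
  assumes p: "1 \<le> p" and g' [measurable]: "g' \<in> borel_measurable borel"
    and eq: "AE z in lborel. z \<in> hemi_triangle \<longrightarrow> g z = g' z"
    and F_def: "\<And>w. F w = indicator chamber w * g' (hemi_map w)"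
    and fin: "torus_pint p (\<lambda>w. of_real (F w)) < \<infinity>"
  shows "complex_of_real (hemi_partial_sum g N (hemi_map w))
    = alternating_sum N (\<lambda>w. of_real (F w)) w"
proof -
  have [measurable]: "F \<in> borel_measurable borel" unfolding F_def by measurable
  have [measurable]: "hemi_eigenfun m n \<in> borel_measurable borel" for m n
    by (intro borel_measurable_continuous_onI continuous_on_hemi_eigenfun)
  have mF: "(\<lambda>w. complex_of_real (F w)) \<in> borel_measurable borel" by measurable
  define c where "c k = (\<Sum>g\<leftarrow>chamber_maps. of_int (map_sign g) * torus_coeff (\<lambda>w. of_real (F w)) (map_freq g k))" for k
  have coeff: "complex_of_real (hemi_coeff g (a - b) (a + b)) = 2 * (-1) powi (a + b) * c (a, b)" for a b
  proof -
    define u where "u = hemi_eigenfun (a - b) (a + b)"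
    have [measurable]: "u \<in> borel_measurable borel" unfolding u_def by measurable
    have "integral\<^sup>L (lebesgue_on hemi_triangle) (\<lambda>z. g z * u z) = integral\<^sup>L (lebesgue_on hemi_triangle) (\<lambda>z. g' z * u z)"
    proof (rule integral_cong_AE)
      have "AE z in lborel. z \<in> hemi_triangle \<longrightarrow> g z * u z = g' z * u z"
        using eq by eventually_elim auto
      then show "(\<lambda>z. g z * u z) \<in> borel_measurable (lebesgue_on hemi_triangle)"
        and "AE z in lebesgue_on hemi_triangle. g z * u z = g' z * u z"
        by (auto intro!: measurable_lebesgue_on_AE[of "\<lambda>z. g' z * u z"] AE_lebesgue_on)
      show "(\<lambda>z. g' z * u z) \<in> borel_measurable (lebesgue_on hemi_triangle)"
        by (rule measurable_lebesgue_on_AE[of "\<lambda>z. g' z * u z"]) auto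
    qed
    also have "\<dots> = (LINT z:hemi_triangle|lborel. g' z * u z)"
      by (rule integral_lebesgue_on_borel) auto
    also have "\<dots> = 2 * sqrt 3 * (LINT w|lborel. indicator hemi_triangle (hemi_map w) *\<^sub>R (g' (hemi_map w) * u (hemi_map w)))"
      unfolding set_lebesgue_integral_def by (rule hemi_map_integral) auto
    also have "(LINT w|lborel. indicator hemi_triangle (hemi_map w) *\<^sub>R (g' (hemi_map w) * u (hemi_map w)))
        = (LINT w|lborel. F w * u (hemi_map w))"
      by (simp add: F_def indicator_def hemi_map_chamber mult_ac)
    finally have "hemi_coeff g (a - b) (a + b) = 4 * (LINT w|lborel. F w * u (hemi_map w))"
      by (simp add: hemi_coeff_def u_def)
    then have "complex_of_real (hemi_coeff g (a - b) (a + b)) = 4 * (LINT w|lborel. complex_of_real (F w * u (hemi_map w)))"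
      by (subst integral_complex_of_real) simp
    also have "(LINT w|lborel. complex_of_real (F w * u (hemi_map w)))
        = (LINT w|lborel. ((-1) powi (a + b) / 2) * (indicator unit_square w *\<^sub>R (of_real (F w) * alternating_char (a, b) w)))"
    proof (intro Bochner_Integration.integral_cong refl)
      fix w
      have "complex_of_real (F w * u (hemi_map w)) = of_real (F w) * ((-1) powi (a + b) * alternating_char (a, b) w / 2)"
        unfolding of_real_mult u_def hemi_eigenfun_hemi_map ..
      then show "complex_of_real (F w * u (hemi_map w))
          = ((-1) powi (a + b) / 2) * (indicator unit_square w *\<^sub>R (of_real (F w) * alternating_char (a, b) w))"
        using chamber_subset by (auto simp: F_def indicator_def)
    qed
    also have "\<dots> = ((-1) powi (a + b) / 2) * c (a, b)"
      unfolding c_def alternating_coeff[OF p mF fin] set_lebesgue_integral_def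
      by (rule integral_mult_right_zero)
    finally show ?thesis by simp
  qed
  have "complex_of_real (hemi_partial_sum g N (hemi_map w))
      = (\<Sum>(a, b)\<in>sector N. complex_of_real (hemi_coeff g (a - b) (a + b)) * of_real (hemi_eigenfun (a - b) (a + b) (hemi_map w)))"
    unfolding hemi_partial_sum_def bij_sector_hemi_indices by (simp add: case_prod_beta')
  also have "\<dots> = (\<Sum>(a, b)\<in>sector N. c (a, b) * alternating_char (a, b) w)"
    unfolding coeff hemi_eigenfun_hemi_map
    by (intro sum.cong refl) (auto simp: powi_minus_one)
  also have "\<dots> = alternating_sum N (\<lambda>w. of_real (F w)) w"
    unfolding hexagon_alternating_sum c_def by (simp add: case_prod_beta')
  finally show ?thesis .
qed

text \<open>Transported to the chamber, the error is at most a constant times that of the hexagonal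
  sums of \<open>F\<close>; the constant consists of the Jacobian and the factor of
  \<open>chamber_estimate\<close>, neither depending on \<open>N\<close>.\<close>

lemma hemi_partial_sum_tendsto:
  fixes g g' :: "real \<times> real \<Rightarrow> real"
  assumes p: "1 < p" and g' [measurable]: "g' \<in> borel_measurable borel"
    and eq: "AE z in lborel. z \<in> hemi_triangle \<longrightarrow> g z = g' z"
    and fin: "(\<integral>\<^sup>+z\<in>hemi_triangle. ennreal (\<bar>g' z\<bar> powr p) \<partial>lborel) < \<infinity>"
  shows "(\<lambda>N. \<integral>\<^sup>+z\<in>hemi_triangle. ennreal (\<bar>hemi_partial_sum g N z - g' z\<bar> powr p) \<partial>lborel) \<longlonglongrightarrow> 0"
proof -
  let ?I = "\<lambda>N. \<integral>\<^sup>+z\<in>hemi_triangle. ennreal (\<bar>hemi_partial_sum g N z - g' z\<bar> powr p) \<partial>lborel"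
  define F where "F w = indicator chamber w * g' (hemi_map w)" for w
  have F [measurable]: "F \<in> borel_measurable borel" unfolding F_def by measurable
  have [measurable]: "hemi_partial_sum g N \<in> borel_measurable borel" for N
    by (intro borel_measurable_continuous_onI continuous_on_hemi_partial_sum)
  have ind: "indicator hemi_triangle (hemi_map w) = (indicator chamber w :: ennreal)" for w
    by (simp add: indicator_def hemi_map_chamber)
  have "torus_pint p (\<lambda>w. of_real (F w)) = (\<integral>\<^sup>+w. ennreal (\<bar>g' (hemi_map w)\<bar> powr p) * indicator hemi_triangle (hemi_map w) \<partial>lborel)"
    unfolding torus_pint_def ind using chamber_subset p
    by (intro nn_integral_cong) (auto simp: F_def indicator_def)
  also have "\<dots> < \<infinity>"
    using fin hemi_map_nn_integral[of "\<lambda>z. ennreal (\<bar>g' z\<bar> powr p) * indicator hemi_triangle z"]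
    by (auto simp: ennreal_mult_less_top)
  finally have Ffin: "torus_pint p (\<lambda>w. of_real (F w)) < \<infinity>" .
  define T where "T N = torus_pint p (\<lambda>z. hexagonal_sum N (\<lambda>z. of_real (F z)) z - of_real (F z))" for N
  have T: "T \<longlonglongrightarrow> 0" unfolding T_def by (rule hexagonal_sum_tendsto[OF p F Ffin])
  have bound: "?I N
      \<le> ennreal (2 * sqrt 3) * (ennreal (12 powr p * 12) * T N)" for N
  proof -
    have "?I N
        = ennreal (2 * sqrt 3) * (\<integral>\<^sup>+w. ennreal (\<bar>hemi_partial_sum g N (hemi_map w) - g' (hemi_map w)\<bar> powr p) * indicator chamber w \<partial>lborel)"
      unfolding ind[symmetric] by (rule hemi_map_nn_integral) measurable
    also have "(\<integral>\<^sup>+w. ennreal (\<bar>hemi_partial_sum g N (hemi_map w) - g' (hemi_map w)\<bar> powr p) * indicator chamber w \<partial>lborel)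
        = (\<integral>\<^sup>+w\<in>chamber. ennreal (norm (alternating_sum N (\<lambda>z. of_real (F z)) w - of_real (F w)) powr p) \<partial>lborel)"
    proof (intro nn_integral_cong)
      fix w
      have "norm (complex_of_real (hemi_partial_sum g N (hemi_map w)) - of_real (F w)) = \<bar>hemi_partial_sum g N (hemi_map w) - F w\<bar>"
        by (metis norm_of_real of_real_diff)
      moreover have "complex_of_real (hemi_partial_sum g N (hemi_map w)) = alternating_sum N (\<lambda>z. of_real (F z)) w"
        using p by (intro hemi_partial_sum_chamber[OF _ g' eq F_def Ffin]) simp
      ultimately show "ennreal (\<bar>hemi_partial_sum g N (hemi_map w) - g' (hemi_map w)\<bar> powr p) * indicator chamber w
        = ennreal (norm (alternating_sum N (\<lambda>z. of_real (F z)) w - of_real (F w)) powr p) * indicator chamber w"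
        by (simp add: F_def indicator_def)
    qed
    also have "\<dots> \<le> ennreal (12 powr p * 12) * T N"
      unfolding T_def using p by (intro chamber_estimate F) (auto simp: F_def)
    finally show ?thesis by (simp add: mult_left_mono)
  qed
  have "(\<lambda>N. ennreal (2 * sqrt 3) * (ennreal (12 powr p * 12) * T N)) \<longlonglongrightarrow> ennreal (2 * sqrt 3) * (ennreal (12 powr p * 12) * 0)"
    by (intro ennreal_tendsto_cmult T) auto
  then have lim: "(\<lambda>N. ennreal (2 * sqrt 3) * (ennreal (12 powr p * 12) * T N)) \<longlonglongrightarrow> 0" by simp
  show ?thesis
  proof (rule tendsto_sandwich[OF _ _ _ lim])
    show "\<forall>\<^sub>F N in sequentially. (0 :: ennreal) \<le> ?I N"
      by simp
    show "\<forall>\<^sub>F N in sequentially. ?I N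
        \<le> ennreal (2 * sqrt 3) * (ennreal (12 powr p * 12) * T N)"
      by (intro always_eventually allI bound)
  qed (rule tendsto_const)
qed

section \<open>Borel representatives and the conclusion\<close>

text \<open>\<open>f\<close> is merely Lebesgue measurable and given on the triangle, so its zero
  extension is exchanged for a Borel function. The antisymmetric part also evaluates
  \<open>f\<close> at the mirror point; agreement there holds almost everywhere because the
  reflection preserves null sets, and both points lie in \<open>eq_triangle\<close>.\<close>

lemma antisym_part_representative:
  fixes p :: real and f :: "real \<times> real \<Rightarrow> real"
  assumes p: "1 < p" and f: "f \<in> Lp_space (lebesgue_on eq_triangle) p"
  obtains g' where "g' \<in> borel_measurable borel"
    "AE z in lborel. z \<in> hemi_triangle \<longrightarrow> antisym_part f z = g' z"
    "(\<integral>\<^sup>+z\<in>hemi_triangle. ennreal (\<bar>g' z\<bar> powr p) \<partial>lborel) < \<infinity>"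
proof -
  have fm: "f \<in> borel_measurable (lebesgue_on eq_triangle)"
    and fi: "integrable (lebesgue_on eq_triangle) (\<lambda>z. \<bar>f z\<bar> powr p)"
    using f by (auto simp: Lp_space_def)
  define f0 where "f0 z = (if z \<in> eq_triangle then f z else 0)" for z
  have "f0 \<in> borel_measurable lebesgue"
    unfolding f0_def using fm by (intro borel_measurable_if_I) auto
  then obtain f' where f' [measurable]: "f' \<in> borel_measurable borel" and ae: "AE z in lborel. f0 z = f' z"
    using completion_ex_borel_measurable_real[of f0 lborel] by auto
  have "integrable lebesgue (\<lambda>z. indicator eq_triangle z *\<^sub>R (\<bar>f z\<bar> powr p))"
    using fi by (subst (asm) integrable_restrict_space) auto
  then have "(\<integral>\<^sup>+z. ennreal (norm (indicator eq_triangle z *\<^sub>R (\<bar>f z\<bar> powr p))) \<partial>lebesgue) < \<infinity>"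
    by (simp add: integrable_iff_bounded)
  also have "(\<integral>\<^sup>+z. ennreal (norm (indicator eq_triangle z *\<^sub>R (\<bar>f z\<bar> powr p))) \<partial>lebesgue)
      = (\<integral>\<^sup>+z. ennreal (norm (indicator eq_triangle z *\<^sub>R (\<bar>f z\<bar> powr p))) \<partial>lborel)"
    by (rule nn_integral_completion)
  also have "\<dots> = (\<integral>\<^sup>+z. ennreal (\<bar>f' z\<bar> powr p) \<partial>lborel)"
  proof (rule nn_integral_cong_AE)
    show "AE z in lborel. ennreal (norm (indicator eq_triangle z *\<^sub>R (\<bar>f z\<bar> powr p))) = ennreal (\<bar>f' z\<bar> powr p)"
      using ae by eventually_elim (auto simp: f0_def indicator_def split: if_splits)
  qed
  finally have fin: "(\<integral>\<^sup>+z. ennreal (\<bar>f' z\<bar> powr p) \<partial>lborel) < \<infinity>" .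
  define r where "r z = (- fst z, snd z)" for z :: "real \<times> real"
  have [measurable]: "r \<in> borel_measurable borel"
    unfolding r_def by (intro borel_measurable_continuous_onI continuous_intros)
  define g' where "g' z = (f' z - f' (r z)) / 2" for z
  have m [measurable]: "g' \<in> borel_measurable borel" unfolding g'_def by measurable
  have "AE z in lborel. f0 (- fst z, snd z) = f' (- fst z, snd z)" by (rule AE_reflect[OF ae])
  with ae have "AE z in lborel. z \<in> hemi_triangle \<longrightarrow> antisym_part f z = g' z"
  proof eventually_elim
    case (elim z)
    then show ?case
      using hemi_subset_eq_triangle[of "fst z" "snd z"]
      by (auto simp: antisym_part_def g'_def r_def f0_def case_prod_beta')
  qed
  moreover have "(\<integral>\<^sup>+z\<in>hemi_triangle. ennreal (\<bar>g' z\<bar> powr p) \<partial>lborel) < \<infinity>"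
  proof -
    have refl: "(\<integral>\<^sup>+z. ennreal (\<bar>f' (r z)\<bar> powr p) \<partial>lborel) = (\<integral>\<^sup>+z. ennreal (\<bar>f' z\<bar> powr p) \<partial>lborel)"
      using affine_nn_integral[of "\<lambda>z. ennreal (\<bar>f' z\<bar> powr p)" "-1" 1 0 0 0 0] by (simp add: r_def)
    have "\<bar>g' z\<bar> powr p \<le> 2 powr p * (\<bar>f' z\<bar> powr p + \<bar>f' (r z)\<bar> powr p)" for z
    proof -
      have "\<bar>g' z\<bar> powr p \<le> (\<bar>f' z\<bar> + \<bar>f' (r z)\<bar>) powr p"
        using p by (intro powr_mono2) (auto simp: g'_def)
      also have "\<dots> \<le> 2 powr p * (\<bar>f' z\<bar> powr p + \<bar>f' (r z)\<bar> powr p)"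
        using p by (intro powr_add_le) auto
      finally show ?thesis .
    qed
    then have "(\<integral>\<^sup>+z\<in>hemi_triangle. ennreal (\<bar>g' z\<bar> powr p) \<partial>lborel)
        \<le> (\<integral>\<^sup>+z. ennreal (2 powr p) * (ennreal (\<bar>f' z\<bar> powr p) + ennreal (\<bar>f' (r z)\<bar> powr p)) \<partial>lborel)"
      by (intro nn_integral_mono)
         (auto simp: indicator_def ennreal_mult[symmetric] ennreal_plus[symmetric] simp del: ennreal_plus intro!: ennreal_leI)
    also have "\<dots> = ennreal (2 powr p) * ((\<integral>\<^sup>+z. ennreal (\<bar>f' z\<bar> powr p) \<partial>lborel) + (\<integral>\<^sup>+z. ennreal (\<bar>f' (r z)\<bar> powr p) \<partial>lborel))"
      by (subst nn_integral_cmult) (auto simp: nn_integral_add)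
    also have "\<dots> < \<infinity>" unfolding refl using fin by (simp add: ennreal_mult_less_top)
    finally show ?thesis .
  qed
  ultimately show ?thesis using m that by blast
qed

theorem theorem8:
  fixes p :: real and f :: "real \<times> real \<Rightarrow> real"
  assumes "1 < p"
    and "f \<in> Lp_space (lebesgue_on eq_triangle) p"
  shows "antisym_part f \<in> Lp_space (lebesgue_on hemi_triangle) p
    \<and> Lp_converges (lebesgue_on hemi_triangle) p
        (hemi_partial_sum (antisym_part f)) (antisym_part f)"
proof -
  obtain g' where g' [measurable]: "g' \<in> borel_measurable borel"
    and eq: "AE z in lborel. z \<in> hemi_triangle \<longrightarrow> antisym_part f z = g' z"
    and fin: "(\<integral>\<^sup>+z\<in>hemi_triangle. ennreal (\<bar>g' z\<bar> powr p) \<partial>lborel) < \<infinity>"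
    by (rule antisym_part_representative[OF assms])
  let ?M = "lebesgue_on hemi_triangle"
  let ?S = "hemi_partial_sum (antisym_part f)"
  have S [measurable]: "?S N \<in> borel_measurable borel" for N
    by (intro borel_measurable_continuous_onI continuous_on_hemi_partial_sum)
  have gm: "antisym_part f \<in> borel_measurable ?M"
    by (rule measurable_lebesgue_on_AE[OF g' eq sets_triangles(1)])
  have gp: "antisym_part f \<in> Lp_space ?M p"
  proof -
    have "set_integrable lborel hemi_triangle (\<lambda>z. \<bar>g' z\<bar> powr p)"
      unfolding set_integrable_def
    proof (rule integrableI_nonneg)
      have "(\<integral>\<^sup>+z. ennreal (indicator hemi_triangle z *\<^sub>R (\<bar>g' z\<bar> powr p)) \<partial>lborel)
          = (\<integral>\<^sup>+z\<in>hemi_triangle. ennreal (\<bar>g' z\<bar> powr p) \<partial>lborel)"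
        by (intro nn_integral_cong) (auto simp: indicator_def)
      then show "(\<integral>\<^sup>+z. ennreal (indicator hemi_triangle z *\<^sub>R (\<bar>g' z\<bar> powr p)) \<partial>lborel) < \<infinity>"
        using fin by simp
    qed auto
    then have "integrable ?M (\<lambda>z. \<bar>g' z\<bar> powr p)" by (simp add: integral_lebesgue_on_borel(2))
    moreover have "(\<lambda>z. \<bar>antisym_part f z\<bar> powr p) \<in> borel_measurable ?M"
      by (intro powr_real_measurable borel_measurable_abs gm borel_measurable_const)
    moreover have "AE z in ?M. \<bar>g' z\<bar> powr p = \<bar>antisym_part f z\<bar> powr p"
    proof (rule AE_lebesgue_on)
      show "AE z in lborel. z \<in> hemi_triangle \<longrightarrow> \<bar>g' z\<bar> powr p = \<bar>antisym_part f z\<bar> powr p"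
        using eq by eventually_elim auto
    qed simp
    ultimately have "integrable ?M (\<lambda>z. \<bar>antisym_part f z\<bar> powr p)"
      by (rule integrable_cong_AE_imp)
    then show ?thesis using gm by (simp add: Lp_space_def)
  qed
  have SN: "?S N \<in> Lp_space ?M p" for N
  proof -
    have "set_integrable lborel hemi_triangle (\<lambda>z. \<bar>?S N z\<bar> powr p)"
      unfolding set_integrable_def
    proof (rule borel_integrable_compact[OF compact_triangles(1)])
      show "continuous_on hemi_triangle (\<lambda>z. \<bar>?S N z\<bar> powr p)"
        using assms(1) by (intro continuous_on_powr' continuous_on_rabs continuous_on_const
            continuous_on_hemi_partial_sum) auto
    qed
    then have "integrable ?M (\<lambda>z. \<bar>?S N z\<bar> powr p)" by (simp add: integral_lebesgue_on_borel(2))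
    moreover have "?S N \<in> borel_measurable ?M"
      by (rule measurable_lebesgue_on_AE[of "?S N"]) auto
    ultimately show ?thesis by (simp add: Lp_space_def)
  qed
  define I where "I N = (\<integral>\<^sup>+z\<in>hemi_triangle. ennreal (\<bar>?S N z - g' z\<bar> powr p) \<partial>lborel)" for N
  have I: "I \<longlonglongrightarrow> 0"
    unfolding I_def by (rule hemi_partial_sum_tendsto[OF assms(1) g' eq fin])
  \<comment> \<open>The Bochner integral inside \<open>Lp_norm\<close> is the real value of the
    extended integral \<open>I N\<close>; as the limit 0 is finite, convergence passes through
    \<open>enn2real\<close> and the p-th root.\<close>
  have norm: "Lp_norm ?M p (\<lambda>z. ?S N z - antisym_part f z) = enn2real (I N) powr (1 / p)" for N
  proof -
    have ae: "AE z in lborel. z \<in> hemi_triangle \<longrightarrow> \<bar>?S N z - antisym_part f z\<bar> powr p = \<bar>?S N z - g' z\<bar> powr p"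
      using eq by eventually_elim auto
    have "integral\<^sup>L ?M (\<lambda>z. \<bar>?S N z - antisym_part f z\<bar> powr p) = integral\<^sup>L ?M (\<lambda>z. \<bar>?S N z - g' z\<bar> powr p)"
    proof (rule integral_cong_AE)
      show "(\<lambda>z. \<bar>?S N z - antisym_part f z\<bar> powr p) \<in> borel_measurable ?M"
        by (rule measurable_lebesgue_on_AE[OF _ ae]) auto
      show "(\<lambda>z. \<bar>?S N z - g' z\<bar> powr p) \<in> borel_measurable ?M"
        by (rule measurable_lebesgue_on_AE[of "\<lambda>z. \<bar>?S N z - g' z\<bar> powr p"]) auto
      show "AE z in ?M. \<bar>?S N z - antisym_part f z\<bar> powr p = \<bar>?S N z - g' z\<bar> powr p"
        by (rule AE_lebesgue_on[OF ae]) simp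
    qed
    also have "\<dots> = (LINT z:hemi_triangle|lborel. \<bar>?S N z - g' z\<bar> powr p)"
      by (rule integral_lebesgue_on_borel) auto
    also have "\<dots> = enn2real (\<integral>\<^sup>+z. ennreal (indicator hemi_triangle z *\<^sub>R (\<bar>?S N z - g' z\<bar> powr p)) \<partial>lborel)"
      unfolding set_lebesgue_integral_def by (rule integral_eq_nn_integral) auto
    also have "(\<integral>\<^sup>+z. ennreal (indicator hemi_triangle z *\<^sub>R (\<bar>?S N z - g' z\<bar> powr p)) \<partial>lborel) = I N"
      unfolding I_def by (intro nn_integral_cong) (auto simp: indicator_def)
    finally show ?thesis by (simp add: Lp_norm_def)
  qed
  have "(\<lambda>N. enn2real (I N)) \<longlonglongrightarrow> enn2real 0"
    using I by (intro tendsto_enn2real) auto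
  then have "(\<lambda>N. enn2real (I N) powr (1 / p)) \<longlonglongrightarrow> 0"
    using assms(1) by (intro tendsto_zero_powrI[where b = "1 / p"]) auto
  then show ?thesis
    using gp SN unfolding Lp_converges_def norm by simp
qed

end
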